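(* Consider a distillation setting (as defined in the context) in which every initial subsystem state $\rho^N_n$ is energy-incoherent with respect to $H^N_n$. Then: (i) For every $N$ there exists a thermal operation $\mathcal{E}$ from the initial system (Hamiltonian $H^N$) to the target system (Hamiltonian $\tilde H^N$) such that $$\delta\big(\mathcal{E}(\rho^N),\,|\tilde E^N_k\rangle\langle\tilde E^N_k|\big)\;\le\;\Phi\!\left(-\frac{\Delta F^N}{\sigma(F^N)}\right)+\frac{C\,\kappa^3(F^N)}{\sigma^3(F^N)},$$ where $C$ is the universal constant of the Berry–Esseen theorem for sums of independent (not necessarily identically distributed) real random variables, i.e. $\sup_x\big|\Pr[\sum_n (X_n-\mathbb{E}X_n)\le x\sqrt{\sum_n\mathrm{Var}X_n}]-\Phi(x)\big|\le C\sum_n\mathbb{E}|X_n-\mathbb{E}X_n|^3/(\sum_n \mathrm{Var}X_n)^{3/2}$ (the paper quotes $0.4097\le C\le 0.4748$). (ii) The optimal transformation error satisfies $$\lim_{N\to\infty}\epsilon_N=\lim_{N\to\infty}\Phi\!\left(-\frac{\Delta F^N}{\sigma(F^N)}\right),$$ whenever the limit on the right-hand side exists.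
   Context: Fix an inverse temperature $\beta>0$; all logarithms are natural. For a finite-dimensional system with Hamiltonian $H$, its Gibbs state is $\gamma=e^{-\beta H}/\mathrm{tr}\,e^{-\beta H}$. A thermal operation from a system with Hamiltonian $H$ to a system with Hamiltonian $H'$ is a channel $\mathcal{E}(\rho)=\mathrm{tr}_{E'}[U(\rho\otimes\gamma_E)U^\dagger]$, where $E$ is an environment with some Hamiltonian $H_E$ and Gibbs state $\gamma_E$ at the same $\beta$, $U$ is a unitary with $[U,H\otimes\mathbb{1}+\mathbb{1}\otimes H_E]=0$, and $E'$ is a subsystem of system+environment whose complement is the output system with Hamiltonian $H'$ (the total Hamiltonian being the sum of $H'$ and the Hamiltonian of $E'$). A state $\rho$ is energy-incoherent if $[\rho,H]=0$. The infidelity is $\delta(\rho_1,\rho_2)=1-\big(\mathrm{tr}\sqrt{\sqrt{\rho_1}\rho_2\sqrt{\rho_1}}\big)^2$. For states $\rho$ and Gibbs state $\gamma$: $D(\rho\|\gamma)=\mathrm{tr}[\rho(\log\rho-\log\gamma)]$, $V(\rho\|\gamma)=\mathrm{tr}[\rho(\log\rho-\log\gamma-D(\rho\|\gamma))^2]$, $Y(\rho\|\gamma)=\mathrm{tr}[\rho|\log\rho-\log\gamma-D(\rho\|\gamma)|^3]$. $\Phi$ is the standard normal cumulative distribution function. Distillation setting: for each $N\in\mathbb{N}$, the initial system consists of $N$ non-interacting finite-dimensional subsystems with Hamiltonians $H^N_n$ ($n=1,\dots,N$), total Hamiltonian $H^N=\sum_n H^N_n$, in the product state $\rho^N=\bigotimes_{n=1}^N\rho^N_n$;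 $\gamma^N_n$ denotes the Gibbs state of $H^N_n$. The target system has an arbitrary Hamiltonian $\tilde H^N$ with Gibbs state $\tilde\gamma^N$, and the target state is $|\tilde E^N_k\rangle\langle\tilde E^N_k|$ for some eigenvector $|\tilde E^N_k\rangle$ of $\tilde H^N$. The optimal transformation error $\epsilon_N$ is the infimum of $\delta(\mathcal{E}(\rho^N),|\tilde E^N_k\rangle\langle\tilde E^N_k|)$ over thermal operations $\mathcal{E}$ from $H^N$ to $\tilde H^N$. Define $F^N=\frac1\beta\sum_n D(\rho^N_n\|\gamma^N_n)$, $\sigma^2(F^N)=\frac1{\beta^2}\sum_n V(\rho^N_n\|\gamma^N_n)$, $\kappa^3(F^N)=\frac1{\beta^3}\sum_n Y(\rho^N_n\|\gamma^N_n)$, and $\Delta F^N=\frac1\beta\big(\sum_n D(\rho^N_n\|\gamma^N_n)-D(|\tilde E^N_k\rangle\langle\tilde E^N_k|\,\|\,\tilde\gamma^N)\big)$. Standing assumptions: the limits $\lim_{N}\sigma^2(F^N)/N$ and $\lim_N\kappa^3(F^N)/N$ exist, are finite and nonzero; all Gibbs distributions involved have rational entries. *)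

theory Defs
  imports "HOL-Probability.Probability" "Jordan_Normal_Form.Jordan_Normal_Form"
begin

definition adj :: "complex mat \<Rightarrow> complex mat" where
  "adj A = Matrix.mat (dim_col A) (dim_row A) (\<lambda>(i,j). cnj (A $$ (j,i)))"

definition mtrace :: "complex mat \<Rightarrow> complex" where
  "mtrace A = (\<Sum>i<dim_row A. A $$ (i,i))"

definition hermitian :: "complex mat \<Rightarrow> bool" where
  "hermitian A \<longleftrightarrow> A \<in> carrier_mat (dim_row A) (dim_row A) \<and> adj A = A"

definition unitary :: "complex mat \<Rightarrow> bool" where
  "unitary U \<longleftrightarrow> U \<in> carrier_mat (dim_row U) (dim_row U) \<and> adj U * U = 1\<^sub>m (dim_row U)"

text \<open>Functional calculus for Hermitian matrices: f(A) = U diag(f(lambda_i)) U^* for any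
  unitary diagonalisation A = U diag(lambda_i) U^* (well defined for Hermitian A).\<close>
definition mat_fun :: "(real \<Rightarrow> real) \<Rightarrow> complex mat \<Rightarrow> complex mat" where
  "mat_fun f A = (SOME B. \<exists>U (lam :: nat \<Rightarrow> real).
      unitary U \<and> U \<in> carrier_mat (dim_row A) (dim_row A) \<and>
      A = U * mat_diag (dim_row A) (\<lambda>i. complex_of_real (lam i)) * adj U \<and>
      B = U * mat_diag (dim_row A) (\<lambda>i. complex_of_real (f (lam i))) * adj U)"

definition mexp :: "complex mat \<Rightarrow> complex mat" where "mexp = mat_fun exp"
definition mlog :: "complex mat \<Rightarrow> complex mat" where "mlog = mat_fun ln"
definition msqrt :: "complex mat \<Rightarrow> complex mat" where "msqrt = mat_fun sqrt"

text \<open>Kronecker (tensor) product, with the first factor as the most significant index.\<close>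
definition kron :: "complex mat \<Rightarrow> complex mat \<Rightarrow> complex mat" where
  "kron A B = Matrix.mat (dim_row A * dim_row B) (dim_col A * dim_col B)
     (\<lambda>(i,j). A $$ (i div dim_row B, j div dim_col B) * B $$ (i mod dim_row B, j mod dim_col B))"

definition ptrace2 :: "nat \<Rightarrow> nat \<Rightarrow> complex mat \<Rightarrow> complex mat" where
  "ptrace2 d1 d2 M = Matrix.mat d1 d1 (\<lambda>(i,j). \<Sum>k<d2. M $$ (i * d2 + k, j * d2 + k))"

fun kron_list :: "complex mat list \<Rightarrow> complex mat" where
  "kron_list [] = 1\<^sub>m 1"
| "kron_list (A # As) = kron A (kron_list As)"

fun ham_sum :: "complex mat list \<Rightarrow> complex mat" where
  "ham_sum [] = 0\<^sub>m 1 1"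
| "ham_sum (H # Hs) = kron H (1\<^sub>m (dim_row (kron_list Hs))) + kron (1\<^sub>m (dim_row H)) (ham_sum Hs)"

definition density_op :: "nat \<Rightarrow> complex mat \<Rightarrow> bool" where
  "density_op d \<rho> \<longleftrightarrow> \<rho> \<in> carrier_mat d d \<and> hermitian \<rho> \<and>
     (\<forall>v \<in> carrier_vec d. 0 \<le> Re (\<Sum>i<d. \<Sum>j<d. cnj (v $ i) * \<rho> $$ (i,j) * v $ j)) \<and> mtrace \<rho> = 1"

definition proj :: "complex Matrix.vec \<Rightarrow> complex mat" where
  "proj v = Matrix.mat (dim_vec v) (dim_vec v) (\<lambda>(i,j). v $ i * cnj (v $ j))"

definition gibbs :: "real \<Rightarrow> complex mat \<Rightarrow> complex mat" where
  "gibbs \<beta> H = (1 / mtrace (mexp ((- complex_of_real \<beta>) \<cdot>\<^sub>m H))) \<cdot>\<^sub>m mexp ((- complex_of_real \<beta>) \<cdot>\<^sub>m H)"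

text \<open>Thermal operations from a system with Hamiltonian H to one with Hamiltonian H'.
  V = W U combines the energy-conserving unitary U (commuting with H + H_E) and the
  identification W of system+environment with output (x) E' under which the total Hamiltonian
  becomes H' + H_{E'}.\<close>
definition thermal_ops :: "real \<Rightarrow> complex mat \<Rightarrow> complex mat \<Rightarrow> (complex mat \<Rightarrow> complex mat) set" where
  "thermal_ops \<beta> H H' = {Ch. \<exists>dE HE dE' HE' V.
      0 < dE \<and> HE \<in> carrier_mat dE dE \<and> hermitian HE \<and>
      HE' \<in> carrier_mat dE' dE' \<and> hermitian HE' \<and>
      dim_row H * dE = dim_row H' * dE' \<and>
      V \<in> carrier_mat (dim_row H * dE) (dim_row H * dE) \<and> unitary V \<and>
      V * (kron H (1\<^sub>m dE) + kron (1\<^sub>m (dim_row H)) HE)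
        = (kron H' (1\<^sub>m dE') + kron (1\<^sub>m (dim_row H')) HE') * V \<and>
      (\<forall>\<rho> \<in> carrier_mat (dim_row H) (dim_row H).
         Ch \<rho> = ptrace2 (dim_row H') dE' (V * kron \<rho> (gibbs \<beta> HE) * adj V))}"

definition infid :: "complex mat \<Rightarrow> complex mat \<Rightarrow> real" where
  "infid \<rho>1 \<rho>2 = 1 - (Re (mtrace (msqrt (msqrt \<rho>1 * \<rho>2 * msqrt \<rho>1)))) ^ 2"

definition relD :: "complex mat \<Rightarrow> complex mat \<Rightarrow> real" where
  "relD \<rho> \<gamma> = Re (mtrace (\<rho> * (mlog \<rho> - mlog \<gamma>)))"

definition relV :: "complex mat \<Rightarrow> complex mat \<Rightarrow> real" where
  "relV \<rho> \<gamma> = (let X = mlog \<rho> - mlog \<gamma> - complex_of_real (relD \<rho> \<gamma>) \<cdot>\<^sub>m 1\<^sub>m (dim_row \<rho>)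
                in Re (mtrace (\<rho> * (X * X))))"

definition relY :: "complex mat \<Rightarrow> complex mat \<Rightarrow> real" where
  "relY \<rho> \<gamma> = (let X = mlog \<rho> - mlog \<gamma> - complex_of_real (relD \<rho> \<gamma>) \<cdot>\<^sub>m 1\<^sub>m (dim_row \<rho>)
                in Re (mtrace (\<rho> * mat_fun (\<lambda>x. \<bar>x\<bar> ^ 3) X)))"

definition Phi :: "real \<Rightarrow> real" where
  "Phi x = (LINT t:{..x}|lborel. std_normal_density t)"

definition berry_esseen_const :: "real \<Rightarrow> bool" where
  "berry_esseen_const C \<longleftrightarrow>
    (\<forall>(N::nat) (\<mu> :: nat \<Rightarrow> real measure).
      (\<forall>n<N. prob_space (\<mu> n) \<and> sets (\<mu> n) = sets borel \<and> integrable (\<mu> n) (\<lambda>x. \<bar>x\<bar> ^ 3)) \<longrightarrow>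
      (let m = (\<lambda>n. \<integral>x. x \<partial>\<mu> n);
           var = (\<Sum>n<N. \<integral>x. (x - m n)\<^sup>2 \<partial>\<mu> n);
           rho = (\<Sum>n<N. \<integral>x. \<bar>x - m n\<bar> ^ 3 \<partial>\<mu> n)
       in 0 < var \<longrightarrow>
          (\<forall>x. \<bar>measure (PiM {..<N} \<mu>)
                   {f \<in> space (PiM {..<N} \<mu>). (\<Sum>n<N. f n - m n) \<le> x * sqrt var} - Phi x\<bar>
               \<le> C * rho / var powr (3/2))))"

end

theory Submission
  imports Defs "Jordan_Normal_Form.Spectral_Radius" "HOL-Real_Asymp.Real_Asymp"
begin

text \<open>
  All states involved commute with the Hamiltonians, so each \<open>\<rho> N n\<close> and its Gibbs state become probability
  vectors \<open>p\<close>, \<open>g\<close> in a joint eigenbasis, and \<open>relD\<close>, \<open>relV\<close>, \<open>relY\<close> are the mean, variance and third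
  absolute central moment of \<open>ln p - ln g\<close>. Let \<open>\<Lambda>\<close> be the sum over \<open>n\<close> of these independent variables and
  let \<open>\<gamma>\<close> be the Gibbs weight of the target level, so that its relative entropy is \<open>- ln \<gamma>\<close>.

  Achievability: the set \<open>S\<close> of levels with \<open>\<Lambda> \<ge> - ln \<gamma>\<close> has Gibbs weight at most \<open>\<gamma>\<close>, and strictly less
  unless \<open>\<Lambda>\<close> is constant, which a positive variance excludes. Take as bath one copy of the target and
  many copies of system plus target, all thermal. Inside an energy shell of the resulting strings, exchangeability of the
  positions and an exponential moment bound make the strings starting in \<open>S\<close> fewer than those whose first
  target letter is the target level, so an energy-conserving permutation maps the former into the latter.
  The error tends to \<open>P(\<Lambda> < - ln \<gamma>)\<close> with growing bath. A finite bath need not attain this limit, but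
  \<open>P(\<Lambda> < - ln \<gamma>) = P(\<Lambda> \<le> y)\<close> for some \<open>y < - ln \<gamma>\<close>, so that strict monotonicity of \<open>Phi\<close> leaves room
  below the Berry--Esseen bound.

  Converse: a thermal operation preserves Gibbs states, so its overlap with the target is the success
  probability of a test passing the Gibbs state with probability \<open>\<gamma>\<close>; hence the error is at least
  \<open>P(\<Lambda> \<le> - ln \<gamma> - s) - exp (- s)\<close> for every \<open>s\<close>. With \<open>s\<close> growing more slowly than the standard deviation,
  Lyapunov's central limit theorem makes both bounds converge to the same limit.
\<close>

unbundle no vec_syntax

section \<open>Unitary diagonalisation\<close>

text \<open>Two features of the statement shape the proof. Part (i) is claimed at every fixed
  \<open>N\<close>, with no error beyond the Berry--Esseen term, and takes a constant satisfying
  \<open>berry_esseen_const\<close> as a hypothesis; part (ii) has no such constant at hand, hence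
  the separate limit theorem. The copy of the target in the bath makes the system together with this
  copy a letter of the same kind as all others. Reading the first letter of the permuted string as
  target first and system second then yields output and discarded environment with matching
  dimensions and Hamiltonians. Exchangeability replaces any asymptotic counting of shells: energy
  and letter counts are both invariant under rearrangement, so the strings compared form a
  rearrangement-closed set. The only quantitative input is a Chernoff bound on the strings with too
  many letters in \<open>S\<close>. In the converse, energy conservation turns the squared
  amplitudes between energy eigenbases into a doubly stochastic matrix that links only equal
  energies; this is why Gibbs weights are transported exactly.\<close>

lemma adj_carrier [simp]: "A \<in> carrier_mat n m \<Longrightarrow> adj A \<in> carrier_mat m n"
  by (auto simp: adj_def)

lemma dim_adj [simp]: "dim_row (adj A) = dim_col A" "dim_col (adj A) = dim_row A"
  by (auto simp: adj_def)

lemma adj_index [simp]: "i < dim_col A \<Longrightarrow> j < dim_row A \<Longrightarrow> adj A $$ (i,j) = cnj (A $$ (j,i))"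
  by (auto simp: adj_def)

lemma adj_adj [simp]: "adj (adj A) = A"
  by (rule eq_matI) auto

lemma index_mult_sum:
  assumes "A \<in> carrier_mat n m" "B \<in> carrier_mat m l" "i < n" "j < l"
  shows "(A * B) $$ (i,j) = (\<Sum>k<m. A $$ (i,k) * B $$ (k,j))"
  using assms by (auto simp: scalar_prod_def atLeast0LessThan)

lemma adj_mult:
  assumes "A \<in> carrier_mat n m" "B \<in> carrier_mat m l"
  shows "adj (A * B) = adj B * adj A"
proof (rule eq_matI)
  fix i j assume ij: "i < dim_row (adj B * adj A)" "j < dim_col (adj B * adj A)"
  then have i: "i < l" and j: "j < n" using assms by auto
  have "adj (A * B) $$ (i,j) = cnj ((A * B) $$ (j,i))" using i j assms by auto
  also have "\<dots> = (\<Sum>k<m. cnj (A $$ (j,k)) * cnj (B $$ (k,i)))"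
    by (subst index_mult_sum[OF assms j i]) simp
  also have "\<dots> = (adj B * adj A) $$ (i,j)"
    using assms i j by (subst index_mult_sum[of _ l m _ n]) (auto simp: mult.commute intro!: sum.cong)
  finally show "adj (A * B) $$ (i,j) = (adj B * adj A) $$ (i,j)" .
qed (use assms in auto)

lemma adj_one [simp]: "adj (1\<^sub>m n) = 1\<^sub>m n"
  by (rule eq_matI) auto

lemma mat_diag_index [simp]: "i < n \<Longrightarrow> j < n \<Longrightarrow> mat_diag n f $$ (i,j) = (if i = j then f j else 0)"
  by (auto simp: mat_diag_def)

lemma dim_mat_diag [simp]: "dim_row (mat_diag n f) = n" "dim_col (mat_diag n f) = n"
  by (auto simp: mat_diag_def)

lemma unitaryD:
  assumes "unitary U" "U \<in> carrier_mat n n"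
  shows "adj U * U = 1\<^sub>m n" "U * adj U = 1\<^sub>m n"
proof -
  show 1: "adj U * U = 1\<^sub>m n" using assms by (auto simp: unitary_def)
  show "U * adj U = 1\<^sub>m n" by (rule mat_mult_left_right_inverse[OF _ assms(2) 1]) (use assms in auto)
qed

lemma unitaryI: "U \<in> carrier_mat n n \<Longrightarrow> adj U * U = 1\<^sub>m n \<Longrightarrow> unitary U"
  by (auto simp: unitary_def)

lemma unitary_one: "unitary (1\<^sub>m n)"
  by (rule unitaryI[of _ n]) auto

lemma unitary_adj:
  assumes "unitary U" "U \<in> carrier_mat n n"
  shows "unitary (adj U)"
  by (rule unitaryI[of _ n]) (use assms unitaryD[OF assms] in auto)

lemma unitary_mult:
  assumes "unitary U" "U \<in> carrier_mat n n" "unitary W" "W \<in> carrier_mat n n"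
  shows "unitary (U * W)"
proof (rule unitaryI[of _ n])
  have c: "adj U \<in> carrier_mat n n" "adj W \<in> carrier_mat n n" using assms by auto
  have "adj (U * W) * (U * W) = adj W * (adj U * U) * W"
    by (subst adj_mult[OF assms(2,4)]) (use assms c in \<open>simp add: assoc_mult_mat[of _ n n _ n _ n] mult_carrier_mat[of _ n n _ n]\<close>)
  also have "\<dots> = 1\<^sub>m n" using assms c by (simp add: unitaryD[OF assms(1,2)] unitaryD[OF assms(3,4)])
  finally show "adj (U * W) * (U * W) = 1\<^sub>m n" .
qed (use assms in auto)

lemma unitary_cols:
  assumes "unitary U" "U \<in> carrier_mat n n" "i < n" "j < n"
  shows "(\<Sum>k<n. cnj (U $$ (k,i)) * U $$ (k,j)) = (if i = j then 1 else 0)"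
proof -
  have "(adj U * U) $$ (i,j) = (\<Sum>k<n. cnj (U $$ (k,i)) * U $$ (k,j))"
    using assms by (subst index_mult_sum[of _ n n _ n]) auto
  then show ?thesis using assms unitaryD[OF assms(1,2)] by simp
qed

lemma unitary_rows:
  assumes "unitary U" "U \<in> carrier_mat n n" "i < n" "j < n"
  shows "(\<Sum>k<n. U $$ (i,k) * cnj (U $$ (j,k))) = (if i = j then 1 else 0)"
proof -
  have "(U * adj U) $$ (i,j) = (\<Sum>k<n. U $$ (i,k) * cnj (U $$ (j,k)))"
    using assms by (subst index_mult_sum[of _ n n _ n]) auto
  then show ?thesis using assms unitaryD[OF assms(1,2)] by simp
qed

text \<open>Gram--Schmidt keeps the head of a completed basis, so after normalising the columns the
  first one is still a nonzero multiple of \<open>v\<close>. This is the deflation step for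
  \<open>normal_diagonalisable\<close>.\<close>

lemma unitary_first_column:
  fixes v :: "complex Matrix.vec"
  assumes v: "v \<in> carrier_vec n" and v0: "v \<noteq> 0\<^sub>v n"
  shows "\<exists>W c. W \<in> carrier_mat n n \<and> unitary W \<and> c \<noteq> 0 \<and> (\<forall>i<n. W $$ (i,0) = c * v $ i)"
proof -
  have n: "n \<noteq> 0" using v v0 by (auto simp: zero_vec_def)
  interpret cof_vec_space n "TYPE(complex)" .
  define b where "b = basis_completion v"
  define ws where "ws = gram_schmidt n b"
  from basis_completion[OF v v0, folded b_def]
  have dist_b: "distinct b" 
    and indep: "\<not> lin_dep (set b)" and b: "set b \<subseteq> carrier_vec n" and hdb: "hd b = v" 
    and len_b: "length b = n" by auto
  from hdb len_b n obtain vs where bv: "b = v # vs" by (cases b, auto)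
  from gram_schmidt_result[OF b dist_b indep refl, folded ws_def]
  have ws: "set ws \<subseteq> carrier_vec n" "corthogonal ws" "length ws = n" 
    by (auto simp: len_b)
  from gram_schmidt_hd[OF v, of vs, folded bv] have hdws: "hd ws = v" unfolding ws_def .
  then have ws0: "ws ! 0 = v" using ws n by (metis hd_conv_nth length_0_conv)
  define nn where "nn j = (\<Sum>k<n. (cmod (ws ! j $ k))\<^sup>2)" for j
  have sp: "(ws ! i) \<bullet>c (ws ! j) = (\<Sum>k<n. ws ! i $ k * cnj (ws ! j $ k))" if "i < n" "j < n" for i j
  proof -
    have "ws ! j \<in> carrier_vec n" using ws that by auto
    then show ?thesis by (auto simp: scalar_prod_def atLeast0LessThan)
  qed
  have nn: "(ws ! j) \<bullet>c (ws ! j) = complex_of_real (nn j)" if "j < n" for j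
    unfolding sp[OF that that] nn_def of_real_sum by (rule sum.cong, simp, rule complex_norm_square[symmetric])
  have nnpos: "nn j > 0" if "j < n" for j
  proof -
    have "nn j \<ge> 0" unfolding nn_def by (auto intro: sum_nonneg)
    moreover have "nn j \<noteq> 0" using corthogonalD[OF ws(2), of j j] that ws nn[OF that] by auto
    ultimately show ?thesis by simp
  qed
  define W where "W = Matrix.mat n n (\<lambda>(i,j). (ws ! j) $ i / complex_of_real (sqrt (nn j)))"
  have W: "W \<in> carrier_mat n n" unfolding W_def by auto
  have "unitary W"
  proof (rule unitaryI[OF W], rule eq_matI)
    fix i j assume "i < dim_row (1\<^sub>m n :: complex mat)" "j < dim_col (1\<^sub>m n :: complex mat)"
    then have i: "i < n" and j: "j < n" by auto
    have "(adj W * W) $$ (i,j) = (\<Sum>k<n. cnj (W $$ (k,i)) * W $$ (k,j))"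
      using W i j by (subst index_mult_sum[of _ n n _ n]) auto
    also have "\<dots> = (\<Sum>k<n. ws ! j $ k * cnj (ws ! i $ k)) / (complex_of_real (sqrt (nn i)) * complex_of_real (sqrt (nn j)))"
      unfolding sum_divide_distrib using i j by (intro sum.cong) (auto simp: W_def)
    also have "\<dots> = (if i = j then 1 else 0)"
    proof (cases "i = j")
      case True
      have "complex_of_real (sqrt (nn j)) * complex_of_real (sqrt (nn j)) = complex_of_real (nn j)"
        using nnpos[OF j] by (simp flip: of_real_mult)
      then show ?thesis using True nn[OF j] sp[OF j j] nnpos[OF j] by auto
    next
      case False
      then show ?thesis using corthogonalD[OF ws(2), of j i] i j ws sp[OF j i] by auto
    qed
    finally show "(adj W * W) $$ (i,j) = 1\<^sub>m n $$ (i,j)" using i j by simp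
  qed (use W in auto)
  moreover have "\<forall>i<n. W $$ (i,0) = (1 / complex_of_real (sqrt (nn 0))) * v $ i"
    using n by (auto simp: W_def ws0)
  moreover have "1 / complex_of_real (sqrt (nn 0)) \<noteq> 0" using nnpos[of 0] n by auto
  ultimately show ?thesis using W by blast
qed

text \<open>Conjugation by a unitary whose first column is an eigenvector clears the first column
  below the corner; normality then clears the first row, and the remaining block is normal again.
  Normal instead of Hermitian matrices are treated because a commuting Hermitian pair is
  diagonalised through one normal matrix.\<close>

lemma normal_diagonalisable:
  assumes "M \<in> carrier_mat n n" "M * adj M = adj M * M"
  shows "\<exists>U c. U \<in> carrier_mat n n \<and> unitary U \<and> M = U * mat_diag n c * adj U"
  using assms
proof (induction n arbitrary: M)
  case 0
  then show ?case
    by (intro exI[of _ "1\<^sub>m 0"] exI[of _ "\<lambda>_. 0"]) (auto simp: unitary_one intro!: eq_matI)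
next
  case (Suc m)
  let ?n = "Suc m"
  note M = Suc.prems(1)
  obtain e where "eigenvalue M e"
    using spectrum_non_empty[OF M] unfolding spectrum_def by auto
  then obtain v where v: "v \<in> carrier_vec ?n" "v \<noteq> 0\<^sub>v ?n" "M *\<^sub>v v = e \<cdot>\<^sub>v v"
    using M unfolding eigenvalue_def eigenvector_def by auto
  from unitary_first_column[OF v(1,2)] obtain W c where W: "W \<in> carrier_mat ?n ?n" "unitary W" "c \<noteq> 0"
    and Wv: "\<forall>i<?n. W $$ (i,0) = c * v $ i" by auto
  define B where "B = adj W * M * W"
  have B: "B \<in> carrier_mat ?n ?n" unfolding B_def using W M by auto
  have MW0: "(M * W) $$ (i,0) = e * W $$ (i,0)" if "i < ?n" for i
  proof -
    have "(M *\<^sub>v v) $ i = (\<Sum>k<?n. M $$ (i,k) * v $ k)"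
      using M v(1) that by (auto simp: scalar_prod_def atLeast0LessThan)
    then have "(\<Sum>k<?n. M $$ (i,k) * v $ k) = e * v $ i" using v that by auto
    then have "c * (\<Sum>k<?n. M $$ (i,k) * v $ k) = e * (c * v $ i)" by simp
    then have "(\<Sum>k<?n. M $$ (i,k) * W $$ (k,0)) = e * W $$ (i,0)"
      using Wv that by (simp add: sum_distrib_left mult.left_commute del: sum.lessThan_Suc)
    then show ?thesis using that M W by (subst index_mult_sum[of _ ?n ?n _ ?n]) auto
  qed
  have B0: "B $$ (i,0) = (if i = 0 then e else 0)" if "i < ?n" for i
  proof -
    have "B = adj W * (M * W)" unfolding B_def using W M by (intro assoc_mult_mat) auto
    then have "B $$ (i,0) = (\<Sum>k<?n. cnj (W $$ (k,i)) * (M * W) $$ (k,0))"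
      using that W M by (simp add: index_mult_sum[of "adj W" ?n ?n "M * W" ?n] del: sum.lessThan_Suc index_mult_mat)
    also have "\<dots> = e * (\<Sum>k<?n. cnj (W $$ (k,i)) * W $$ (k,0))"
      unfolding sum_distrib_left by (intro sum.cong) (auto simp: MW0)
    also have "\<dots> = (if i = 0 then e else 0)"
      using unitary_cols[OF W(2,1) that, of 0] by simp
    finally show ?thesis .
  qed
  have aW: "adj W \<in> carrier_mat ?n ?n" and aM: "adj M \<in> carrier_mat ?n ?n" and aB: "adj B \<in> carrier_mat ?n ?n"
    using W M B by auto
  have adjB: "adj B = adj W * adj M * W"
    unfolding B_def using W M aW aM
    by (simp add: adj_mult[of _ ?n ?n _ ?n] assoc_mult_mat[of _ ?n ?n _ ?n _ ?n] mult_carrier_mat[of _ ?n ?n _ ?n])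
  have cancel: "X * W * (adj W * Y) = X * Y" if "X \<in> carrier_mat ?n ?n" "Y \<in> carrier_mat ?n ?n" for X Y
  proof -
    have "X * W * (adj W * Y) = X * (W * adj W) * Y"
      using that W aW by (simp add: assoc_mult_mat[of _ ?n ?n _ ?n _ ?n] mult_carrier_mat[of _ ?n ?n _ ?n])
    then show ?thesis using that unitaryD[OF W(2,1)] by simp
  qed
  have "B * adj B = adj W * (M * adj M) * W"
  proof -
    have "B * adj B = (adj W * M) * W * (adj W * (adj M * W))"
      unfolding adjB unfolding B_def using W M aW aM by (simp add: assoc_mult_mat[of _ ?n ?n _ ?n _ ?n] mult_carrier_mat[of _ ?n ?n _ ?n])
    also have "\<dots> = (adj W * M) * (adj M * W)" by (rule cancel) (use W M aW aM in auto)
    finally show ?thesis using W M aW aM by (simp add: assoc_mult_mat[of _ ?n ?n _ ?n _ ?n] mult_carrier_mat[of _ ?n ?n _ ?n])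
  qed
  moreover have "adj B * B = adj W * (adj M * M) * W"
  proof -
    have "adj B * B = (adj W * adj M) * W * (adj W * (M * W))"
      unfolding adjB unfolding B_def using W M aW aM by (simp add: assoc_mult_mat[of _ ?n ?n _ ?n _ ?n] mult_carrier_mat[of _ ?n ?n _ ?n])
    also have "\<dots> = (adj W * adj M) * (M * W)" by (rule cancel) (use W M aW aM in auto)
    finally show ?thesis using W M aW aM by (simp add: assoc_mult_mat[of _ ?n ?n _ ?n _ ?n] mult_carrier_mat[of _ ?n ?n _ ?n])
  qed
  ultimately have BB: "B * adj B = adj B * B" using Suc.prems(2) by simp
  have BBij: "(\<Sum>k<?n. B $$ (i,k) * cnj (B $$ (j,k))) = (\<Sum>k<?n. cnj (B $$ (k,i)) * B $$ (k,j))"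
    if "i < ?n" "j < ?n" for i j
  proof -
    have "(B * adj B) $$ (i,j) = (\<Sum>k<?n. B $$ (i,k) * cnj (B $$ (j,k)))"
      using B aB that by (subst index_mult_sum[of _ ?n ?n _ ?n]) (auto intro!: sum.cong simp del: sum.lessThan_Suc)
    moreover have "(adj B * B) $$ (i,j) = (\<Sum>k<?n. cnj (B $$ (k,i)) * B $$ (k,j))"
      using B aB that by (subst index_mult_sum[of _ ?n ?n _ ?n]) (auto intro!: sum.cong simp del: sum.lessThan_Suc)
    ultimately show ?thesis using BB by simp
  qed
  \<comment> \<open>Entry (0,0) of the normality identity equates the norms of the first row and the
    first column. They share the corner \<open>e\<close>, which exhausts the column.\<close>
  have row0: "B $$ (0, Suc j) = 0" if "j < m" for j
  proof -
    have "(\<Sum>k<?n. complex_of_real ((cmod (B $$ (0,k)))\<^sup>2)) = (\<Sum>k<?n. complex_of_real ((cmod (B $$ (k,0)))\<^sup>2))"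
    proof -
      have 1: "complex_of_real ((cmod (B $$ (0,k)))\<^sup>2) = B $$ (0,k) * cnj (B $$ (0,k))"
        "complex_of_real ((cmod (B $$ (k,0)))\<^sup>2) = cnj (B $$ (k,0)) * B $$ (k,0)" for k
        by (metis complex_norm_square mult.commute)+
      show ?thesis unfolding 1 by (rule BBij) auto
    qed
    then have "(\<Sum>k<?n. (cmod (B $$ (0,k)))\<^sup>2) = (\<Sum>k<?n. (cmod (B $$ (k,0)))\<^sup>2)"
      unfolding of_real_sum[symmetric] of_real_eq_iff .
    then have "(\<Sum>k<m. (cmod (B $$ (0,Suc k)))\<^sup>2) = 0"
      unfolding sum.lessThan_Suc_shift by (simp add: B0)
    then show ?thesis using that by (simp add: sum_nonneg_eq_0_iff)
  qed
  define B3 where "B3 = Matrix.mat m m (\<lambda>(i,j). B $$ (Suc i, Suc j))"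
  have B3: "B3 \<in> carrier_mat m m" unfolding B3_def by auto
  have "B3 * adj B3 = adj B3 * B3"
  proof (rule eq_matI)
    fix i j assume "i < dim_row (adj B3 * B3)" "j < dim_col (adj B3 * B3)"
    then have ij: "i < m" "j < m" using B3 by auto
    have "(B3 * adj B3) $$ (i,j) = (\<Sum>k<m. B3 $$ (i,k) * cnj (B3 $$ (j,k)))"
      using B3 ij by (subst index_mult_sum[of _ m m _ m]) auto
    also have "\<dots> = (\<Sum>k<?n. B $$ (Suc i,k) * cnj (B $$ (Suc j,k)))"
      unfolding sum.lessThan_Suc_shift using ij by (simp add: B3_def B0)
    also have "\<dots> = (\<Sum>k<?n. cnj (B $$ (k,Suc i)) * B $$ (k,Suc j))"
      using BBij ij by blast
    also have "\<dots> = (\<Sum>k<m. cnj (B3 $$ (k,i)) * B3 $$ (k,j))"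
      unfolding sum.lessThan_Suc_shift using ij by (simp add: B3_def row0)
    also have "\<dots> = (adj B3 * B3) $$ (i,j)"
      using B3 ij by (subst index_mult_sum[of _ m m _ m]) auto
    finally show "(B3 * adj B3) $$ (i,j) = (adj B3 * B3) $$ (i,j)" .
  qed (use B3 in auto)
  from Suc.IH[OF B3 this] obtain U3 d where U3: "U3 \<in> carrier_mat m m" "unitary U3"
    and B3eq: "B3 = U3 * mat_diag m d * adj U3" by auto
  define P where "P = Matrix.mat ?n ?n (\<lambda>(i,j). if i = 0 \<or> j = 0 then (if i = j then 1 else 0) else U3 $$ (i - 1, j - 1))"
  define d' where "d' i = (if i = 0 then e else d (i - 1))" for i
  have P: "P \<in> carrier_mat ?n ?n" unfolding P_def by auto
  have uP: "unitary P"
  proof (rule unitaryI[OF P], rule eq_matI)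
    fix i j assume "i < dim_row (1\<^sub>m ?n :: complex mat)" "j < dim_col (1\<^sub>m ?n :: complex mat)"
    then have ij: "i < ?n" "j < ?n" by auto
    have "(adj P * P) $$ (i,j) = (\<Sum>k<?n. cnj (P $$ (k,i)) * P $$ (k,j))"
      using P ij by (subst index_mult_sum[of _ ?n ?n _ ?n]) (auto intro!: sum.cong simp del: sum.lessThan_Suc)
    also have "\<dots> = (if i = j then 1 else 0)"
      unfolding sum.lessThan_Suc_shift
      using ij unitary_cols[OF U3(2,1), of "i - 1" "j - 1"] by (cases i; cases j) (auto simp: P_def)
    finally show "(adj P * P) $$ (i,j) = 1\<^sub>m ?n $$ (i,j)" using ij by simp
  qed (use P in auto)
  have Beq: "B = P * mat_diag ?n d' * adj P"
  proof (rule eq_matI)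
    fix i j assume "i < dim_row (P * mat_diag ?n d' * adj P)" "j < dim_col (P * mat_diag ?n d' * adj P)"
    then have ij: "i < ?n" "j < ?n" using P by auto
    have "(P * mat_diag ?n d' * adj P) $$ (i,j) = (\<Sum>k<?n. P $$ (i,k) * d' k * cnj (P $$ (j,k)))"
      unfolding mat_diag_mult_right[OF P]
      using P ij by (subst index_mult_sum[of _ ?n ?n _ ?n]) (auto intro!: sum.cong simp del: sum.lessThan_Suc)
    moreover have "B3 $$ (i,j) = (\<Sum>k<m. U3 $$ (i,k) * d k * cnj (U3 $$ (j,k)))" if "i < m" "j < m" for i j
      unfolding B3eq mat_diag_mult_right[OF U3(1)]
      using U3 that by (subst index_mult_sum[of _ m m _ m]) (auto intro!: sum.cong)
    ultimately show "B $$ (i,j) = (P * mat_diag ?n d' * adj P) $$ (i,j)"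
      unfolding sum.lessThan_Suc_shift using ij
      by (cases i; cases j) (auto simp: P_def d'_def B3_def B0 row0)
  qed (use B P in auto)
  have aP: "adj P \<in> carrier_mat ?n ?n" using P by auto
  have Dc: "mat_diag ?n d' \<in> carrier_mat ?n ?n" by simp
  have "M = W * B * adj W"
  proof -
    have "W * B * adj W = (W * adj W) * M * (W * adj W)"
      unfolding B_def using W M aW by (simp add: assoc_mult_mat[of _ ?n ?n _ ?n _ ?n] mult_carrier_mat[of _ ?n ?n _ ?n])
    then show ?thesis using unitaryD[OF W(2,1)] M by simp
  qed
  also have "\<dots> = (W * P) * mat_diag ?n d' * adj (W * P)"
    unfolding Beq adj_mult[OF W(1) P] using W P aW aP by (simp add: assoc_mult_mat[of _ ?n ?n _ ?n _ ?n] mult_carrier_mat[of _ ?n ?n _ ?n])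
  finally show ?case using unitary_mult[OF W(2,1) uP P] W P by (intro exI[of _ "W * P"] exI[of _ d']) auto
qed

section \<open>Functional calculus in an explicit eigenbasis\<close>

text \<open>Real eigenvalues with an explicit basis: once several commuting operators share
  \<open>U\<close>, products, traces and matrix functions become operations on real vectors.\<close>

definition spec :: "nat \<Rightarrow> complex mat \<Rightarrow> (nat \<Rightarrow> real) \<Rightarrow> complex mat" where
  "spec n U a = U * mat_diag n (\<lambda>i. complex_of_real (a i)) * adj U"

locale unitary_basis =
  fixes n :: nat and U :: "complex mat"
  assumes carrier [simp]: "U \<in> carrier_mat n n" and unitary: "unitary U"
begin

lemma dims [simp]: "dim_row U = n" "dim_col U = n"
  by (rule carrier_matD[OF carrier])+

lemma spec_carrier [simp]: "spec n U a \<in> carrier_mat n n"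
  unfolding spec_def by (metis adj_carrier carrier mat_diag_dim mult_carrier_mat)

lemma dim_spec [simp]: "dim_row (spec n U a) = n" "dim_col (spec n U a) = n"
  using spec_carrier by (metis carrier_matD)+

lemma spec_index:
  assumes "i < n" "j < n"
  shows "spec n U a $$ (i,j) = (\<Sum>l<n. U $$ (i,l) * complex_of_real (a l) * cnj (U $$ (j,l)))"
  unfolding spec_def mat_diag_mult_right[OF carrier]
  using assms by (subst index_mult_sum[of _ n n _ n]) auto

lemma spec_cong: "(\<And>i. i < n \<Longrightarrow> a i = b i) \<Longrightarrow> spec n U a = spec n U b"
  by (rule eq_matI) (auto simp: spec_index)

lemma spec_mult: "spec n U a * spec n U b = spec n U (\<lambda>i. a i * b i)"
proof -
  let ?A = "mat_diag n (\<lambda>i. complex_of_real (a i))" and ?B = "mat_diag n (\<lambda>i. complex_of_real (b i))"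
  have c: "adj U \<in> carrier_mat n n" "?A \<in> carrier_mat n n" "?B \<in> carrier_mat n n" by auto
  have "spec n U a * spec n U b = U * ?A * (adj U * U) * ?B * adj U"
    unfolding spec_def using c carrier
    by (simp add: assoc_mult_mat[of _ n n _ n _ n] mult_carrier_mat[of _ n n _ n] del: mat_diag_diag)
  also have "\<dots> = U * (?A * ?B) * adj U"
    using c carrier
    by (simp add: unitaryD[OF unitary carrier] assoc_mult_mat[of _ n n _ n _ n] mult_carrier_mat[of _ n n _ n] del: mat_diag_diag)
  finally show ?thesis by (simp add: spec_def)
qed

lemma spec_one: "1\<^sub>m n = spec n U (\<lambda>_. 1)"
  unfolding spec_def using unitaryD[OF unitary carrier] carrier by simp

lemma spec_minus: "spec n U a - spec n U b = spec n U (\<lambda>i. a i - b i)"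
  by (rule eq_matI) (auto simp: spec_index algebra_simps sum_subtractf)

lemma spec_smult: "complex_of_real c \<cdot>\<^sub>m spec n U a = spec n U (\<lambda>i. c * a i)"
  by (rule eq_matI) (auto simp: spec_index algebra_simps sum_distrib_left)

lemma mtrace_spec: "mtrace (spec n U a) = complex_of_real (\<Sum>i<n. a i)"
proof -
  have "mtrace (spec n U a) = (\<Sum>i<n. \<Sum>l<n. U $$ (i,l) * complex_of_real (a l) * cnj (U $$ (i,l)))"
    unfolding mtrace_def by (simp add: spec_index)
  also have "\<dots> = (\<Sum>l<n. complex_of_real (a l) * (\<Sum>i<n. cnj (U $$ (i,l)) * U $$ (i,l)))"
    by (subst sum.swap) (simp add: sum_distrib_left mult_ac)
  finally show ?thesis using unitary_cols[OF unitary carrier] by simp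
qed

lemma hermitian_spec: "hermitian (spec n U a)"
  unfolding hermitian_def by (auto intro!: eq_matI simp: spec_index mult_ac)

lemma conj_spec: "adj U * spec n U a * U = mat_diag n (\<lambda>i. complex_of_real (a i))"
proof -
  have c: "adj U \<in> carrier_mat n n" "mat_diag n (\<lambda>i. complex_of_real (a i)) \<in> carrier_mat n n" by auto
  have "adj U * spec n U a * U = (adj U * U) * mat_diag n (\<lambda>i. complex_of_real (a i)) * (adj U * U)"
    unfolding spec_def using c carrier
    by (simp add: assoc_mult_mat[of _ n n _ n _ n] mult_carrier_mat[of _ n n _ n])
  then show ?thesis using c carrier by (simp add: unitaryD[OF unitary carrier])
qed

end

text \<open>Transfers positivity of a quadratic form to the eigenvalues, for states as well as for
  partial traces.\<close>

lemma (in unitary_basis) quadratic_form_col: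
  assumes k: "k < n"
  shows "(\<Sum>i<n. \<Sum>j<n. cnj (U $$ (i,k)) * spec n U a $$ (i,j) * U $$ (j,k)) = complex_of_real (a k)"
proof -
  have "complex_of_real (a k) = (adj U * spec n U a * U) $$ (k,k)" unfolding conj_spec using k by simp
  also have "\<dots> = (\<Sum>j<n. (\<Sum>i<n. cnj (U $$ (i,k)) * spec n U a $$ (i,j)) * U $$ (j,k))"
    using k
    by (subst index_mult_sum[of _ n n _ n])
       (auto intro!: sum.cong mult_carrier_mat[of _ n n] simp: index_mult_sum[of "adj U" n n "spec n U a" n] simp del: index_mult_mat(1))
  also have "\<dots> = (\<Sum>i<n. \<Sum>j<n. cnj (U $$ (i,k)) * spec n U a $$ (i,j) * U $$ (j,k))"
    unfolding sum_distrib_right by (rule sum.swap)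
  finally show ?thesis ..
qed

text \<open>Two diagonalisations of the same matrix are related by a unitary that only mixes equal
  eigenvalues, hence commutes with any function of them.\<close>
lemma spec_fun_unique:
  assumes "unitary_basis n U" "unitary_basis n W" "spec n U a = spec n W b"
  shows "spec n U (\<lambda>i. f (a i)) = spec n W (\<lambda>i. f (b i))"
proof -
  interpret U: unitary_basis n U by fact
  interpret W: unitary_basis n W by fact
  define Q where "Q = adj W * U"
  have c [simp]: "adj U \<in> carrier_mat n n" "adj W \<in> carrier_mat n n" "Q \<in> carrier_mat n n"
    by (auto simp: Q_def)
  let ?D = "\<lambda>a. mat_diag n (\<lambda>i. complex_of_real (a i))"
  note assoc = assoc_mult_mat[of _ n n _ n _ n] mult_carrier_mat[of _ n n _ n]
  have WQ: "W * Q = U"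
    using unitaryD[OF W.unitary W.carrier]
    by (simp add: Q_def flip: assoc_mult_mat[of _ n n _ n _ n])
  have QU: "Q * adj U = adj W"
    using unitaryD[OF U.unitary U.carrier] by (simp add: Q_def assoc)
  have "Q * ?D a = adj W * spec n U a * U"
    unfolding spec_def Q_def by (simp add: assoc unitaryD[OF U.unitary U.carrier])
  also have "\<dots> = ?D b * Q"
  proof -
    have "adj W * spec n W b * U = (adj W * W) * ?D b * (adj W * U)"
      unfolding spec_def by (simp add: assoc)
    then show ?thesis using assms(3) unitaryD[OF W.unitary W.carrier] by (simp add: Q_def)
  qed
  finally have comm: "Q * ?D a = ?D b * Q" .
  have ab: "Q $$ (i,j) * complex_of_real (a j) = complex_of_real (b i) * Q $$ (i,j)" if "i < n" "j < n" for i j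
    using arg_cong[OF comm, of "\<lambda>M. M $$ (i,j)"] that
    by (simp add: mat_diag_mult_right[of Q n n] mat_diag_mult_left[of Q n n])
  have "Q $$ (i,j) = 0 \<or> a j = b i" if "i < n" "j < n" for i j
    using ab[OF that] by auto
  then have "Q * ?D (\<lambda>i. f (a i)) = ?D (\<lambda>i. f (b i)) * Q"
    by (intro eq_matI) (fastforce simp: mat_diag_mult_right[of Q n n] mat_diag_mult_left[of Q n n])+
  then have "W * (Q * ?D (\<lambda>i. f (a i))) * adj U = W * (?D (\<lambda>i. f (b i)) * Q) * adj U" by simp
  then have "(W * Q) * ?D (\<lambda>i. f (a i)) * adj U = W * ?D (\<lambda>i. f (b i)) * (Q * adj U)"
    by (simp add: assoc)
  then show ?thesis unfolding spec_def WQ QU .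
qed

context unitary_basis begin

text \<open>\<open>mat_fun\<close> chooses some diagonalisation; by \<open>spec_fun_unique\<close>
  the result does not depend on the choice, so it may be evaluated in the basis at hand.\<close>

lemma mat_fun_spec: "mat_fun f (spec n U a) = spec n U (\<lambda>i. f (a i))"
proof -
  have dr: "dim_row (spec n U a) = n" by simp
  show ?thesis unfolding mat_fun_def dr
  proof (rule someI2)
    show "\<exists>W lam. unitary W \<and> W \<in> carrier_mat n n \<and>
         spec n U a = W * mat_diag n (\<lambda>i. complex_of_real (lam i)) * adj W \<and>
         spec n U (\<lambda>i. f (a i)) = W * mat_diag n (\<lambda>i. complex_of_real (f (lam i))) * adj W"
      using unitary by (intro exI[of _ U] exI[of _ a]) (auto simp: spec_def)
  next
    fix B
    assume "\<exists>W lam. unitary W \<and> W \<in> carrier_mat n n \<and>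
         spec n U a = W * mat_diag n (\<lambda>i. complex_of_real (lam i)) * adj W \<and>
         B = W * mat_diag n (\<lambda>i. complex_of_real (f (lam i))) * adj W"
    then obtain W lam where W: "unitary W" "W \<in> carrier_mat n n" "spec n U a = spec n W lam"
      "B = spec n W (\<lambda>i. f (lam i))" by (auto simp: spec_def)
    then show "B = spec n U (\<lambda>i. f (a i))"
      using spec_fun_unique[of n U W a lam f] unitary_basis_axioms by (auto simp: unitary_basis_def)
  qed
qed

end

text \<open>Commutation makes \<open>A + \<i> B\<close> normal. In a unitary eigenbasis of it the
  real and imaginary parts of the eigenvalues belong to \<open>A\<close> and
  \<open>B\<close>.\<close>

lemma simultaneous_diagonalisation:
  assumes A: "A \<in> carrier_mat n n" "hermitian A" and B: "B \<in> carrier_mat n n" "hermitian B"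
    and comm: "A * B = B * A"
  obtains U a b where "unitary_basis n U" "A = spec n U a" "B = spec n U b"
proof -
  define M where "M = A + \<i> \<cdot>\<^sub>m B"
  have aA: "adj A = A" and aB: "adj B = B" using A B by (auto simp: hermitian_def)
  have M: "M \<in> carrier_mat n n" using A B by (auto simp: M_def)
  have aM: "adj M = A - \<i> \<cdot>\<^sub>m B"
  proof (rule eq_matI)
    fix i j assume "i < dim_row (A - \<i> \<cdot>\<^sub>m B)" "j < dim_col (A - \<i> \<cdot>\<^sub>m B)"
    then have ij: "i < n" "j < n" using A B by auto
    have "cnj (A $$ (j,i)) = A $$ (i,j)" "cnj (B $$ (j,i)) = B $$ (i,j)"
      using ij A B aA aB by (metis adj_index carrier_matD)+
    then show "adj M $$ (i,j) = (A - \<i> \<cdot>\<^sub>m B) $$ (i,j)" using ij A B by (simp add: M_def)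
  qed (use A B in \<open>auto simp: M_def\<close>)
  have "M * adj M = adj M * M"
  proof (rule eq_matI)
    fix i j assume "i < dim_row (adj M * M)" "j < dim_col (adj M * M)"
    then have ij: "i < n" "j < n" using M by auto
    have ab: "(\<Sum>k<n. A $$ (i,k) * B $$ (k,j)) = (\<Sum>k<n. B $$ (i,k) * A $$ (k,j))"
      using arg_cong[OF comm, of "\<lambda>M. M $$ (i,j)"] index_mult_sum[OF A(1) B(1) ij] index_mult_sum[OF B(1) A(1) ij]
      by simp
    have "(M * adj M) $$ (i,j) = (\<Sum>k<n. (A $$ (i,k) + \<i> * B $$ (i,k)) * (A $$ (k,j) - \<i> * B $$ (k,j)))"
      unfolding aM using A B M ij by (subst index_mult_sum[of _ n n _ n]) (auto simp: M_def)
    also have "\<dots> = (\<Sum>k<n. A $$ (i,k) * A $$ (k,j)) + (\<Sum>k<n. B $$ (i,k) * B $$ (k,j))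
        + \<i> * ((\<Sum>k<n. B $$ (i,k) * A $$ (k,j)) - (\<Sum>k<n. A $$ (i,k) * B $$ (k,j)))"
      by (simp add: algebra_simps sum.distrib sum_subtractf sum_distrib_left)
    also have "\<dots> = (\<Sum>k<n. A $$ (i,k) * A $$ (k,j)) + (\<Sum>k<n. B $$ (i,k) * B $$ (k,j))
        - \<i> * ((\<Sum>k<n. B $$ (i,k) * A $$ (k,j)) - (\<Sum>k<n. A $$ (i,k) * B $$ (k,j)))"
      using ab by simp
    also have "\<dots> = (\<Sum>k<n. (A $$ (i,k) - \<i> * B $$ (i,k)) * (A $$ (k,j) + \<i> * B $$ (k,j)))"
      by (simp add: algebra_simps sum.distrib sum_subtractf sum_distrib_left)
    also have "\<dots> = (adj M * M) $$ (i,j)"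
      unfolding aM using A B M ij by (subst index_mult_sum[of _ n n _ n]) (auto simp: M_def)
    finally show "(M * adj M) $$ (i,j) = (adj M * M) $$ (i,j)" .
  qed (use M in auto)
  from normal_diagonalisable[OF M this] obtain U c where U: "U \<in> carrier_mat n n" "unitary U"
    and Meq: "M = U * mat_diag n c * adj U" by auto
  interpret unitary_basis n U by unfold_locales (use U in auto)
  have Mij: "M $$ (i,j) = (\<Sum>k<n. U $$ (i,k) * c k * cnj (U $$ (j,k)))" if "i < n" "j < n" for i j
    unfolding Meq mat_diag_mult_right[OF U(1)]
    using that by (subst index_mult_sum[of _ n n _ n]) auto
  have aMij: "adj M $$ (i,j) = (\<Sum>k<n. U $$ (i,k) * cnj (c k) * cnj (U $$ (j,k)))" if "i < n" "j < n" for i j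
    using that M by (simp add: Mij mult_ac)
  have "A = spec n U (\<lambda>i. Re (c i))"
  proof (rule eq_matI)
    fix i j assume "i < dim_row (spec n U (\<lambda>i. Re (c i)))" "j < dim_col (spec n U (\<lambda>i. Re (c i)))"
    then have ij: "i < n" "j < n" by auto
    have "2 * A $$ (i,j) = M $$ (i,j) + adj M $$ (i,j)" unfolding aM using ij A B by (simp add: M_def)
    also have "\<dots> = (\<Sum>k<n. U $$ (i,k) * (c k + cnj (c k)) * cnj (U $$ (j,k)))"
      using ij by (simp add: Mij aMij algebra_simps sum.distrib del: adj_index)
    also have "\<dots> = 2 * spec n U (\<lambda>i. Re (c i)) $$ (i,j)"
      using ij by (simp add: spec_index complex_add_cnj sum_distrib_left mult_ac)
    finally show "A $$ (i,j) = spec n U (\<lambda>i. Re (c i)) $$ (i,j)" by simp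
  qed (use A in auto)
  moreover have "B = spec n U (\<lambda>i. Im (c i))"
  proof (rule eq_matI)
    fix i j assume "i < dim_row (spec n U (\<lambda>i. Im (c i)))" "j < dim_col (spec n U (\<lambda>i. Im (c i)))"
    then have ij: "i < n" "j < n" by auto
    have "2 * \<i> * B $$ (i,j) = M $$ (i,j) - adj M $$ (i,j)" unfolding aM using ij A B by (simp add: M_def)
    also have "\<dots> = (\<Sum>k<n. U $$ (i,k) * (c k - cnj (c k)) * cnj (U $$ (j,k)))"
      using ij by (simp add: Mij aMij algebra_simps sum_subtractf del: adj_index)
    also have "\<dots> = 2 * \<i> * spec n U (\<lambda>i. Im (c i)) $$ (i,j)"
      using ij by (simp add: spec_index complex_diff_cnj sum_distrib_left mult_ac)
    finally show "B $$ (i,j) = spec n U (\<lambda>i. Im (c i)) $$ (i,j)" by simp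
  qed (use B in auto)
  ultimately show ?thesis using that unitary_basis_axioms by blast
qed

lemma hermitian_diagonalisation:
  assumes "A \<in> carrier_mat n n" "hermitian A"
  obtains U a where "unitary_basis n U" "A = spec n U a"
  using simultaneous_diagonalisation[OF assms assms refl] by metis

context unitary_basis begin

lemma gibbs_spec:
  assumes "n > 0"
  shows "gibbs \<beta> (spec n U e) = spec n U (\<lambda>i. exp (- \<beta> * e i) / (\<Sum>j<n. exp (- \<beta> * e j)))"
proof -
  have "mexp ((- complex_of_real \<beta>) \<cdot>\<^sub>m spec n U e) = spec n U (\<lambda>i. exp (- \<beta> * e i))"
    using spec_smult[of "- \<beta>" e] by (simp add: mexp_def mat_fun_spec)
  moreover have "1 / complex_of_real x \<cdot>\<^sub>m M = complex_of_real (1 / x) \<cdot>\<^sub>m M" for x M by simp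
  ultimately show ?thesis unfolding gibbs_def by (simp only: mtrace_spec spec_smult) (simp add: divide_simps)
qed

text \<open>States without full rank are covered: the value of \<open>ln\<close> at 0 is multiplied
  by \<open>p i = 0\<close>, in accordance with the convention 0 log 0 = 0. The same applies to
  \<open>relV_spec\<close> and \<open>relY_spec\<close>.\<close>

lemma relD_spec: "relD (spec n U p) (spec n U g) = (\<Sum>i<n. p i * (ln (p i) - ln (g i)))"
  unfolding relD_def mlog_def by (simp only: mat_fun_spec spec_minus spec_mult mtrace_spec Re_complex_of_real)

lemma relX_spec:
  "mlog (spec n U p) - mlog (spec n U g) - complex_of_real c \<cdot>\<^sub>m 1\<^sub>m (dim_row (spec n U p))
   = spec n U (\<lambda>i. ln (p i) - ln (g i) - c)"
  unfolding mlog_def by (simp only: dim_spec spec_one spec_smult mat_fun_spec spec_minus mult_1_right)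

lemma relV_spec:
  "relV (spec n U p) (spec n U g)
   = (\<Sum>i<n. p i * (ln (p i) - ln (g i) - relD (spec n U p) (spec n U g))\<^sup>2)"
  unfolding relV_def Let_def relX_spec spec_mult mtrace_spec by (simp add: power2_eq_square)

lemma relY_spec:
  "relY (spec n U p) (spec n U g)
   = (\<Sum>i<n. p i * \<bar>ln (p i) - ln (g i) - relD (spec n U p) (spec n U g)\<bar> ^ 3)"
  unfolding relY_def Let_def relX_spec mat_fun_spec spec_mult mtrace_spec by simp

end

section \<open>Tensor products, partial traces and fidelity with a pure state\<close>

lemma div_mod_less: "k < n * (m::nat) \<Longrightarrow> k div m < n \<and> k mod m < m"
  by (metis less_mult_imp_div_less mod_less_divisor mult_0_right not_gr_zero not_less_zero)

lemma pair_index_less: "i < n \<Longrightarrow> j < m \<Longrightarrow> i * m + j < n * (m::nat)"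
  by (metis add_strict_left_mono dual_order.strict_trans1 add.commute mult_Suc mult_le_mono1 Suc_leI)

lemma sum_lessThan_mult:
  fixes f :: "nat \<Rightarrow> 'a::comm_monoid_add"
  shows "(\<Sum>k<n * m. f k) = (\<Sum>i<n. \<Sum>j<m. f (i * m + j))"
proof -
  have "(\<Sum>i<n. \<Sum>j<m. f (i * m + j)) = (\<Sum>p\<in>{..<n} \<times> {..<m}. f (fst p * m + snd p))"
    by (simp add: sum.cartesian_product case_prod_beta)
  also have "\<dots> = (\<Sum>k<n * m. f k)"
    by (rule sum.reindex_bij_witness[of _ "\<lambda>k. (k div m, k mod m)" "\<lambda>p. fst p * m + snd p"])
       (auto simp: pair_index_less div_mod_less)
  finally show ?thesis by simp
qed

lemma kron_carrier [simp]:
  "A \<in> carrier_mat n m \<Longrightarrow> B \<in> carrier_mat n' m' \<Longrightarrow> kron A B \<in> carrier_mat (n * n') (m * m')"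
  by (auto simp: kron_def)

lemma dim_kron [simp]: "dim_row (kron A B) = dim_row A * dim_row B" "dim_col (kron A B) = dim_col A * dim_col B"
  by (auto simp: kron_def)

lemma kron_index:
  "i < dim_row A * dim_row B \<Longrightarrow> j < dim_col A * dim_col B \<Longrightarrow>
    kron A B $$ (i,j) = A $$ (i div dim_row B, j div dim_col B) * B $$ (i mod dim_row B, j mod dim_col B)"
  by (auto simp: kron_def)

lemma kron_pair_index:
  "i < dim_row A \<Longrightarrow> k < dim_row B \<Longrightarrow> j < dim_col A \<Longrightarrow> l < dim_col B \<Longrightarrow>
    kron A B $$ (i * dim_row B + k, j * dim_col B + l) = A $$ (i,j) * B $$ (k,l)"
  by (subst kron_index) (auto simp: pair_index_less)

lemma kron_mult:
  assumes "A \<in> carrier_mat n m" "B \<in> carrier_mat n' m'" "C \<in> carrier_mat m l" "D \<in> carrier_mat m' l'"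
  shows "kron A B * kron C D = kron (A * C) (B * D)"
proof (rule eq_matI)
  fix i j assume "i < dim_row (kron (A * C) (B * D))" "j < dim_col (kron (A * C) (B * D))"
  then have ij: "i < n * n'" "j < l * l'" using assms by auto
  note dm = div_mod_less[OF ij(1)] div_mod_less[OF ij(2)]
  have "(kron A B * kron C D) $$ (i,j) = (\<Sum>k<m * m'. kron A B $$ (i,k) * kron C D $$ (k,j))"
    using assms ij by (intro index_mult_sum[of _ "n*n'" _ _ "l*l'"]) auto
  also have "\<dots> = (\<Sum>k<m. \<Sum>k'<m'. (A $$ (i div n', k) * C $$ (k, j div l')) * (B $$ (i mod n', k') * D $$ (k', j mod l')))"
    unfolding sum_lessThan_mult
  proof (intro sum.cong refl)
    fix k k' assume "k \<in> {..<m}" "k' \<in> {..<m'}"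
    then show "kron A B $$ (i, k * m' + k') * kron C D $$ (k * m' + k', j) =
      (A $$ (i div n', k) * C $$ (k, j div l')) * (B $$ (i mod n', k') * D $$ (k', j mod l'))"
      using assms ij by (simp add: kron_index pair_index_less mult_ac)
  qed
  also have "\<dots> = (\<Sum>k<m. A $$ (i div n', k) * C $$ (k, j div l')) * (\<Sum>k'<m'. B $$ (i mod n', k') * D $$ (k', j mod l'))"
    by (rule sum_product[symmetric])
  also have "\<dots> = kron (A * C) (B * D) $$ (i,j)"
    using assms ij dm
    by (simp add: kron_index index_mult_sum[of A n m C l] index_mult_sum[of B n' m' D l'] del: index_mult_mat(1))
  finally show "(kron A B * kron C D) $$ (i,j) = kron (A * C) (B * D) $$ (i,j)" .
qed (use assms in auto)

lemma adj_kron: "adj (kron A B) = kron (adj A) (adj B)"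
proof (rule eq_matI)
  fix i j assume "i < dim_row (kron (adj A) (adj B))" "j < dim_col (kron (adj A) (adj B))"
  then show "adj (kron A B) $$ (i,j) = kron (adj A) (adj B) $$ (i,j)"
    using div_mod_less[of i "dim_col A" "dim_col B"] div_mod_less[of j "dim_row A" "dim_row B"]
    by (simp add: kron_index)
qed auto

lemma kron_mat_diag:
  "kron (mat_diag n a) (mat_diag m b) = mat_diag (n * m) (\<lambda>i. a (i div m) * b (i mod m))"
proof (rule eq_matI)
  fix i j assume "i < dim_row (mat_diag (n * m) (\<lambda>i. a (i div m) * b (i mod m)))"
    "j < dim_col (mat_diag (n * m) (\<lambda>i. a (i div m) * b (i mod m)))"
  then have ij: "i < n * m" "j < n * m" by auto
  have "i = j \<longleftrightarrow> i div m = j div m \<and> i mod m = j mod m" by (metis div_mult_mod_eq)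
  then show "kron (mat_diag n a) (mat_diag m b) $$ (i,j) = mat_diag (n * m) (\<lambda>i. a (i div m) * b (i mod m)) $$ (i,j)"
    using ij div_mod_less[OF ij(1)] div_mod_less[OF ij(2)] by (auto simp: kron_index)
qed auto

lemma unitary_basis_one: "unitary_basis n (1\<^sub>m n)"
  by unfold_locales (auto simp: unitary_one)

lemma kron_one: "kron (1\<^sub>m n) (1\<^sub>m m) = 1\<^sub>m (n * m)"
  using kron_mat_diag[of n "\<lambda>_. 1" m "\<lambda>_. 1"] by simp

lemma unitary_basis_kron:
  assumes "unitary_basis n U" "unitary_basis m W"
  shows "unitary_basis (n * m) (kron U W)"
proof -
  interpret U: unitary_basis n U by fact
  interpret W: unitary_basis m W by fact
  show ?thesis
  proof
    show "unitary (kron U W)"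
    proof (rule unitaryI[of _ "n * m"])
      show "adj (kron U W) * kron U W = 1\<^sub>m (n * m)"
        unfolding adj_kron
        by (subst kron_mult[of _ n n _ m m _ n _ m])
           (auto simp: unitaryD[OF U.unitary U.carrier] unitaryD[OF W.unitary W.carrier] kron_one)
    qed simp
  qed simp
qed

lemma unitary_basis_mult:
  "unitary_basis n U \<Longrightarrow> unitary_basis n W \<Longrightarrow> unitary_basis n (U * W)"
  by (auto simp: unitary_basis_def unitary_mult)

lemma unitary_basis_adj: "unitary_basis n U \<Longrightarrow> unitary_basis n (adj U)"
  by (auto simp: unitary_basis_def unitary_adj)

text \<open>A flat index \<open>i\<close> stands for the pair \<open>(i div m, i mod m)\<close>, as
  in \<open>kron\<close>. Under this convention a permutation of flat indices acts on pairs of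
  levels.\<close>

lemma kron_spec:
  assumes "unitary_basis n U" "unitary_basis m W"
  shows "kron (spec n U a) (spec m W b) = spec (n * m) (kron U W) (\<lambda>i. a (i div m) * b (i mod m))"
proof -
  interpret U: unitary_basis n U by fact
  interpret W: unitary_basis m W by fact
  let ?A = "mat_diag n (\<lambda>i. complex_of_real (a i))" and ?B = "mat_diag m (\<lambda>i. complex_of_real (b i))"
  have c: "U * ?A \<in> carrier_mat n n" "W * ?B \<in> carrier_mat m m" "adj U \<in> carrier_mat n n" "adj W \<in> carrier_mat m m"
    by (auto intro: mult_carrier_mat[of _ n n] mult_carrier_mat[of _ m m])
  have "spec (n * m) (kron U W) (\<lambda>i. a (i div m) * b (i mod m)) = kron U W * kron ?A ?B * kron (adj U) (adj W)"
    unfolding spec_def kron_mat_diag adj_kron by simp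
  also have "\<dots> = kron (U * ?A) (W * ?B) * kron (adj U) (adj W)"
    by (subst kron_mult[of _ n n _ m m _ n _ m]) auto
  also have "\<dots> = kron (spec n U a) (spec m W b)"
    unfolding spec_def by (rule kron_mult) (use c in auto)
  finally show ?thesis by simp
qed

context unitary_basis begin
lemma spec_add: "spec n U a + spec n U b = spec n U (\<lambda>i. a i + b i)"
  by (rule eq_matI) (auto simp: spec_index algebra_simps sum.distrib)
end

lemma kron_spec_add:
  assumes "unitary_basis n U" "unitary_basis m W"
  shows "kron (spec n U a) (1\<^sub>m m) + kron (1\<^sub>m n) (spec m W b)
    = spec (n * m) (kron U W) (\<lambda>i. a (i div m) + b (i mod m))"
proof -
  interpret UW: unitary_basis "n * m" "kron U W" by (rule unitary_basis_kron[OF assms])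
  show ?thesis
    unfolding unitary_basis.spec_one[OF assms(1)] unitary_basis.spec_one[OF assms(2)] kron_spec[OF assms] UW.spec_add
    by simp
qed

lemma unitary_conj_spec:
  assumes "unitary_basis n U" "unitary_basis n V"
  shows "V * spec n U a * adj V = spec n (V * U) a"
proof -
  interpret U: unitary_basis n U by fact
  interpret V: unitary_basis n V by fact
  have c: "adj U \<in> carrier_mat n n" "adj V \<in> carrier_mat n n" by auto
  show ?thesis unfolding spec_def adj_mult[OF V.carrier U.carrier] using c
    by (simp add: assoc_mult_mat[of _ n n _ n _ n] mult_carrier_mat[of _ n n _ n])
qed

text \<open>Allows a partial trace to be taken in any orthonormal basis of the discarded
  factor.\<close>

lemma unitary_parseval:
  assumes "unitary_basis n Y"
  shows "(\<Sum>s<n. (cmod (\<Sum>r<n. cnj (Y $$ (r,s)) * z r))\<^sup>2) = (\<Sum>r<n. (cmod (z r))\<^sup>2)"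
proof -
  interpret Y: unitary_basis n Y by fact
  have "complex_of_real (\<Sum>s<n. (cmod (\<Sum>r<n. cnj (Y $$ (r,s)) * z r))\<^sup>2)
    = (\<Sum>s<n. (\<Sum>r<n. cnj (Y $$ (r,s)) * z r) * cnj (\<Sum>t<n. cnj (Y $$ (t,s)) * z t))"
    unfolding of_real_sum complex_norm_square ..
  also have "\<dots> = (\<Sum>s<n. \<Sum>r<n. \<Sum>t<n. z r * cnj (z t) * (Y $$ (t,s) * cnj (Y $$ (r,s))))"
    unfolding cnj_sum sum_product by (simp add: mult_ac)
  also have "\<dots> = (\<Sum>r<n. \<Sum>t<n. \<Sum>s<n. z r * cnj (z t) * (Y $$ (t,s) * cnj (Y $$ (r,s))))"
    by (subst sum.swap, rule sum.cong[OF refl], rule sum.swap)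
  also have "\<dots> = (\<Sum>r<n. \<Sum>t<n. z r * cnj (z t) * (if t = r then 1 else 0))"
    unfolding sum_distrib_left[symmetric] by (intro sum.cong refl) (simp add: unitary_rows[OF Y.unitary Y.carrier])
  also have "\<dots> = (\<Sum>r<n. z r * cnj (z r))" by (simp add: if_distrib cong: if_cong)
  also have "\<dots> = complex_of_real (\<Sum>r<n. (cmod (z r))\<^sup>2)"
    unfolding of_real_sum complex_norm_square ..
  finally show ?thesis unfolding of_real_eq_iff .
qed

text \<open>The expectation of the reduced state in basis vector \<open>k\<close> is the weight of
  the block of product vectors with first index \<open>k\<close>. The basis \<open>Y\<close> is
  free: the converse takes an energy eigenbasis of the environment, achievability the standard
  basis.\<close>

lemma ptrace2_overlap:
  assumes W: "unitary_basis d1 W" and Y: "unitary_basis d2 Y" and T: "unitary_basis (d1 * d2) T" and k: "k < d1"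
  shows "(\<Sum>i<d1. \<Sum>j<d1. cnj (W $$ (i,k)) * ptrace2 d1 d2 (spec (d1 * d2) T c) $$ (i,j) * W $$ (j,k))
    = complex_of_real (\<Sum>r<d2. \<Sum>a<d1 * d2. c a * (cmod ((adj (kron W Y) * T) $$ (k * d2 + r, a)))\<^sup>2)"
proof -
  interpret W: unitary_basis d1 W by fact
  interpret Y: unitary_basis d2 Y by fact
  interpret T: unitary_basis "d1 * d2" T by fact
  define z where "z a r = (\<Sum>i<d1. cnj (W $$ (i,k)) * T $$ (i * d2 + r, a))" for a r
  have X: "(adj (kron W Y) * T) $$ (k * d2 + s, a) = (\<Sum>r<d2. cnj (Y $$ (r,s)) * z a r)"
    if "s < d2" "a < d1 * d2" for s a
  proof -
    have "(adj (kron W Y) * T) $$ (k * d2 + s, a) = (\<Sum>b<d1 * d2. adj (kron W Y) $$ (k * d2 + s, b) * T $$ (b, a))"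
      using that k by (intro index_mult_sum[of _ "d1*d2" _ _ "d1*d2"]) (auto simp: pair_index_less)
    also have "\<dots> = (\<Sum>i<d1. \<Sum>r<d2. cnj (W $$ (i,k)) * cnj (Y $$ (r,s)) * T $$ (i * d2 + r, a))"
      unfolding sum_lessThan_mult using that k
      by (intro sum.cong refl) (simp add: pair_index_less kron_pair_index[of _ W _ Y, simplified])
    also have "\<dots> = (\<Sum>r<d2. cnj (Y $$ (r,s)) * z a r)"
      unfolding z_def sum_distrib_left by (subst sum.swap) (simp add: mult_ac)
    finally show ?thesis .
  qed
  have "(\<Sum>i<d1. \<Sum>j<d1. cnj (W $$ (i,k)) * ptrace2 d1 d2 (spec (d1 * d2) T c) $$ (i,j) * W $$ (j,k))
    = (\<Sum>i<d1. \<Sum>j<d1. \<Sum>r<d2. \<Sum>a<d1 * d2. complex_of_real (c a) *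
        ((cnj (W $$ (i,k)) * T $$ (i * d2 + r, a)) * (W $$ (j,k) * cnj (T $$ (j * d2 + r, a)))))"
    unfolding ptrace2_def
    by (intro sum.cong refl) (simp add: T.spec_index pair_index_less sum_distrib_left sum_distrib_right mult_ac)
  also have "\<dots> = (\<Sum>r<d2. \<Sum>a<d1 * d2. \<Sum>i<d1. \<Sum>j<d1. complex_of_real (c a) *
        ((cnj (W $$ (i,k)) * T $$ (i * d2 + r, a)) * (W $$ (j,k) * cnj (T $$ (j * d2 + r, a)))))"
    unfolding sum.swap[of _ "{..<d1}" "{..<d2}"] sum.swap[of _ "{..<d1}" "{..<d1 * d2}"] ..
  also have "\<dots> = (\<Sum>r<d2. \<Sum>a<d1 * d2. complex_of_real (c a) * (z a r * cnj (z a r)))"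
    by (intro sum.cong refl) (simp add: z_def sum_product sum_distrib_left mult_ac)
  also have "\<dots> = complex_of_real (\<Sum>a<d1 * d2. c a * (\<Sum>r<d2. (cmod (z a r))\<^sup>2))"
    unfolding complex_norm_square[symmetric] of_real_mult[symmetric] of_real_sum[symmetric] of_real_eq_iff sum_distrib_left
    by (rule sum.swap)
  also have "(\<Sum>a<d1 * d2. c a * (\<Sum>r<d2. (cmod (z a r))\<^sup>2))
     = (\<Sum>a<d1 * d2. \<Sum>s<d2. c a * (cmod (\<Sum>r<d2. cnj (Y $$ (r,s)) * z a r))\<^sup>2)"
    by (intro sum.cong refl) (simp only: sum_distrib_left[symmetric] unitary_parseval[OF Y])
  also have "\<dots> = (\<Sum>s<d2. \<Sum>a<d1 * d2. c a * (cmod ((adj (kron W Y) * T) $$ (k * d2 + s, a)))\<^sup>2)"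
    by (subst sum.swap) (auto intro!: sum.cong simp: X)
  finally show ?thesis .
qed

lemma ptrace2_hermitian:
  assumes T: "unitary_basis (d1 * d2) T"
  shows "hermitian (ptrace2 d1 d2 (spec (d1 * d2) T c))"
proof -
  interpret T: unitary_basis "d1 * d2" T by fact
  show ?thesis unfolding hermitian_def
    by (auto intro!: eq_matI simp: ptrace2_def T.spec_index pair_index_less mult_ac)
qed

section \<open>Infidelity with a rank-one projector\<close>

text \<open>The square of \<open>proj w\<close> is \<open>c\<close> times itself and its trace is
  \<open>c\<close>. The vector is left unnormalised because the lemma is also applied to the image
  of the target vector under the root of a state.\<close>

lemma (in unitary_basis) proj_spectrum:
  assumes pw: "proj w = spec n U a" and dw: "dim_vec w = n"
  defines "c \<equiv> \<Sum>i<n. (cmod (w $ i))\<^sup>2"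
  shows "i < n \<Longrightarrow> a i = 0 \<or> a i = c" and "(\<Sum>i<n. a i) = c"
proof -
  have car: "proj w \<in> carrier_mat n n" by (auto simp: proj_def dw)
  have ww: "(\<Sum>k<n. w $ k * cnj (w $ k)) = complex_of_real c"
    unfolding c_def of_real_sum complex_norm_square ..
  have "proj w * proj w = complex_of_real c \<cdot>\<^sub>m proj w"
  proof (rule eq_matI)
    fix i j assume "i < dim_row (complex_of_real c \<cdot>\<^sub>m proj w)" "j < dim_col (complex_of_real c \<cdot>\<^sub>m proj w)"
    then have ij: "i < n" "j < n" by (auto simp: proj_def dw)
    have "(proj w * proj w) $$ (i,j) = (\<Sum>k<n. w $ i * cnj (w $ k) * (w $ k * cnj (w $ j)))"
      using ij by (subst index_mult_sum[OF car car ij]) (auto simp: proj_def dw)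
    also have "\<dots> = w $ i * cnj (w $ j) * (\<Sum>k<n. w $ k * cnj (w $ k))"
      by (simp add: sum_distrib_left mult_ac)
    finally show "(proj w * proj w) $$ (i,j) = (complex_of_real c \<cdot>\<^sub>m proj w) $$ (i,j)"
      unfolding ww using ij by (simp add: proj_def dw)
  qed (auto simp: proj_def)
  then have "spec n U (\<lambda>i. a i * a i) = spec n U (\<lambda>i. c * a i)"
    unfolding pw spec_mult spec_smult .
  then have eq: "mat_diag n (\<lambda>i. complex_of_real (a i * a i)) = mat_diag n (\<lambda>i. complex_of_real (c * a i))"
    by (metis conj_spec)
  show "a i = 0 \<or> a i = c" if "i < n" for i
  proof -
    have "complex_of_real (a i * a i) = complex_of_real (c * a i)"
      using arg_cong[OF eq, of "\<lambda>M. M $$ (i,i)"] that by simp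
    then have "a i * a i = c * a i" unfolding of_real_eq_iff .
    then show ?thesis by simp
  qed
  have "mtrace (proj w) = complex_of_real c"
    unfolding mtrace_def ww[symmetric] by (simp add: proj_def dw)
  then show "(\<Sum>i<n. a i) = c" unfolding pw mtrace_spec of_real_eq_iff .
qed

lemma proj_hermitian: "hermitian (proj w)"
  unfolding hermitian_def by (auto simp: proj_def intro!: eq_matI)

lemma mtrace_msqrt_proj:
  "mtrace (msqrt (proj w)) = complex_of_real (sqrt (\<Sum>i<dim_vec w. (cmod (w $ i))\<^sup>2))"
proof -
  let ?n = "dim_vec w"
  define c where "c = (\<Sum>i<?n. (cmod (w $ i))\<^sup>2)"
  have car: "proj w \<in> carrier_mat ?n ?n" by (auto simp: proj_def)
  obtain U a where U: "unitary_basis ?n U" and pw: "proj w = spec ?n U a"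
    by (rule hermitian_diagonalisation[OF car proj_hermitian])
  interpret unitary_basis ?n U by fact
  note aa = proj_spectrum(1)[OF pw refl, folded c_def] and tr = proj_spectrum(2)[OF pw refl, folded c_def]
  have c0: "c \<ge> 0" unfolding c_def by (auto intro: sum_nonneg)
  \<comment> \<open>On the two values 0 and \<open>c\<close> the root is linear, so its trace
    follows from the trace of \<open>proj w\<close>; division by zero yielding 0 covers
    \<open>c = 0\<close>.\<close>
  have "sqrt (a i) = a i / sqrt c" if "i < ?n" for i
    using aa[OF that] c0 by (auto simp: real_div_sqrt)
  then have "(\<Sum>i<?n. sqrt (a i)) = c / sqrt c" unfolding tr[symmetric] sum_divide_distrib by simp
  then show ?thesis unfolding pw msqrt_def mat_fun_spec mtrace_spec c_def[symmetric]
    using c0 by (simp add: real_div_sqrt)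
qed

text \<open>With \<open>R\<close> the root of \<open>A\<close>, the operator \<open>R * proj v * R\<close> is the rank-one \<open>proj (R v)\<close>, whose root is
  explicit.\<close>
lemma infid_pure:
  assumes S: "unitary_basis n X" and A: "A = spec n X l" and l: "\<And>i. i < n \<Longrightarrow> l i \<ge> 0" and v: "dim_vec v = n"
  shows "infid A (proj v) = 1 - Re (\<Sum>i<n. \<Sum>j<n. A $$ (i,j) * (v $ j * cnj (v $ i)))"
proof -
  interpret unitary_basis n X by fact
  define R where "R = spec n X (\<lambda>i. sqrt (l i))"
  have R: "R \<in> carrier_mat n n" unfolding R_def by simp
  have hR: "cnj (R $$ (i,j)) = R $$ (j,i)" if "i < n" "j < n" for i j
    unfolding R_def using that by (simp add: spec_index mult_ac)
  have RR: "R * R = A" unfolding R_def A spec_mult by (rule spec_cong) (simp add: l)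
  have msA: "msqrt A = R" unfolding A R_def msqrt_def mat_fun_spec ..
  define w where "w = Matrix.vec n (\<lambda>i. \<Sum>j<n. R $$ (i,j) * v $ j)"
  have P: "proj v \<in> carrier_mat n n" using v by (auto simp: proj_def)
  have "R * proj v * R = proj w"
  proof (rule eq_matI)
    fix i j assume "i < dim_row (proj w)" "j < dim_col (proj w)"
    then have ij: "i < n" "j < n" by (auto simp: proj_def w_def)
    have RP: "(R * proj v) $$ (i,k) = (\<Sum>m<n. R $$ (i,m) * (v $ m * cnj (v $ k)))" if "k < n" for k
      using index_mult_sum[OF R P ij(1) that] that v by (simp add: proj_def)
    have "(R * proj v * R) $$ (i,j) = (\<Sum>k<n. (\<Sum>m<n. R $$ (i,m) * (v $ m * cnj (v $ k))) * R $$ (k,j))"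
      by (subst index_mult_sum[OF mult_carrier_mat[OF R P] R ij]) (simp add: RP)
    also have "\<dots> = (\<Sum>m<n. R $$ (i,m) * v $ m) * (\<Sum>k<n. cnj (v $ k) * R $$ (k,j))"
      by (subst mult.commute) (simp add: sum_product sum_distrib_left sum_distrib_right mult_ac)
    also have "(\<Sum>k<n. cnj (v $ k) * R $$ (k,j)) = cnj (w $ j)"
      using ij by (simp add: w_def hR mult_ac)
    finally show "(R * proj v * R) $$ (i,j) = proj w $$ (i,j)"
      using ij by (simp add: proj_def w_def)
  qed (use R in \<open>auto simp: proj_def w_def\<close>)
  moreover have dw: "dim_vec w = n" by (simp add: w_def)
  ultimately have "infid A (proj v) = 1 - (\<Sum>i<n. (cmod (w $ i))\<^sup>2)"
    unfolding infid_def msA using mtrace_msqrt_proj[of w] by (simp add: sum_nonneg)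
  also have "complex_of_real (\<Sum>i<n. (cmod (w $ i))\<^sup>2) = (\<Sum>i<n. \<Sum>j<n. A $$ (i,j) * (v $ j * cnj (v $ i)))"
  proof -
    have "complex_of_real (\<Sum>i<n. (cmod (w $ i))\<^sup>2) = (\<Sum>k<n. w $ k * cnj (w $ k))"
      unfolding of_real_sum complex_norm_square ..
    also have "\<dots> = (\<Sum>k<n. \<Sum>j<n. \<Sum>i<n. (R $$ (i,k) * R $$ (k,j)) * (v $ j * cnj (v $ i)))"
      by (intro sum.cong refl) (simp add: w_def sum_product hR mult_ac)
    also have "\<dots> = (\<Sum>i<n. \<Sum>j<n. \<Sum>k<n. (R $$ (i,k) * R $$ (k,j)) * (v $ j * cnj (v $ i)))"
      by (subst sum.swap, subst (2) sum.swap, rule sum.swap)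
    also have "\<dots> = (\<Sum>i<n. \<Sum>j<n. A $$ (i,j) * (v $ j * cnj (v $ i)))"
      unfolding RR[symmetric]
      by (intro sum.cong refl) (simp add: index_mult_sum[OF R R] sum_distrib_right del: index_mult_mat(1))
    finally show ?thesis .
  qed
  then have "(\<Sum>i<n. (cmod (w $ i))\<^sup>2) = Re (\<Sum>i<n. \<Sum>j<n. A $$ (i,j) * (v $ j * cnj (v $ i)))"
    by (metis Re_complex_of_real)
  finally show ?thesis .
qed

text \<open>Common starting point of both bounds: the error of an operation of thermal form is a
  weighted sum of transition probabilities.\<close>

lemma infid_ptrace2:
  assumes W: "unitary_basis d1 W" and Y: "unitary_basis d2 Y" and T: "unitary_basis (d1 * d2) T" and k: "k < d1"
    and c: "\<And>a. a < d1 * d2 \<Longrightarrow> c a \<ge> 0"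
    and v: "dim_vec v = d1" "proj v = spec d1 W (\<lambda>i. if i = k then 1 else 0)"
  shows "infid (ptrace2 d1 d2 (spec (d1 * d2) T c)) (proj v)
    = 1 - (\<Sum>r<d2. \<Sum>a<d1 * d2. c a * (cmod ((adj (kron W Y) * T) $$ (k * d2 + r, a)))\<^sup>2)"
proof -
  interpret W: unitary_basis d1 W by fact
  let ?A = "ptrace2 d1 d2 (spec (d1 * d2) T c)"
  have car: "?A \<in> carrier_mat d1 d1" by (simp add: ptrace2_def)
  obtain X l where X: "unitary_basis d1 X" and A: "?A = spec d1 X l"
    by (rule hermitian_diagonalisation[OF car ptrace2_hermitian[OF T]])
  interpret X: unitary_basis d1 X by fact
  \<comment> \<open>\<open>ptrace2_overlap\<close> with the eigenbasis \<open>X\<close> of the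
    output itself exhibits each eigenvalue as a nonnegative combination of the
    \<open>c a\<close>.\<close>
  have l: "l i \<ge> 0" if "i < d1" for i
  proof -
    have "complex_of_real (l i) = (\<Sum>m<d1. \<Sum>j<d1. cnj (X $$ (m,i)) * ?A $$ (m,j) * X $$ (j,i))"
      unfolding A by (rule X.quadratic_form_col[OF that, symmetric])
    then have "l i = (\<Sum>r<d2. \<Sum>a<d1 * d2. c a * (cmod ((adj (kron X Y) * T) $$ (i * d2 + r, a)))\<^sup>2)"
      unfolding ptrace2_overlap[OF X Y T that] of_real_eq_iff .
    then show ?thesis using c by (auto intro!: sum_nonneg)
  qed
  \<comment> \<open>The projector fixes \<open>v\<close> only up to a phase, so products of
    coordinates are compared and not the vectors.\<close>
  have vv: "v $ j * cnj (v $ i) = cnj (W $$ (i,k)) * W $$ (j,k)" if "i < d1" "j < d1" for i j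
  proof -
    have "v $ j * cnj (v $ i) = spec d1 W (\<lambda>i. if i = k then 1 else 0) $$ (j,i)"
      unfolding v(2)[symmetric] using that v(1) by (simp add: proj_def)
    also have "\<dots> = (\<Sum>l<d1. if l = k then W $$ (j,k) * cnj (W $$ (i,k)) else 0)"
      by (subst W.spec_index[OF that(2,1)], intro sum.cong refl) simp
    finally show ?thesis using k by simp
  qed
  have "infid ?A (proj v) = 1 - Re (\<Sum>i<d1. \<Sum>j<d1. ?A $$ (i,j) * (v $ j * cnj (v $ i)))"
    by (rule infid_pure[OF X A l v(1)])
  also have "(\<Sum>i<d1. \<Sum>j<d1. ?A $$ (i,j) * (v $ j * cnj (v $ i)))
    = (\<Sum>i<d1. \<Sum>j<d1. cnj (W $$ (i,k)) * ?A $$ (i,j) * W $$ (j,k))"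
    by (intro sum.cong refl) (simp add: vv mult_ac)
  finally show ?thesis unfolding ptrace2_overlap[OF W Y T k] by simp
qed

section \<open>Permutations of energy shells\<close>

lemma sum_lists_Suc:
  fixes f :: "'a list \<Rightarrow> 'b::comm_monoid_add"
  assumes "finite K"
  shows "(\<Sum>xs\<in>{xs. set xs \<subseteq> K \<and> length xs = Suc m}. f xs)
    = (\<Sum>x\<in>K. \<Sum>xs\<in>{xs. set xs \<subseteq> K \<and> length xs = m}. f (x # xs))"
proof -
  let ?L = "{xs. set xs \<subseteq> K \<and> length xs = m}"
  have "(\<Sum>x\<in>K. \<Sum>xs\<in>?L. f (x # xs)) = (\<Sum>p\<in>K \<times> ?L. f (fst p # snd p))"
    by (simp add: sum.cartesian_product case_prod_beta)
  also have "\<dots> = (\<Sum>xs\<in>{xs. set xs \<subseteq> K \<and> length xs = Suc m}. f xs)"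
    by (rule sum.reindex_bij_witness[of _ "\<lambda>xs. (hd xs, tl xs)" "\<lambda>p. fst p # snd p"])
       (auto simp: length_Suc_conv)
  finally show ?thesis by simp
qed

lemma sum_lists_prod:
  fixes f :: "'a \<Rightarrow> 'b::comm_semiring_1"
  assumes "finite K"
  shows "(\<Sum>xs\<in>{xs. set xs \<subseteq> K \<and> length xs = m}. prod_list (map f xs)) = (\<Sum>x\<in>K. f x) ^ m"
proof (induction m)
  case 0
  have "{xs. set xs \<subseteq> K \<and> length xs = 0} = {[]}" by auto
  then show ?case by simp
next
  case (Suc m)
  then show ?case
    by (simp add: sum_lists_Suc[OF assms] sum_distrib_left[symmetric] sum_distrib_right[symmetric])
qed

text \<open>Double counting of pairs (list, position): by exchangeability every position carries an
  element satisfying \<open>s\<close> equally often.\<close>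
lemma card_hd_exchangeable:
  assumes fin: "finite G" and len: "\<And>xs. xs \<in> G \<Longrightarrow> length xs = Suc m"
    and closed: "\<And>xs ys. xs \<in> G \<Longrightarrow> mset ys = mset xs \<Longrightarrow> ys \<in> G"
  shows "Suc m * card {xs \<in> G. s (hd xs)} = (\<Sum>xs\<in>G. length (filter s xs))"
proof -
  \<comment> \<open>Exchanging the entries at 0 and \<open>l\<close> is an involution that preserves
    the multiset, hence maps \<open>G\<close> to itself and brings position \<open>l\<close> to the
    head.\<close>
  define sw where "sw l xs = xs[0 := xs ! l, l := xs ! 0]" for l and xs :: "'a list"
  have sw_mset: "mset (sw l xs) = mset xs" if "l \<le> m" "xs \<in> G" for l xs
    unfolding sw_def using mset_swap[of 0 xs l] len[OF that(2)] that by (metis less_Suc_eq_le mset_swap zero_less_Suc)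
  have sw_in: "sw l xs \<in> G" if "l \<le> m" "xs \<in> G" for l xs
    using closed[OF that(2) sw_mset[OF that]] .
  have sw_sw: "sw l (sw l xs) = xs" if "l \<le> m" "xs \<in> G" for l xs
    using len[OF that(2)] that(1)
    by (intro nth_equalityI) (auto simp: sw_def nth_list_update)
  have sw_nth: "sw l xs ! 0 = xs ! l" "sw l xs ! l = xs ! 0" if "l \<le> m" "xs \<in> G" for l xs
    using len[OF that(2)] that(1) by (auto simp: sw_def nth_list_update)
  have pos: "card {xs \<in> G. s (xs ! l)} = card {xs \<in> G. s (hd xs)}" if "l \<le> m" for l
  proof (rule bij_betw_same_card[of "sw l"], rule bij_betwI[of _ _ _ "sw l"])
    have hd: "hd xs = xs ! 0" if "xs \<in> G" for xs using len[OF that] by (cases xs) auto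
    show "sw l \<in> {xs \<in> G. s (xs ! l)} \<rightarrow> {xs \<in> G. s (hd xs)}"
      using that by (auto simp: sw_in sw_nth hd)
    show "sw l \<in> {xs \<in> G. s (hd xs)} \<rightarrow> {xs \<in> G. s (xs ! l)}"
      using that by (auto simp: sw_in sw_nth hd)
  qed (use that sw_sw in auto)
  have "(\<Sum>xs\<in>G. length (filter s xs)) = (\<Sum>xs\<in>G. \<Sum>l\<le>m. if s (xs ! l) then 1 else 0)"
  proof (rule sum.cong[OF refl])
    fix xs assume "xs \<in> G"
    then have "length (filter s xs) = card {l. l \<le> m \<and> s (xs ! l)}"
      by (simp add: length_filter_conv_card len less_Suc_eq_le)
    also have "\<dots> = (\<Sum>l\<le>m. if s (xs ! l) then 1 else 0)"
      by (simp add: sum.If_cases Int_def)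
    finally show "length (filter s xs) = (\<Sum>l\<le>m. if s (xs ! l) then 1 else 0)" .
  qed
  also have "\<dots> = (\<Sum>l\<le>m. \<Sum>xs\<in>G. if s (xs ! l) then 1 else 0)" by (rule sum.swap)
  also have "\<dots> = (\<Sum>l\<le>m. card {xs \<in> G. s (xs ! l)})"
    using fin by (simp add: sum.If_cases Int_def)
  also have "\<dots> = Suc m * card {xs \<in> G. s (hd xs)}" by (simp add: pos)
  finally show ?thesis ..
qed

text \<open>An injection of \<open>A\<close> into \<open>B\<close> is completed by any bijection
  between the complements of \<open>A\<close> and of its image, which are finite and
  equinumerous.\<close>

lemma bij_extending_subset_map:
  assumes fin: "finite G" and sub: "A \<subseteq> G" "B \<subseteq> G" and le: "card A \<le> card B"
  shows "\<exists>h. bij_betw h G G \<and> h ` A \<subseteq> B"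
proof -
  have "finite A" "finite B" using fin sub finite_subset by auto
  then obtain f where f: "f ` A \<subseteq> B" "inj_on f A" using card_le_inj le by metis
  have "card (G - A) = card (G - f ` A)"
  proof -
    have "card (G - A) = card G - card A" "card (G - f ` A) = card G - card (f ` A)"
      using sub f \<open>finite A\<close> by (intro card_Diff_subset; auto)+
    then show ?thesis using f by (simp add: card_image)
  qed
  then obtain g where g: "bij_betw g (G - A) (G - f ` A)"
    using finite_same_card_bij[of "G - A" "G - f ` A"] fin by auto
  define h where "h x = (if x \<in> A then f x else g x)" for x
  have "bij_betw h A (f ` A)"
    using inj_on_imp_bij_betw[OF f(2)] by (subst bij_betw_cong[where g = f]) (simp_all add: h_def)
  moreover have "bij_betw h (G - A) (G - f ` A)"
    using g by (subst bij_betw_cong[where g = g]) (auto simp: h_def)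
  ultimately have "bij_betw h (A \<union> (G - A)) (f ` A \<union> (G - f ` A))"
    by (rule bij_betw_combine) auto
  moreover have "A \<union> (G - A) = G" "f ` A \<union> (G - f ` A) = G" using sub f by auto
  ultimately show ?thesis using f by (intro exI[of _ h]) (auto simp: h_def)
qed

text \<open>On a rearrangement-closed set of strings, the number of strings starting in
  \<open>s\<close> is proportional to the total number of \<open>s\<close> letters, and likewise for
  \<open>t\<close>. A stringwise bound on letter counts therefore becomes a bound on the numbers of
  strings to be mapped.\<close>

lemma energy_shell_permutation:
  fixes w :: "'a \<Rightarrow> real" and s t :: "'a \<Rightarrow> bool" and m :: nat
  assumes fin: "finite K"
  defines "\<Omega> \<equiv> {xs. set xs \<subseteq> K \<and> length xs = Suc m}"
  shows "\<exists>\<pi>. bij_betw \<pi> \<Omega> \<Omega> \<and> (\<forall>xs\<in>\<Omega>. sum_list (map w (\<pi> xs)) = sum_list (map w xs)) \<and>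
    (\<forall>xs\<in>\<Omega>. s (hd xs) \<and> length (filter s xs) \<le> length (filter t xs) \<longrightarrow> t (hd (\<pi> xs)))"
proof -
  \<comment> \<open>The count inequality is built into the set; like the energy it survives
    rearrangement, so \<open>card_hd_exchangeable\<close> applies to each
    \<open>G e\<close>.\<close>
  define G where "G e = {xs \<in> \<Omega>. sum_list (map w xs) = e \<and> length (filter s xs) \<le> length (filter t xs)}" for e
  have fin\<Omega>: "finite \<Omega>" unfolding \<Omega>_def by (rule finite_lists_length_eq[OF fin])
  have finG: "finite (G e)" for e unfolding G_def using fin\<Omega> by auto
  have "\<exists>h. bij_betw h (G e) (G e) \<and> h ` {xs \<in> G e. s (hd xs)} \<subseteq> {xs \<in> G e. t (hd xs)}" for e
  proof (rule bij_extending_subset_map[OF finG])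
    have closed: "ys \<in> G e" if "xs \<in> G e" "mset ys = mset xs" for xs ys
    proof -
      have "sum_list (map w ys) = sum_list (map w xs)"
        using that(2) by (metis mset_map sum_mset_sum_list)
      moreover have "length (filter P ys) = length (filter P xs)" for P
        using that(2) by (metis mset_filter size_mset)
      moreover have "length ys = length xs" "set ys = set xs"
        using that(2) by (metis size_mset, metis mset_eq_setD)
      ultimately show ?thesis using that(1) by (auto simp: G_def \<Omega>_def)
    qed
    have len: "length xs = Suc m" if "xs \<in> G e" for xs using that by (auto simp: G_def \<Omega>_def)
    have "Suc m * card {xs \<in> G e. P (hd xs)} = (\<Sum>xs\<in>G e. length (filter P xs))" for P
      by (rule card_hd_exchangeable[OF finG len closed])
    moreover have "(\<Sum>xs\<in>G e. length (filter s xs)) \<le> (\<Sum>xs\<in>G e. length (filter t xs))"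
      by (rule sum_mono) (auto simp: G_def)
    ultimately have "Suc m * card {xs \<in> G e. s (hd xs)} \<le> Suc m * card {xs \<in> G e. t (hd xs)}"
      by metis
    then show "card {xs \<in> G e. s (hd xs)} \<le> card {xs \<in> G e. t (hd xs)}"
      by (simp only: mult_le_cancel1 zero_less_Suc simp_thms)
  qed auto
  then obtain h where h: "\<And>e. bij_betw (h e) (G e) (G e)"
    "\<And>e. h e ` {xs \<in> G e. s (hd xs)} \<subseteq> {xs \<in> G e. t (hd xs)}" by metis
  \<comment> \<open>Strings with more \<open>s\<close> than \<open>t\<close> letters stay fixed.
    Both kinds of strings and the energy are preserved, so equal images force the same branch and
    the same shell; this gives injectivity.\<close>
  define \<pi> where "\<pi> xs = (if length (filter s xs) \<le> length (filter t xs) then h (sum_list (map w xs)) xs else xs)" for xs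
  have inG: "\<pi> xs \<in> G (sum_list (map w xs))" if "xs \<in> \<Omega>" "length (filter s xs) \<le> length (filter t xs)" for xs
    using that h(1)[of "sum_list (map w xs)"] by (auto simp: \<pi>_def G_def bij_betw_def)
  have en: "sum_list (map w (\<pi> xs)) = sum_list (map w xs)" if "xs \<in> \<Omega>" for xs
    using inG[OF that] by (cases "length (filter s xs) \<le> length (filter t xs)") (auto simp: G_def \<pi>_def)
  have "inj_on \<pi> \<Omega>"
  proof (rule inj_onI)
    fix xs ys assume *: "xs \<in> \<Omega>" "ys \<in> \<Omega>" "\<pi> xs = \<pi> ys"
    have good: "length (filter s (\<pi> zs)) \<le> length (filter t (\<pi> zs)) \<longleftrightarrow> length (filter s zs) \<le> length (filter t zs)"
      if "zs \<in> \<Omega>" for zs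
      using inG[OF that] by (cases "length (filter s zs) \<le> length (filter t zs)") (auto simp: G_def \<pi>_def)
    have e: "sum_list (map w xs) = sum_list (map w ys)" using en * by metis
    show "xs = ys"
    proof (cases "length (filter s xs) \<le> length (filter t xs)")
      case True
      then have "length (filter s ys) \<le> length (filter t ys)" using good * by metis
      moreover have "inj_on (h (sum_list (map w ys))) (G (sum_list (map w ys)))" using h(1) by (auto simp: bij_betw_def)
      ultimately show ?thesis using * True e by (auto simp: \<pi>_def G_def inj_on_def)
    next
      case False
      then have "\<not> length (filter s ys) \<le> length (filter t ys)" using good * by metis
      then show ?thesis using * False by (simp add: \<pi>_def)
    qed
  qed
  moreover have "\<pi> ` \<Omega> \<subseteq> \<Omega>"
    using inG by (auto simp: \<pi>_def G_def split: if_splits)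
  ultimately have "bij_betw \<pi> \<Omega> \<Omega>" using fin\<Omega> by (simp add: bij_betw_def endo_inj_surj)
  moreover have "t (hd (\<pi> xs))" if "xs \<in> \<Omega>" "s (hd xs)" "length (filter s xs) \<le> length (filter t xs)" for xs
    using h(2)[of "sum_list (map w xs)"] that by (auto simp: \<pi>_def G_def)
  ultimately show ?thesis using en by blast
qed

section \<open>Exponential moment bound for the bath\<close>

lemma exp_le_quadratic:
  fixes x :: real
  assumes "\<bar>x\<bar> \<le> 1"
  shows "exp x \<le> 1 + x + x\<^sup>2"
proof (cases "x \<ge> 0")
  case True
  then show ?thesis using assms by (intro exp_bound) auto
next
  case False
  define y where "y = - x"
  have y: "y > 0" using False by (simp add: y_def)
  have "exp x = 1 / exp y" by (simp add: y_def exp_minus field_simps)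
  also have "\<dots> \<le> 1 / (1 + y)" using exp_ge_add_one_self[of y] y by (intro divide_left_mono) auto
  also have "\<dots> \<le> 1 - y + y\<^sup>2"
  proof -
    have "(1 - y + y\<^sup>2) * (1 + y) = 1 + y ^ 3" by (simp add: algebra_simps power2_eq_square power3_eq_cube)
    then show ?thesis using y by (simp add: pos_divide_le_eq)
  qed
  finally show ?thesis by (simp add: y_def)
qed

text \<open>Chernoff bound: the variable \<open>X\<close>, the indicator of \<open>s\<close> minus
  that of \<open>t\<close>, has negative mean under \<open>g\<close>, so that \<open>m\<close>
  independent letters fail to outweigh one extra \<open>s\<close> with probability at most
  \<open>\<theta> ^ m\<close>. Only the first letter follows the arbitrary law
  \<open>q\<close>.\<close>

lemma bath_permutation:
  fixes w g q :: "'a \<Rightarrow> real" and s t :: "'a \<Rightarrow> bool"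
  assumes fin: "finite K" and g: "\<And>x. x \<in> K \<Longrightarrow> g x \<ge> 0" "sum g K = 1"
    and q: "\<And>x. x \<in> K \<Longrightarrow> q x \<ge> 0" "sum q K = 1"
    and gap: "(\<Sum>x\<in>K. g x * (of_bool (s x) - of_bool (t x))) < 0" and eps: "\<epsilon> > 0"
  obtains m \<pi> where
    "bij_betw \<pi> {xs. set xs \<subseteq> K \<and> length xs = Suc m} {xs. set xs \<subseteq> K \<and> length xs = Suc m}"
    "\<And>xs. xs \<in> {xs. set xs \<subseteq> K \<and> length xs = Suc m} \<Longrightarrow> sum_list (map w (\<pi> xs)) = sum_list (map w xs)"
    "(\<Sum>xs\<in>{xs. set xs \<subseteq> K \<and> length xs = Suc m}. q (hd xs) * prod_list (map g (tl xs)) * of_bool (t (hd (\<pi> xs))))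
      \<ge> (\<Sum>x\<in>K. q x * of_bool (s x)) - \<epsilon>"
proof -
  define X where "X x = of_bool (s x) - (of_bool (t x) :: real)" for x
  define \<delta> where "\<delta> = - (\<Sum>x\<in>K. g x * X x)"
  have d0: "\<delta> > 0" using gap by (simp add: \<delta>_def X_def)
  have X1: "\<bar>X x\<bar> \<le> 1" for x by (auto simp: X_def)
  have "\<delta> \<le> (\<Sum>x\<in>K. g x)" unfolding \<delta>_def sum_negf[symmetric]
  proof (rule sum_mono)
    fix x assume "x \<in> K"
    then show "- (g x * X x) \<le> g x" using mult_left_mono[of "- X x" 1 "g x"] X1[of x] g by auto
  qed
  then have d1: "\<delta> \<le> 1" using g by simp
  \<comment> \<open>The parameter \<open>\<delta> / 2\<close> minimises the quadratic bound
    \<open>1 - u * \<delta> + u\<^sup>2\<close> on the moment with exponent \<open>u\<close>, giving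
    \<open>1 - (\<delta> / 2)\<^sup>2\<close>.\<close>
  define \<theta> where "\<theta> = (\<Sum>x\<in>K. g x * exp (\<delta> / 2 * X x))"
  have "\<theta> \<le> (\<Sum>x\<in>K. g x * (1 + \<delta> / 2 * X x + (\<delta> / 2)\<^sup>2))"
    unfolding \<theta>_def
  proof (intro sum_mono mult_left_mono g(1))
    fix x
    have a: "\<bar>\<delta> / 2 * X x\<bar> \<le> \<delta> / 2" using X1[of x] d0 by (simp add: abs_mult mult_left_le)
    have "exp (\<delta> / 2 * X x) \<le> 1 + \<delta> / 2 * X x + (\<delta> / 2 * X x)\<^sup>2"
      by (rule exp_le_quadratic) (use a d1 in auto)
    also have "(\<delta> / 2 * X x)\<^sup>2 \<le> (\<delta> / 2)\<^sup>2" using power_mono[OF a abs_ge_zero, of 2] by (simp only: power2_abs)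
    finally show "exp (\<delta> / 2 * X x) \<le> 1 + \<delta> / 2 * X x + (\<delta> / 2)\<^sup>2" by simp
  qed
  also have "\<dots> = (\<Sum>x\<in>K. g x) * (1 + (\<delta> / 2)\<^sup>2) + \<delta> / 2 * (\<Sum>x\<in>K. g x * X x)"
    unfolding sum_distrib_left sum_distrib_right sum.distrib[symmetric] by (intro sum.cong) (auto simp: algebra_simps)
  also have "\<dots> = 1 - (\<delta> / 2)\<^sup>2"
  proof -
    have "(\<Sum>x\<in>K. g x * X x) = - \<delta>" by (simp add: \<delta>_def)
    then show ?thesis unfolding g(2) by (simp add: power2_eq_square)
  qed
  finally have th1: "\<theta> < 1" using d0 by (smt (verit) zero_less_power divide_pos_pos)
  have th0: "\<theta> \<ge> 0" unfolding \<theta>_def using g by (auto intro: sum_nonneg)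
  obtain m where m: "\<theta> ^ m < \<epsilon>" using real_arch_pow_inv[OF eps th1] by auto
  define L where "L = {xs. set xs \<subseteq> K \<and> length xs = m}"
  define \<Omega> where "\<Omega> = {xs. set xs \<subseteq> K \<and> length xs = Suc m}"
  have finL: "finite L" unfolding L_def by (rule finite_lists_length_eq[OF fin])
  obtain \<pi> where \<pi>: "bij_betw \<pi> \<Omega> \<Omega>" "\<And>xs. xs \<in> \<Omega> \<Longrightarrow> sum_list (map w (\<pi> xs)) = sum_list (map w xs)"
    "\<And>xs. xs \<in> \<Omega> \<Longrightarrow> s (hd xs) \<Longrightarrow> length (filter s xs) \<le> length (filter t xs) \<Longrightarrow> t (hd (\<pi> xs))"
    using energy_shell_permutation[OF fin, of m w s t] unfolding \<Omega>_def by blast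
  have gl: "prod_list (map g xs) \<ge> 0" if "xs \<in> L" for xs
  proof (rule prod_list_nonneg)
    fix y assume "y \<in> set (map g xs)"
    then show "y \<ge> 0" using that g(1) unfolding L_def by auto
  qed
  have Xsum: "real (length (filter s xs)) - real (length (filter t xs)) = sum_list (map X xs)" for xs
    by (induction xs) (auto simp: X_def)
  have expX: "exp (\<delta> / 2 * sum_list (map X xs)) * prod_list (map g xs) = prod_list (map (\<lambda>x. g x * exp (\<delta> / 2 * X x)) xs)" for xs
    by (induction xs) (auto simp: distrib_left exp_add mult_ac)
  \<comment> \<open>Both the mass of \<open>s\<close> and \<open>\<theta> ^ m\<close> are spread
    over all strings, so that the claim can be checked string by string.\<close>
  have "(\<Sum>x\<in>K. q x * of_bool (s x)) - \<epsilon> \<le> (\<Sum>x\<in>K. q x * of_bool (s x)) - \<theta> ^ m" using m by simp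
  also have "\<dots> = (\<Sum>x\<in>K. q x * of_bool (s x) * (\<Sum>xs\<in>L. prod_list (map g xs)))
      - (\<Sum>x\<in>K. q x * (\<Sum>xs\<in>L. prod_list (map (\<lambda>x. g x * exp (\<delta> / 2 * X x)) xs)))"
    unfolding L_def sum_lists_prod[OF fin] by (simp add: g q \<theta>_def flip: sum_distrib_right)
  also have "\<dots> = (\<Sum>x\<in>K. \<Sum>xs\<in>L. q x * (of_bool (s x) * prod_list (map g xs) - prod_list (map (\<lambda>x. g x * exp (\<delta> / 2 * X x)) xs)))"
    by (simp add: sum_distrib_left sum_subtractf algebra_simps)
  also have "\<dots> \<le> (\<Sum>x\<in>K. \<Sum>xs\<in>L. q x * (prod_list (map g xs) * of_bool (t (hd (\<pi> (x # xs))))))"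
  proof (intro sum_mono mult_left_mono q(1))
    fix x xs assume x: "x \<in> K" and xs: "xs \<in> L"
    show "of_bool (s x) * prod_list (map g xs) - prod_list (map (\<lambda>x. g x * exp (\<delta> / 2 * X x)) xs)
      \<le> prod_list (map g xs) * of_bool (t (hd (\<pi> (x # xs))))"
    proof (cases "length (filter s (x # xs)) \<le> length (filter t (x # xs))")
      case True
      have "0 \<le> prod_list (map (\<lambda>x. g x * exp (\<delta> / 2 * X x)) xs)"
        unfolding expX[symmetric] using gl[OF xs] by simp
      moreover have "x # xs \<in> \<Omega>" using x xs by (auto simp: L_def \<Omega>_def)
      then have "s x \<Longrightarrow> t (hd (\<pi> (x # xs)))" using \<pi>(3)[of "x # xs"] True by simp
      ultimately show ?thesis using gl[OF xs] by (cases "s x") auto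
    next
      case False
      \<comment> \<open>The excess is an integer, hence at least 1; dropping the first letter
        removes at most 1, and the exponential weight of the rest is still at least 1.\<close>
      then have "sum_list (map X (x # xs)) \<ge> 1" unfolding Xsum[symmetric] by linarith
      then have "sum_list (map X xs) \<ge> 0" using X1[of x] by simp
      then have "1 \<le> exp (\<delta> / 2 * sum_list (map X xs))" using d0 by simp
      then have "prod_list (map g xs) \<le> prod_list (map (\<lambda>x. g x * exp (\<delta> / 2 * X x)) xs)"
        unfolding expX[symmetric] using mult_right_mono[OF _ gl[OF xs], of 1] by simp
      moreover have "of_bool (s x) * prod_list (map g xs) \<le> prod_list (map g xs)" using gl[OF xs] by (cases "s x") auto
      moreover have "0 \<le> prod_list (map g xs) * of_bool (t (hd (\<pi> (x # xs))))" using gl[OF xs] by simp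
      ultimately show ?thesis by linarith
    qed
  qed
  also have "\<dots> = (\<Sum>xs\<in>\<Omega>. q (hd xs) * prod_list (map g (tl xs)) * of_bool (t (hd (\<pi> xs))))"
    unfolding \<Omega>_def L_def sum_lists_Suc[OF fin] by (simp add: mult.assoc)
  finally show ?thesis using that[of \<pi> m] \<pi> unfolding \<Omega>_def by blast
qed

section \<open>Achievability with a finite bath\<close>

definition gibbs_weight :: "real \<Rightarrow> nat \<Rightarrow> (nat \<Rightarrow> real) \<Rightarrow> nat \<Rightarrow> real" where
  "gibbs_weight \<beta> n e i = exp (- \<beta> * e i) / (\<Sum>j<n. exp (- \<beta> * e j))"

lemma gibbs_weight_pos: "n > 0 \<Longrightarrow> gibbs_weight \<beta> n e i > 0"
  unfolding gibbs_weight_def by (intro divide_pos_pos sum_pos) (auto simp: lessThan_empty_iff)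

lemma gibbs_weight_sum: "n > 0 \<Longrightarrow> (\<Sum>i<n. gibbs_weight \<beta> n e i) = 1"
proof -
  assume "n > 0"
  then have "(\<Sum>j<n. exp (- \<beta> * e j)) > 0" by (intro sum_pos) (auto simp: lessThan_empty_iff)
  then show ?thesis unfolding gibbs_weight_def sum_divide_distrib[symmetric] by simp
qed

lemma (in unitary_basis) gibbs_spec': "n > 0 \<Longrightarrow> gibbs \<beta> (spec n U e) = spec n U (gibbs_weight \<beta> n e)"
  using gibbs_spec[of \<beta> e] by (simp add: gibbs_weight_def[abs_def])

text \<open>A classical energy-matching bijection of product levels lifts to a unitary. The same
  flat index is read with \<open>dE\<close> before and with \<open>dE'\<close> after the operation,
  which realises the change of factorisation into output and discarded part.\<close>

lemma thermal_op_of_index_permutation: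
  assumes U: "unitary_basis D U" and W: "unitary_basis D' W"
    and dE: "dE > 0" and dim: "D * dE = D' * dE'" and k: "k < D'"
    and bij: "bij_betw \<tau> {..<D * dE} {..<D * dE}"
    and energy: "\<And>a. a < D * dE \<Longrightarrow>
      E' (\<tau> a div dE') + h' (\<tau> a mod dE') = E (a div dE) + h (a mod dE)"
    and p: "\<And>i. i < D \<Longrightarrow> p i \<ge> 0"
    and v: "dim_vec v = D'" "proj v = spec D' W (\<lambda>i. if i = k then 1 else 0)"
  shows "\<exists>Ch \<in> thermal_ops \<beta> (spec D U E) (spec D' W E').
    infid (Ch (spec D U p)) (proj v)
      = 1 - (\<Sum>a<D * dE. p (a div dE) * gibbs_weight \<beta> dE h (a mod dE) * of_bool (\<tau> a div dE' = k))"
proof -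
  define N where "N = D * dE"
  have N': "N = D' * dE'" using dim by (simp add: N_def)
  interpret U: unitary_basis D U by fact
  interpret W: unitary_basis D' W by fact
  interpret I: unitary_basis dE "1\<^sub>m dE" by (rule unitary_basis_one)
  interpret I': unitary_basis dE' "1\<^sub>m dE'" by (rule unitary_basis_one)
  define K where "K = kron U (1\<^sub>m dE)"
  define K' where "K' = kron W (1\<^sub>m dE')"
  interpret K: unitary_basis N K unfolding N_def K_def by (rule unitary_basis_kron[OF U unitary_basis_one])
  interpret K': unitary_basis N K' unfolding N' K'_def by (rule unitary_basis_kron[OF W unitary_basis_one])
  define P :: "complex mat" where "P = Matrix.mat N N (\<lambda>(b,a). if b = \<tau> a then 1 else 0)"
  have P: "P \<in> carrier_mat N N" by (simp add: P_def)
  have \<tau>N: "\<tau> a < N" if "a < N" for a using bij that unfolding N_def bij_betw_def by auto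
  have \<tau>inj: "\<tau> a = \<tau> b \<longleftrightarrow> a = b" if "a < N" "b < N" for a b
    using bij that unfolding N_def bij_betw_def by (auto dest: inj_onD)
  interpret P: unitary_basis N P
  proof
    show "unitary P"
    proof (rule unitaryI[OF P], rule eq_matI)
      fix a b assume "a < dim_row (1\<^sub>m N :: complex mat)" "b < dim_col (1\<^sub>m N :: complex mat)"
      then have ab: "a < N" "b < N" by auto
      have "(adj P * P) $$ (a,b) = (\<Sum>c<N. (if c = \<tau> a then 1 else 0) * (if c = \<tau> b then 1 else 0))"
        using P ab by (subst index_mult_sum[of _ N N _ N]) (auto simp: P_def intro!: sum.cong)
      also have "\<dots> = (\<Sum>c<N. if c = \<tau> a then (if a = b then 1 else 0) else 0)"
        using \<tau>inj[OF ab] by (intro sum.cong) auto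
      finally show "(adj P * P) $$ (a,b) = 1\<^sub>m N $$ (a,b)" using ab \<tau>N by simp
    qed (use P in auto)
  qed (rule P)
  \<comment> \<open>Sends the product eigenvector numbered \<open>a\<close> of system plus bath to
    the one numbered \<open>\<tau> a\<close> of output plus environment.\<close>
  define V where "V = K' * P * adj K"
  have V: "unitary_basis N V" unfolding V_def
    by (intro unitary_basis_mult unitary_basis_adj) unfold_locales
  interpret V: unitary_basis N V by fact
  note assoc = assoc_mult_mat[of _ N N _ N _ N] mult_carrier_mat[of _ N N _ N]
  have VK: "V * K = K' * P"
    unfolding V_def by (simp add: assoc unitaryD[OF K.unitary K.carrier])
  define HE where "HE = spec dE (1\<^sub>m dE) h"
  define HE' where "HE' = spec dE' (1\<^sub>m dE') h'"
  have ham: "kron (spec D U E) (1\<^sub>m dE) + kron (1\<^sub>m D) HE = spec N K (\<lambda>a. E (a div dE) + h (a mod dE))"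
    unfolding HE_def K_def N_def by (rule kron_spec_add[OF U unitary_basis_one])
  have ham': "kron (spec D' W E') (1\<^sub>m dE') + kron (1\<^sub>m D') HE' = spec N K' (\<lambda>a. E' (a div dE') + h' (a mod dE'))"
    unfolding HE'_def K'_def N' by (rule kron_spec_add[OF W unitary_basis_one])
  let ?e = "mat_diag N (\<lambda>a. complex_of_real (E (a div dE) + h (a mod dE)))"
  let ?e' = "mat_diag N (\<lambda>a. complex_of_real (E' (a div dE') + h' (a mod dE')))"
  have "P * ?e = ?e' * P"
  proof (rule eq_matI)
    fix b a assume "b < dim_row (?e' * P)" "a < dim_col (?e' * P)"
    then have "b < N" "a < N" using P by auto
    moreover from this have "complex_of_real (E' (\<tau> a div dE') + h' (\<tau> a mod dE')) = complex_of_real (E (a div dE) + h (a mod dE))"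
      using energy[of a] by (simp only: N_def)
    ultimately show "(P * ?e) $$ (b,a) = (?e' * P) $$ (b,a)"
      using P by (simp add: mat_diag_mult_right[of P N N] mat_diag_mult_left[of P N N])
         (auto simp: P_def N_def)
  qed (use P in auto)
  then have comm: "V * (kron (spec D U E) (1\<^sub>m dE) + kron (1\<^sub>m D) HE)
      = (kron (spec D' W E') (1\<^sub>m dE') + kron (1\<^sub>m D') HE') * V"
    unfolding ham ham'
  proof -
    assume *: "P * ?e = ?e' * P"
    have "V * spec N K (\<lambda>a. E (a div dE) + h (a mod dE)) = (V * K) * ?e * adj K"
      unfolding spec_def by (simp add: assoc)
    also have "\<dots> = K' * (P * ?e) * adj K" unfolding VK by (simp add: assoc)
    also have "\<dots> = K' * ?e' * (adj K' * K') * P * adj K"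
      unfolding * by (simp add: assoc unitaryD[OF K'.unitary K'.carrier])
    also have "\<dots> = spec N K' (\<lambda>a. E' (a div dE') + h' (a mod dE')) * V"
      unfolding spec_def V_def by (simp add: assoc)
    finally show "V * spec N K (\<lambda>a. E (a div dE) + h (a mod dE)) = spec N K' (\<lambda>a. E' (a div dE') + h' (a mod dE')) * V" .
  qed
  define Ch where "Ch \<rho> = ptrace2 D' dE' (V * kron \<rho> (gibbs \<beta> HE) * adj V)" for \<rho>
  have mem: "Ch \<in> thermal_ops \<beta> (spec D U E) (spec D' W E')"
    unfolding thermal_ops_def mem_Collect_eq
    by (rule exI[of _ dE], rule exI[of _ HE], rule exI[of _ dE'], rule exI[of _ HE'], rule exI[of _ V])
       (use dE dim comm V.unitary V.carrier in
         \<open>auto simp: HE_def HE'_def I.hermitian_spec I'.hermitian_spec Ch_def N_def\<close>)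
  define c where "c a = p (a div dE) * gibbs_weight \<beta> dE h (a mod dE)" for a
  have "V * kron (spec D U p) (gibbs \<beta> HE) * adj V = spec N (V * K) c"
    unfolding HE_def I.gibbs_spec'[OF dE] kron_spec[OF U unitary_basis_one]
      unitary_conj_spec[OF K.unitary_basis_axioms[unfolded N_def K_def] V[unfolded N_def]]
    by (simp add: N_def K_def c_def[abs_def])
  then have Ch: "Ch (spec D U p) = ptrace2 D' dE' (spec (D' * dE') (K' * P) c)"
    unfolding Ch_def VK N' by simp
  have T: "unitary_basis (D' * dE') (K' * P)"
    using unitary_basis_mult[OF K'.unitary_basis_axioms P.unitary_basis_axioms] unfolding N' .
  have c0: "c a \<ge> 0" if "a < D' * dE'" for a
    unfolding c_def using p[of "a div dE"] gibbs_weight_pos[OF dE] that dim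
    by (intro mult_nonneg_nonneg) (auto intro: less_imp_le simp: less_mult_imp_div_less)
  \<comment> \<open>Between the two product eigenbases the amplitudes are the entries of the
    permutation matrix, so every transition probability is 0 or 1.\<close>
  have X: "adj K' * (K' * P) = P"
    using unitaryD[OF K'.unitary K'.carrier] P by (simp flip: assoc_mult_mat[of _ N N _ N _ N])
  have "infid (Ch (spec D U p)) (proj v) = 1 - (\<Sum>r<dE'. \<Sum>a<D' * dE'. c a * (cmod (P $$ (k * dE' + r, a)))\<^sup>2)"
    unfolding Ch
    by (subst infid_ptrace2[OF W unitary_basis_one T k c0 v]) (simp_all add: X[unfolded K'_def] K'_def)
  also have "(\<Sum>r<dE'. \<Sum>a<D' * dE'. c a * (cmod (P $$ (k * dE' + r, a)))\<^sup>2)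
      = (\<Sum>a<N. \<Sum>r<dE'. c a * of_bool (k * dE' + r = \<tau> a))"
    unfolding N'[symmetric]
  proof (subst sum.swap, intro sum.cong refl)
    fix a r assume "a \<in> {..<N}" "r \<in> {..<dE'}"
    then show "c a * (cmod (P $$ (k * dE' + r, a)))\<^sup>2 = c a * of_bool (k * dE' + r = \<tau> a)"
      using pair_index_less[OF k, of r dE'] by (simp add: P_def N')
  qed
  also have "\<dots> = (\<Sum>a<N. c a * of_bool (\<tau> a div dE' = k))"
  proof (rule sum.cong[OF refl])
    fix a assume "a \<in> {..<N}"
    then have "\<tau> a < D' * dE'" using \<tau>N N' by auto
    then have md: "\<tau> a mod dE' < dE'" using div_mod_less by blast
    have iff: "k * dE' + r = \<tau> a \<longleftrightarrow> \<tau> a div dE' = k \<and> r = \<tau> a mod dE'" if "r < dE'" for r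
      using that by (metis div_mult_mod_eq div_mult_self3 div_less add.commute add_0 mod_less mod_mult_self3 less_nat_zero_code)
    have "(\<Sum>r<dE'. c a * of_bool (k * dE' + r = \<tau> a)) = (\<Sum>r<dE'. if r = \<tau> a mod dE' then c a * of_bool (\<tau> a div dE' = k) else 0)"
      using iff by (intro sum.cong) auto
    then show "(\<Sum>r<dE'. c a * of_bool (k * dE' + r = \<tau> a)) = c a * of_bool (\<tau> a div dE' = k)"
      using md by simp
  qed
  finally show ?thesis using mem unfolding N_def c_def by (intro bexI[of _ Ch]) auto
qed

text \<open>The bath is one copy of the target together with \<open>m\<close> copies of system plus target, so that
  system plus bath is a string of \<open>m + 1\<close> letters; the operation outputs the target part of the first letter.\<close>
lemma thermal_distillation_error:
  assumes U: "unitary_basis D U" and W: "unitary_basis D' W" and D: "D > 0" and k: "k < D'"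
    and p: "\<And>i. i < D \<Longrightarrow> p i \<ge> 0" "(\<Sum>i<D. p i) = 1"
    and v: "dim_vec v = D'" "proj v = spec D' W (\<lambda>i. if i = k then 1 else 0)"
    and gap: "(\<Sum>i<D. gibbs_weight \<beta> D E i * of_bool (s i)) < gibbs_weight \<beta> D' E' k" and eps: "\<epsilon> > 0"
  shows "\<exists>Ch \<in> thermal_ops \<beta> (spec D U E) (spec D' W E').
    infid (Ch (spec D U p)) (proj v) \<le> 1 - (\<Sum>i<D. p i * of_bool (s i)) + \<epsilon>"
proof -
  define g where "g = gibbs_weight \<beta> D E"
  define g' where "g' = gibbs_weight \<beta> D' E'"
  have D': "D' > 0" using k by simp
  have gs: "(\<Sum>i<D. g i) = 1" "(\<Sum>j<D'. g' j) = 1" and gp: "g i > 0" "g' i > 0" for i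
    using gibbs_weight_sum D D' gibbs_weight_pos by (auto simp: g_def g'_def)
  define K where "K = {..<D} \<times> {..<D'}"
  have fin: "finite K" by (simp add: K_def)
  have sumK: "(\<Sum>z\<in>K. f (fst z) (snd z)) = (\<Sum>i<D. \<Sum>j<D'. f i j)" for f :: "nat \<Rightarrow> nat \<Rightarrow> real"
    unfolding K_def by (simp add: sum.cartesian_product case_prod_beta)
  define w where "w z = E (fst z) + E' (snd z)" for z
  define G where "G z = g (fst z) * g' (snd z)" for z
  define Q where "Q z = p (fst z) * g' (snd z)" for z
  have Gs: "sum G K = 1" and Qs: "sum Q K = 1"
    unfolding G_def Q_def sumK[of "\<lambda>i j. g i * g' j"] sumK[of "\<lambda>i j. p i * g' j"] sum_product[symmetric]
    using gs p by simp_all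
  \<comment> \<open>The drift of a Gibbs-distributed letter is the Gibbs weight of \<open>s\<close>
    minus that of the target level, negative by \<open>gap\<close>.\<close>
  have "(\<Sum>z\<in>K. G z * (of_bool (s (fst z)) - of_bool (snd z = k)))
      = (\<Sum>i<D. \<Sum>j<D'. (g i * of_bool (s i)) * g' j) - (\<Sum>i<D. \<Sum>j<D'. g i * (g' j * of_bool (j = k)))"
    unfolding G_def sumK[of "\<lambda>i j. g i * g' j * (of_bool (s i) - of_bool (j = k))"] sum_subtractf[symmetric]
    by (simp add: algebra_simps)
  also have "\<dots> = (\<Sum>i<D. g i * of_bool (s i)) - g' k"
  proof -
    have "(\<Sum>j<D'. g' j * of_bool (j = k)) = (\<Sum>j<D'. if j = k then g' k else 0)" by (rule sum.cong) auto
    then show ?thesis unfolding sum_product[symmetric] using gs k by simp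
  qed
  finally have gap': "(\<Sum>z\<in>K. G z * (of_bool (s (fst z)) - of_bool (snd z = k))) < 0"
    using gap by (simp add: g_def g'_def)
  obtain m \<pi> where \<pi>:
    "bij_betw \<pi> {xs. set xs \<subseteq> K \<and> length xs = Suc m} {xs. set xs \<subseteq> K \<and> length xs = Suc m}"
    "\<And>xs. xs \<in> {xs. set xs \<subseteq> K \<and> length xs = Suc m} \<Longrightarrow> sum_list (map w (\<pi> xs)) = sum_list (map w xs)"
    "(\<Sum>xs\<in>{xs. set xs \<subseteq> K \<and> length xs = Suc m}. Q (hd xs) * prod_list (map G (tl xs)) * of_bool (snd (hd (\<pi> xs)) = k))
      \<ge> (\<Sum>z\<in>K. Q z * of_bool (s (fst z))) - \<epsilon>"
  proof (rule bath_permutation[OF fin _ Gs _ Qs gap' eps, of w])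
    show "G z \<ge> 0" "Q z \<ge> 0" if "z \<in> K" for z
      using that gp(1)[of "fst z"] gp(2)[of "snd z"] p(1)[of "fst z"] by (auto simp: G_def Q_def K_def)
  qed blast
  define \<Omega> where "\<Omega> = {xs. set xs \<subseteq> K \<and> length xs = Suc m}"
  define L where "L = {xs. set xs \<subseteq> K \<and> length xs = m}"
  define n where "n = card L"
  have finL: "finite L" unfolding L_def by (rule finite_lists_length_eq[OF fin])
  have "replicate m (0,0) \<in> L" using D D' by (auto simp: L_def K_def)
  then have n0: "n > 0" unfolding n_def using finL by (auto simp: card_gt_0_iff)
  \<comment> \<open>The strings of the remaining \<open>m\<close> letters are numbered in arbitrary
    order to serve as matrix indices.\<close>
  obtain f where f: "bij_betw f {..<n} L"
    using ex_bij_betw_nat_finite[OF finL] by (auto simp: n_def atLeast0LessThan)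
  define f' where "f' = the_inv_into {..<n} f"
  have f'f: "f' (f r) = r" if "r < n" for r
    using f that unfolding f'_def bij_betw_def by (simp add: the_inv_into_f_f)
  have ff': "f (f' xs) = xs" and f'n: "f' xs < n" if "xs \<in> L" for xs
    using f that f_the_inv_into_f_bij_betw[OF f] bij_betw_the_inv_into[OF f]
    unfolding f'_def by (auto simp: bij_betw_def)
  have fL: "f r \<in> L" if "r < n" for r using f that by (auto simp: bij_betw_def)
  \<comment> \<open>The bath is a target copy with \<open>n\<close> strings. After the operation the
    first target part is the output, so a system copy with \<open>n\<close> strings remains.\<close>
  define dE where "dE = D' * n"
  define dE' where "dE' = D * n"
  have dE0: "dE > 0" using D' n0 by (simp add: dE_def)
  define R where "R r = sum_list (map w (f r))" for r
  define h where "h a = E' (a div n) + R (a mod n)" for a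
  define h' where "h' a = E (a div n) + R (a mod n)" for a
  \<comment> \<open>\<open>dec\<close> and \<open>enc\<close> put the system part first;
    \<open>enc'\<close> puts the target part first, so that the output is the leading factor kept by
    \<open>ptrace2\<close>.\<close>
  define dec where "dec a = (a div dE, (a mod dE) div n) # f (a mod n)" for a
  define enc where "enc xs = (fst (hd xs) * D' + snd (hd xs)) * n + f' (tl xs)" for xs
  define enc' where "enc' xs = (snd (hd xs) * D + fst (hd xs)) * n + f' (tl xs)" for xs
  have Om: "xs \<in> \<Omega> \<longleftrightarrow> (\<exists>i j ys. i < D \<and> j < D' \<and> ys \<in> L \<and> xs = (i,j) # ys)" for xs
    by (cases xs) (auto simp: \<Omega>_def L_def K_def)
  have div1: "(x * n + r) div n = x" "(x * n + r) mod n = r" if "r < n" for x r :: nat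
    using that by auto
  have idx: "((i * D' + j) * n + r) div dE = i" "((i * D' + j) * n + r) mod dE = j * n + r" "(i * D' + j) * n + r < D * dE"
    if "i < D" "j < D'" "r < n" for i j r
  proof -
    have jr: "j * n + r < dE" unfolding dE_def using that by (intro pair_index_less)
    have e: "(i * D' + j) * n + r = i * dE + (j * n + r)" by (simp add: dE_def algebra_simps)
    show "((i * D' + j) * n + r) div dE = i" "((i * D' + j) * n + r) mod dE = j * n + r"
      unfolding e using jr by auto
    show "(i * D' + j) * n + r < D * dE" unfolding e using that jr by (intro pair_index_less)
  qed
  have idx': "((j * D + i) * n + r) div dE' = j" "((j * D + i) * n + r) mod dE' = i * n + r" "(j * D + i) * n + r < D' * dE'"
    if "i < D" "j < D'" "r < n" for i j r
  proof -
    have jr: "i * n + r < dE'" unfolding dE'_def using that by (intro pair_index_less)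
    have e: "(j * D + i) * n + r = j * dE' + (i * n + r)" by (simp add: dE'_def algebra_simps)
    show "((j * D + i) * n + r) div dE' = j" "((j * D + i) * n + r) mod dE' = i * n + r"
      unfolding e using jr by auto
    show "(j * D + i) * n + r < D' * dE'" unfolding e using that jr by (intro pair_index_less)
  qed
  have dim: "D * dE = D' * dE'" by (simp add: dE_def dE'_def)
  have dec_form: "\<exists>i j r. i < D \<and> j < D' \<and> r < n \<and> a = (i * D' + j) * n + r" if "a < D * dE" for a
  proof (intro exI conjI)
    have a: "a < (D * D') * n" using that by (simp add: dE_def mult.assoc)
    from div_mod_less[OF a] have 1: "a div n < D * D'" "a mod n < n" by auto
    from div_mod_less[OF 1(1)] show "a div n div D' < D" "a div n mod D' < D'" by auto
    show "a mod n < n" by (rule 1)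
    show "a = (a div n div D' * D' + a div n mod D') * n + a mod n" by simp
  qed
  have dec_idx: "dec ((i * D' + j) * n + r) = (i,j) # f r" if "i < D" "j < D'" "r < n" for i j r
    unfolding dec_def using idx[OF that] div1[OF that(3)] by simp
  have dec_bij: "bij_betw dec {..<D * dE} \<Omega>"
  proof (rule bij_betwI[of _ _ _ enc])
    show "dec \<in> {..<D * dE} \<rightarrow> \<Omega>" using dec_form dec_idx fL by (fastforce simp: Om)
    show "enc \<in> \<Omega> \<rightarrow> {..<D * dE}" using idx(3) f'n by (fastforce simp: Om enc_def)
    show "enc (dec a) = a" if "a \<in> {..<D * dE}" for a
      using dec_form[of a] that dec_idx f'f by (auto simp: enc_def)
    show "dec (enc xs) = xs" if "xs \<in> \<Omega>" for xs
      using that dec_idx f'n ff' by (fastforce simp: Om enc_def)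
  qed
  have enc'_bij: "bij_betw enc' \<Omega> {..<D * dE}"
  proof (rule bij_betwI[of _ _ _ "\<lambda>a. ((a mod dE') div n, a div dE') # f (a mod n)"])
    have dec': "((a mod dE') div n, a div dE') # f (a mod n) = (i,j) # f r"
      if "a = (j * D + i) * n + r" "i < D" "j < D'" "r < n" for a i j r
      unfolding that(1) using idx'[OF that(2-)] div1[OF that(4)] by simp
    have form': "\<exists>i j r. i < D \<and> j < D' \<and> r < n \<and> a = (j * D + i) * n + r" if "a < D * dE" for a
    proof (intro exI conjI)
      have a: "a < (D' * D) * n" using that by (simp add: dE_def mult_ac)
      from div_mod_less[OF a] have 1: "a div n < D' * D" "a mod n < n" by auto
      from div_mod_less[OF 1(1)] show "a div n div D < D'" "a div n mod D < D" by auto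
      show "a mod n < n" by (rule 1)
      show "a = (a div n div D * D + a div n mod D) * n + a mod n" by simp
    qed
    show "enc' \<in> \<Omega> \<rightarrow> {..<D * dE}" using idx'(3) f'n dim by (fastforce simp: Om enc'_def)
    show "(\<lambda>a. ((a mod dE') div n, a div dE') # f (a mod n)) \<in> {..<D * dE} \<rightarrow> \<Omega>"
    proof
      fix a assume "a \<in> {..<D * dE}"
      then obtain i j r where "i < D" "j < D'" "r < n" "a = (j * D + i) * n + r" using form'[of a] unfolding lessThan_iff by blast
      then show "((a mod dE') div n, a div dE') # f (a mod n) \<in> \<Omega>"
        using dec'[of a j i r] fL by (auto simp: Om)
    qed
    show "((enc' xs mod dE') div n, enc' xs div dE') # f (enc' xs mod n) = xs" if "xs \<in> \<Omega>" for xs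
      using that dec'[OF refl, of _ _ "f' (tl xs)"] f'n ff' by (fastforce simp: Om enc'_def)
    show "enc' (((a mod dE') div n, a div dE') # f (a mod n)) = a" if "a \<in> {..<D * dE}" for a
    proof -
      obtain i j r where "i < D" "j < D'" "r < n" "a = (j * D + i) * n + r" using form'[of a] \<open>a \<in> {..<D * dE}\<close> unfolding lessThan_iff by blast
      then show ?thesis using dec'[of a j i r] f'f by (simp add: enc'_def)
    qed
  qed
  define \<tau> where "\<tau> = enc' \<circ> \<pi> \<circ> dec"
  have \<tau>: "bij_betw \<tau> {..<D * dE} {..<D * dE}"
    unfolding \<tau>_def using bij_betw_trans[OF bij_betw_trans[OF dec_bij \<pi>(1)[folded \<Omega>_def]] enc'_bij]
    by (simp add: o_assoc)
  have enc'_val: "enc' xs div dE' = snd (hd xs)"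
    "E' (enc' xs div dE') + h' (enc' xs mod dE') = sum_list (map w xs)" if "xs \<in> \<Omega>" for xs
  proof -
    from that obtain i j ys where x: "i < D" "j < D'" "ys \<in> L" "xs = (i,j) # ys" unfolding Om by blast
    note q = idx'[OF x(1,2) f'n[OF x(3)]] div1[OF f'n[OF x(3)]]
    show "enc' xs div dE' = snd (hd xs)" using x q by (simp add: enc'_def)
    show "E' (enc' xs div dE') + h' (enc' xs mod dE') = sum_list (map w xs)"
      using x q ff'[OF x(3)] by (simp add: enc'_def h'_def R_def w_def)
  qed
  have dec_val: "E (a div dE) + h (a mod dE) = sum_list (map w (dec a))" if "a < D * dE" for a
  proof -
    obtain i j r where x: "i < D" "j < D'" "r < n" "a = (i * D' + j) * n + r"
      using dec_form[OF \<open>a < D * dE\<close>] by blast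
    show ?thesis unfolding x(4) dec_idx[OF x(1-3)] using idx[OF x(1-3)] div1[OF x(3)]
      by (simp add: h_def R_def w_def)
  qed
  have dec\<Omega>: "dec a \<in> \<Omega>" "\<pi> (dec a) \<in> \<Omega>" if "a < D * dE" for a
    using that dec_bij \<pi>(1)[folded \<Omega>_def] by (auto simp: bij_betw_def)
  have energy: "E' (\<tau> a div dE') + h' (\<tau> a mod dE') = E (a div dE) + h (a mod dE)" if "a < D * dE" for a
    unfolding \<tau>_def o_def dec_val[OF that] enc'_val(2)[OF dec\<Omega>(2)[OF that]]
    using \<pi>(2)[folded \<Omega>_def, OF dec\<Omega>(1)[OF that]] .
  \<comment> \<open>The product of letter weights is the Boltzmann factor of the total energy;
    \<open>c\<close> is the partition function of one letter.\<close>
  have prodG: "prod_list (map G xs) = exp (- \<beta> * sum_list (map w xs)) / c ^ length xs"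
    if c: "c = (\<Sum>i<D. exp (- \<beta> * E i)) * (\<Sum>j<D'. exp (- \<beta> * E' j))" for xs c
  proof (induction xs)
    case (Cons z xs)
    have "G z = exp (- \<beta> * w z) / c"
      by (simp add: G_def g_def g'_def gibbs_weight_def w_def c distrib_left exp_add exp_diff exp_minus field_simps)
    then show ?case using Cons by (simp add: distrib_left exp_add exp_diff exp_minus field_simps)
  qed simp
  have bath: "gibbs_weight \<beta> dE h (j * n + r) = g' j * prod_list (map G (f r))" if "j < D'" "r < n" for j r
  proof -
    define c where "c = (\<Sum>i<D. exp (- \<beta> * E i)) * (\<Sum>j<D'. exp (- \<beta> * E' j))"
    define Z where "Z = (\<Sum>j<D'. exp (- \<beta> * E' j))"
    have "c > 0" unfolding c_def using D D' by (intro mult_pos_pos sum_pos) (auto simp: lessThan_empty_iff)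
    have ex: "exp (- \<beta> * h (j * n + r)) = Z * c ^ m * (g' j * prod_list (map G (f r)))" if "j < D'" "r < n" for j r
    proof -
      have "Z > 0" unfolding Z_def using D' by (intro sum_pos) (auto simp: lessThan_empty_iff)
      have "exp (- \<beta> * h (j * n + r)) = exp (- \<beta> * E' j) * exp (- \<beta> * R r)"
        using that by (simp add: h_def distrib_left exp_diff exp_add exp_minus field_simps)
      also have "exp (- \<beta> * E' j) = Z * g' j" using \<open>Z > 0\<close> by (simp add: g'_def gibbs_weight_def Z_def)
      also have "exp (- \<beta> * R r) = c ^ m * prod_list (map G (f r))"
        using fL[OF that(2)] \<open>c > 0\<close> by (simp add: prodG[OF c_def] R_def L_def)
      finally show ?thesis by simp
    qed
    \<comment> \<open>The bath partition function factorises into that of the target copy and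
      \<open>c ^ m\<close>, since the normalised weights sum to 1.\<close>
    have "(\<Sum>a<dE. exp (- \<beta> * h a)) = (\<Sum>j<D'. \<Sum>r<n. Z * c ^ m * (g' j * prod_list (map G (f r))))"
      unfolding dE_def sum_lessThan_mult by (intro sum.cong refl) (use ex in auto)
    also have "\<dots> = Z * c ^ m * ((\<Sum>j<D'. g' j) * (\<Sum>r<n. prod_list (map G (f r))))"
      unfolding sum_product by (simp only: sum_distrib_left)
    also have "(\<Sum>r<n. prod_list (map G (f r))) = (\<Sum>xs\<in>L. prod_list (map G xs))"
      by (rule sum.reindex_bij_betw[OF f])
    also have "\<dots> = 1" unfolding L_def sum_lists_prod[OF fin] Gs by simp
    finally have Zs: "(\<Sum>a<dE. exp (- \<beta> * h a)) = Z * c ^ m" using gs by simp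
    have "Z > 0" unfolding Z_def using D' by (intro sum_pos) (auto simp: lessThan_empty_iff)
    then show ?thesis unfolding gibbs_weight_def[of \<beta> dE] Zs ex[OF that] using \<open>c > 0\<close> by simp
  qed
  have "(\<Sum>a<D * dE. p (a div dE) * gibbs_weight \<beta> dE h (a mod dE) * of_bool (\<tau> a div dE' = k))
    = (\<Sum>a<D * dE. Q (hd (dec a)) * prod_list (map G (tl (dec a))) * of_bool (snd (hd (\<pi> (dec a))) = k))"
  proof (intro sum.cong refl)
    fix a assume "a \<in> {..<D * dE}"
    then have a: "a < D * dE" by simp
    obtain i j r where x: "i < D" "j < D'" "r < n" "a = (i * D' + j) * n + r" using dec_form[OF a] by blast
    have 1: "p (a div dE) * gibbs_weight \<beta> dE h (a mod dE) = Q (hd (dec a)) * prod_list (map G (tl (dec a)))"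
      unfolding x(4) dec_idx[OF x(1-3)] idx[OF x(1-3)] bath[OF x(2,3)] by (simp add: Q_def)
    have 2: "\<tau> a div dE' = snd (hd (\<pi> (dec a)))"
      unfolding \<tau>_def o_def using enc'_val(1)[OF dec\<Omega>(2)[OF a]] .
    show "p (a div dE) * gibbs_weight \<beta> dE h (a mod dE) * of_bool (\<tau> a div dE' = k)
      = Q (hd (dec a)) * prod_list (map G (tl (dec a))) * of_bool (snd (hd (\<pi> (dec a))) = k)"
      unfolding 1 2 ..
  qed
  also have "\<dots> = (\<Sum>xs\<in>\<Omega>. Q (hd xs) * prod_list (map G (tl xs)) * of_bool (snd (hd (\<pi> xs)) = k))"
    by (rule sum.reindex_bij_betw[OF dec_bij])
  also have "\<dots> \<ge> (\<Sum>z\<in>K. Q z * of_bool (s (fst z))) - \<epsilon>" using \<pi>(3) unfolding \<Omega>_def .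
  also have "(\<Sum>z\<in>K. Q z * of_bool (s (fst z))) = (\<Sum>i<D. \<Sum>j<D'. (p i * of_bool (s i)) * g' j)"
    unfolding Q_def sumK[of "\<lambda>i j. p i * g' j * of_bool (s i)"] by (simp add: mult_ac)
  also have "\<dots> = (\<Sum>i<D. p i * of_bool (s i))" unfolding sum_product[symmetric] gs by simp
  finally have ge: "(\<Sum>i<D. p i * of_bool (s i)) - \<epsilon> \<le> (\<Sum>a<D * dE. p (a div dE) * gibbs_weight \<beta> dE h (a mod dE) * of_bool (\<tau> a div dE' = k))" .
  obtain Ch where Ch: "Ch \<in> thermal_ops \<beta> (spec D U E) (spec D' W E')"
    "infid (Ch (spec D U p)) (proj v)
      = 1 - (\<Sum>a<D * dE. p (a div dE) * gibbs_weight \<beta> dE h (a mod dE) * of_bool (\<tau> a div dE' = k))"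
    using thermal_op_of_index_permutation[where E = E and E' = E' and h = h and h' = h' and p = p and \<beta> = \<beta>,
        OF U W dE0 dim k \<tau> energy p(1) v] by blast
  show ?thesis using ge Ch(2) by (intro bexI[OF _ Ch(1)]) linarith
qed

section \<open>Converse\<close>

text \<open>Neyman--Pearson: the overlap is the success probability of a test that passes the initial
  Gibbs state with probability exactly the target Gibbs weight.\<close>
lemma thermal_op_infid_ge:
  assumes U: "unitary_basis D U" and W: "unitary_basis D' W" and D: "D > 0" and k: "k < D'"
    and p: "\<And>i. i < D \<Longrightarrow> p i \<ge> 0"
    and v: "dim_vec v = D'" "proj v = spec D' W (\<lambda>i. if i = k then 1 else 0)"
    and Ch: "Ch \<in> thermal_ops \<beta> (spec D U E) (spec D' W E')"
  shows "infid (Ch (spec D U p)) (proj v)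
    \<ge> 1 - t * gibbs_weight \<beta> D' E' k - (\<Sum>i<D. max 0 (p i - t * gibbs_weight \<beta> D E i))"
proof -
  interpret U: unitary_basis D U by fact
  interpret W: unitary_basis D' W by fact
  from Ch obtain dE HE dE' HE' V where
    dE: "0 < dE" and HE: "HE \<in> carrier_mat dE dE" "hermitian HE"
    and HE': "HE' \<in> carrier_mat dE' dE'" "hermitian HE'"
    and dim: "D * dE = D' * dE'"
    and V: "V \<in> carrier_mat (D * dE) (D * dE)" "unitary V"
    and comm: "V * (kron (spec D U E) (1\<^sub>m dE) + kron (1\<^sub>m D) HE)
      = (kron (spec D' W E') (1\<^sub>m dE') + kron (1\<^sub>m D') HE') * V"
    and Cheq: "\<And>\<rho>. \<rho> \<in> carrier_mat D D \<Longrightarrow> Ch \<rho> = ptrace2 D' dE' (V * kron \<rho> (gibbs \<beta> HE) * adj V)"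
    unfolding thermal_ops_def mem_Collect_eq U.dim_spec W.dim_spec by blast
  define N where "N = D * dE"
  have N': "N = D' * dE'" using dim by (simp add: N_def)
  have N0: "N > 0" using D dE by (simp add: N_def)
  then have dE': "dE' > 0" and D': "D' > 0" unfolding N' by auto
  obtain Y h where Y: "unitary_basis dE Y" and HEe: "HE = spec dE Y h"
    by (rule hermitian_diagonalisation[OF HE])
  obtain Y' h' where Y': "unitary_basis dE' Y'" and HEe': "HE' = spec dE' Y' h'"
    by (rule hermitian_diagonalisation[OF HE'])
  interpret Y: unitary_basis dE Y by fact
  interpret Y': unitary_basis dE' Y' by fact
  define K where "K = kron U Y"
  define K' where "K' = kron W Y'"
  interpret K: unitary_basis N K unfolding N_def K_def by (rule unitary_basis_kron[OF U Y])
  interpret K': unitary_basis N K' unfolding N' K'_def by (rule unitary_basis_kron[OF W Y'])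
  interpret V: unitary_basis N V by unfold_locales (use V in \<open>auto simp: N_def\<close>)
  define e where "e a = E (a div dE) + h (a mod dE)" for a
  define e' where "e' b = E' (b div dE') + h' (b mod dE')" for b
  have ham: "kron (spec D U E) (1\<^sub>m dE) + kron (1\<^sub>m D) HE = spec N K e"
    unfolding HEe K_def N_def e_def[abs_def] by (rule kron_spec_add[OF U Y])
  have ham': "kron (spec D' W E') (1\<^sub>m dE') + kron (1\<^sub>m D') HE' = spec N K' e'"
    unfolding HEe' K'_def N' e'_def[abs_def] by (rule kron_spec_add[OF W Y'])
  note assoc = assoc_mult_mat[of _ N N _ N _ N] mult_carrier_mat[of _ N N _ N]
  \<comment> \<open>Amplitudes from the initial to the final product energy eigenbasis; the
    intertwining relation forces them to vanish between different energies.\<close>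
  define X where "X = adj K' * (V * K)"
  interpret X: unitary_basis N X unfolding X_def
    by (intro unitary_basis_mult unitary_basis_adj) unfold_locales
  let ?e = "mat_diag N (\<lambda>a. complex_of_real (e a))"
  let ?e' = "mat_diag N (\<lambda>a. complex_of_real (e' a))"
  have "X * ?e = adj K' * (V * spec N K e) * K"
    unfolding X_def spec_def by (simp add: assoc unitaryD[OF K.unitary K.carrier])
  also have "\<dots> = adj K' * (spec N K' e' * V) * K" using comm unfolding ham ham' by simp
  also have "\<dots> = (adj K' * K') * ?e' * (adj K' * (V * K))" unfolding spec_def by (simp add: assoc)
  also have "\<dots> = ?e' * X" unfolding X_def unitaryD[OF K'.unitary K'.carrier] by (simp add: assoc)
  finally have XX: "X * ?e = ?e' * X" .
  have cons: "X $$ (b,a) = 0 \<or> e a = e' b" if "a < N" "b < N" for a b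
    using arg_cong[OF XX, of "\<lambda>M. M $$ (b,a)"] that
    by (simp add: mat_diag_mult_right[of X N N] mat_diag_mult_left[of X N N])
  \<comment> \<open>The doubly stochastic matrix of squared amplitudes: \<open>Bcol\<close> and
    \<open>Brow\<close> are the unitarity of \<open>X\<close>.\<close>
  define B where "B b a = (cmod (X $$ (b,a)))\<^sup>2" for a b
  have B0: "B b a \<ge> 0" for a b by (simp add: B_def)
  have Be: "f (e a) * B b a = f (e' b) * B b a" if "a < N" "b < N" for a b and f :: "real \<Rightarrow> real"
    using cons[OF that] by (auto simp: B_def)
  have Bcol: "(\<Sum>b<N. B b a) = 1" if "a < N" for a
  proof -
    have "complex_of_real (\<Sum>b<N. B b a) = (\<Sum>b<N. cnj (X $$ (b,a)) * X $$ (b,a))"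
      unfolding B_def of_real_sum complex_norm_square by (simp add: mult.commute)
    then show ?thesis using unitary_cols[OF X.unitary X.carrier that that] by (simp only: of_real_eq_1_iff simp_thms if_True)
  qed
  have Brow: "(\<Sum>a<N. B b a) = 1" if "b < N" for b
  proof -
    have "complex_of_real (\<Sum>a<N. B b a) = (\<Sum>a<N. X $$ (b,a) * cnj (X $$ (b,a)))"
      unfolding B_def of_real_sum complex_norm_square ..
    then show ?thesis using unitary_rows[OF X.unitary X.carrier that that] by (simp only: of_real_eq_1_iff simp_thms if_True)
  qed
  define Z ZE Z' ZE' where "Z = (\<Sum>i<D. exp (- \<beta> * E i))" "ZE = (\<Sum>i<dE. exp (- \<beta> * h i))"
    "Z' = (\<Sum>i<D'. exp (- \<beta> * E' i))" "ZE' = (\<Sum>i<dE'. exp (- \<beta> * h' i))"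
  note Zdefs = this
  have Zpos: "Z > 0" "ZE > 0" "Z' > 0" "ZE' > 0"
    unfolding Zdefs using D D' dE dE' by (auto intro!: sum_pos simp: lessThan_empty_iff)
  have exp_split: "exp (- (\<beta> * (x + y))) = exp (- (\<beta> * x)) * exp (- (\<beta> * y))" for x y
    by (simp add: distrib_left exp_diff exp_minus field_simps exp_add)
  \<comment> \<open>Equality of total partition functions: double stochasticity moves the Boltzmann
    factors from initial to final levels without changing their sum.\<close>
  have "Z * ZE = (\<Sum>a<N. exp (- \<beta> * e a))"
    unfolding N_def sum_lessThan_mult Zdefs sum_product
    by (intro sum.cong refl) (simp add: e_def exp_split)
  also have "\<dots> = (\<Sum>a<N. \<Sum>b<N. exp (- \<beta> * e a) * B b a)"
    unfolding sum_distrib_left[symmetric] by (intro sum.cong refl) (simp add: Bcol)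
  also have "\<dots> = (\<Sum>b<N. \<Sum>a<N. exp (- \<beta> * e' b) * B b a)"
    by (subst sum.swap) (intro sum.cong refl Be[where f = "\<lambda>x. exp (- \<beta> * x)"], auto)
  also have "\<dots> = (\<Sum>b<N. exp (- \<beta> * e' b))"
    unfolding sum_distrib_left[symmetric] by (intro sum.cong refl) (simp add: Brow)
  also have "\<dots> = Z' * ZE'"
    unfolding N' sum_lessThan_mult Zdefs sum_product
    by (intro sum.cong refl) (simp add: e'_def exp_split)
  finally have ZZ: "Z * ZE = Z' * ZE'" .
  define g where "g = gibbs_weight \<beta> D E"
  define hg where "hg = gibbs_weight \<beta> dE h"
  \<comment> \<open>Acceptance probability of the test on initial level \<open>a\<close>: the
    probability of ending in some level whose output part is \<open>k\<close>.\<close>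
  define m where "m a = (\<Sum>r<dE'. B (k * dE' + r) a)" for a
  have kr: "k * dE' + r < N" if "r < dE'" for r unfolding N' using pair_index_less[OF k that] .
  have m: "0 \<le> m a" "m a \<le> 1" if "a < N" for a
  proof -
    show "0 \<le> m a" unfolding m_def using B0 by (auto intro: sum_nonneg)
    have "m a = (\<Sum>b\<in>(\<lambda>r. k * dE' + r) ` {..<dE'}. B b a)"
      unfolding m_def by (subst sum.reindex) (auto simp: inj_on_def)
    also have "\<dots> \<le> (\<Sum>b<N. B b a)" using B0 kr by (intro sum_mono2) auto
    finally show "m a \<le> 1" using Bcol[OF that] by simp
  qed
  have hgpos: "hg s > 0" for s unfolding hg_def by (rule gibbs_weight_pos[OF dE])
  have Ga: "g (a div dE) * hg (a mod dE) = exp (- \<beta> * e a) / (Z * ZE)" for a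
    unfolding g_def hg_def gibbs_weight_def e_def Zdefs by (simp add: exp_split)
  have "(\<Sum>a<N. g (a div dE) * hg (a mod dE) * m a) = (\<Sum>r<dE'. \<Sum>a<N. exp (- \<beta> * e a) * B (k * dE' + r) a) / (Z * ZE)"
    unfolding Ga m_def by (subst sum.swap) (simp add: sum_distrib_left sum_divide_distrib)
  also have "(\<Sum>r<dE'. \<Sum>a<N. exp (- \<beta> * e a) * B (k * dE' + r) a) = (\<Sum>r<dE'. exp (- \<beta> * e' (k * dE' + r)))"
  proof (intro sum.cong refl)
    fix r assume "r \<in> {..<dE'}"
    then have r: "k * dE' + r < N" using kr by auto
    have "(\<Sum>a<N. exp (- \<beta> * e a) * B (k * dE' + r) a) = (\<Sum>a<N. exp (- \<beta> * e' (k * dE' + r)) * B (k * dE' + r) a)"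
      by (intro sum.cong refl Be[where f = "\<lambda>x. exp (- \<beta> * x)"]) (use r in auto)
    then show "(\<Sum>a<N. exp (- \<beta> * e a) * B (k * dE' + r) a) = exp (- \<beta> * e' (k * dE' + r))"
      unfolding sum_distrib_left[symmetric] Brow[OF r] by simp
  qed
  also have "\<dots> = exp (- \<beta> * E' k) * ZE'"
    unfolding Zdefs sum_distrib_left
    by (intro sum.cong refl) (simp add: e'_def exp_split)
  also have "\<dots> / (Z * ZE) = gibbs_weight \<beta> D' E' k"
    unfolding ZZ gibbs_weight_def using Zpos by (simp add: Zdefs)
  finally have pass: "(\<Sum>a<N. g (a div dE) * hg (a mod dE) * m a) = gibbs_weight \<beta> D' E' k" .
  define c where "c a = p (a div dE) * hg (a mod dE)" for a
  have "V * kron (spec D U p) (gibbs \<beta> HE) * adj V = spec N (V * K) c"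
    unfolding HEe Y.gibbs_spec'[OF dE] kron_spec[OF U Y]
      unitary_conj_spec[OF K.unitary_basis_axioms[unfolded N_def K_def] V.unitary_basis_axioms[unfolded N_def]]
    by (simp add: N_def K_def c_def[abs_def] hg_def)
  then have Ch': "Ch (spec D U p) = ptrace2 D' dE' (spec (D' * dE') (V * K) c)"
    unfolding Cheq[OF U.spec_carrier] N' by simp
  have T: "unitary_basis (D' * dE') (V * K)"
    using unitary_basis_mult[OF V.unitary_basis_axioms K.unitary_basis_axioms] unfolding N' .
  have c0: "c a \<ge> 0" if "a < D' * dE'" for a
    unfolding c_def using p[of "a div dE"] hgpos that dim
    by (intro mult_nonneg_nonneg) (auto intro: less_imp_le simp: less_mult_imp_div_less)
  have "infid (Ch (spec D U p)) (proj v) = 1 - (\<Sum>r<dE'. \<Sum>a<N. c a * B (k * dE' + r) a)"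
    unfolding Ch' by (subst infid_ptrace2[OF W Y' T k c0 v]) (simp_all add: X_def B_def K'_def N')
  also have "(\<Sum>r<dE'. \<Sum>a<N. c a * B (k * dE' + r) a) = (\<Sum>a<N. c a * m a)"
    unfolding m_def by (subst sum.swap) (simp add: sum_distrib_left)
  \<comment> \<open>Subtracts \<open>t\<close> times the acceptance probability of the Gibbs state;
    the remaining differences are then bounded by their positive parts, as \<open>m a\<close> lies
    between 0 and 1.\<close>
  also have "(\<Sum>a<N. c a * m a) = t * gibbs_weight \<beta> D' E' k
      + (\<Sum>a<N. (p (a div dE) - t * g (a div dE)) * (hg (a mod dE) * m a))"
    unfolding pass[symmetric] sum_distrib_left sum.distrib[symmetric]
    by (intro sum.cong refl) (simp add: c_def algebra_simps)
  finally have inf: "infid (Ch (spec D U p)) (proj v) = 1 - (t * gibbs_weight \<beta> D' E' k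
      + (\<Sum>a<N. (p (a div dE) - t * g (a div dE)) * (hg (a mod dE) * m a)))" .
  have "(\<Sum>a<N. (p (a div dE) - t * g (a div dE)) * (hg (a mod dE) * m a))
      \<le> (\<Sum>a<N. max 0 (p (a div dE) - t * g (a div dE)) * hg (a mod dE))"
  proof (rule sum_mono)
    fix a assume "a \<in> {..<N}"
    then have ma: "0 \<le> m a" "m a \<le> 1" using m by auto
    have "(p (a div dE) - t * g (a div dE)) * (hg (a mod dE) * m a)
      \<le> max 0 (p (a div dE) - t * g (a div dE)) * (hg (a mod dE) * m a)"
      using ma hgpos[of "a mod dE"] by (intro mult_right_mono) auto
    also have "\<dots> \<le> max 0 (p (a div dE) - t * g (a div dE)) * (hg (a mod dE) * 1)"
      using ma hgpos[of "a mod dE"] by (intro mult_left_mono) auto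
    finally show "(p (a div dE) - t * g (a div dE)) * (hg (a mod dE) * m a)
      \<le> max 0 (p (a div dE) - t * g (a div dE)) * hg (a mod dE)" by simp
  qed
  also have "\<dots> = (\<Sum>i<D. max 0 (p i - t * g i)) * (\<Sum>s<dE. hg s)"
    unfolding N_def sum_lessThan_mult sum_product by (intro sum.cong refl) simp
  also have "(\<Sum>s<dE. hg s) = 1" unfolding hg_def by (rule gibbs_weight_sum[OF dE])
  finally show ?thesis unfolding inf g_def by simp
qed

section \<open>The central limit theorem for triangular arrays\<close>

text \<open>The exponent 3/2 suits both regimes, dominating \<open>a\<^sup>2\<close> for small and
  \<open>a\<close> for large arguments. With \<open>a\<close> proportional to a variance it produces
  exactly what a third moment controls.\<close>

lemma abs_one_minus_exp_le:
  fixes a :: real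
  assumes "a \<ge> 0"
  shows "\<bar>exp (- a) - (1 - a)\<bar> \<le> a powr (3/2)"
proof -
  have lo: "exp (- a) \<ge> 1 - a" using exp_ge_add_one_self[of "- a"] by simp
  show ?thesis
  proof (cases "a \<le> 1")
    case True
    have "exp (- a) \<le> 1 + (- a) + (- a)\<^sup>2"
      by (rule exp_le_quadratic) (use True assms in auto)
    moreover have "a\<^sup>2 \<le> a powr (3/2)"
    proof (cases "a = 0")
      case False
      then have "a\<^sup>2 = a powr 2" using assms by (simp add: powr_numeral)
      also have "\<dots> \<le> a powr (3/2)" using True assms False by (intro powr_mono') auto
      finally show ?thesis .
    qed simp
    ultimately show ?thesis using lo by simp
  next
    case False
    then have "exp (- a) - (1 - a) \<le> a" using assms by (smt (verit) exp_le_one_iff)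
    also have "a = a powr 1" using assms by simp
    also have "\<dots> \<le> a powr (3/2)" using False by (intro powr_mono) auto
    finally show ?thesis using lo by simp
  qed
qed

text \<open>Lyapunov's inequality between moments. As a function of \<open>y\<^sup>2\<close> the
  cube is convex; its tangent at the second moment lies below it, and integrating the tangent gives
  the bound.\<close>

lemma (in prob_space) variance_powr_le_third_moment:
  fixes X :: "'a \<Rightarrow> real"
  assumes "integrable M (\<lambda>x. (X x)\<^sup>2)" "integrable M (\<lambda>x. \<bar>X x\<bar> ^ 3)"
  shows "(expectation (\<lambda>x. (X x)\<^sup>2)) powr (3/2) \<le> expectation (\<lambda>x. \<bar>X x\<bar> ^ 3)"
proof -
  define V where "V = expectation (\<lambda>x. (X x)\<^sup>2)"
  have V0: "V \<ge> 0" unfolding V_def by simp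
  define r where "r = sqrt V"
  have r0: "r \<ge> 0" and rV: "r\<^sup>2 = V" using V0 by (auto simp: r_def)
  have tangent: "y ^ 3 \<ge> 3/2 * r * y\<^sup>2 - r ^ 3 / 2" if "y \<ge> 0" for y :: real
  proof -
    have "y ^ 3 - (3/2 * r * y\<^sup>2 - r ^ 3 / 2) = (y - r)\<^sup>2 * (y + r / 2)"
      by (simp add: power2_eq_square power3_eq_cube field_simps)
    moreover have "(y - r)\<^sup>2 * (y + r / 2) \<ge> 0" using that r0 by simp
    ultimately show ?thesis by linarith
  qed
  have "V powr (3/2) = r ^ 3"
  proof (cases "V = 0")
    case False
    then have "V powr (3/2) = (V powr (1/2)) powr 3" using V0 by (simp add: powr_powr)
    also have "\<dots> = r ^ 3" using V0 False by (simp add: powr_half_sqrt r_def powr_numeral)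
    finally show ?thesis .
  qed (simp add: r_def)
  also have "\<dots> = 3/2 * r * V - r ^ 3 / 2" unfolding rV[symmetric] by (simp add: power2_eq_square power3_eq_cube)
  also have "\<dots> = expectation (\<lambda>x. 3/2 * r * (X x)\<^sup>2 - r ^ 3 / 2)"
    using assms(1) by (simp add: V_def prob_space)
  also have "\<dots> \<le> expectation (\<lambda>x. \<bar>X x\<bar> ^ 3)"
  proof (rule integral_mono)
    show "3/2 * r * (X x)\<^sup>2 - r ^ 3 / 2 \<le> \<bar>X x\<bar> ^ 3" for x using tangent[of "\<bar>X x\<bar>"] by simp
  qed (use assms in auto)
  finally show ?thesis unfolding V_def .
qed

section \<open>The standard normal distribution function\<close>

lemma Phi_eq_cdf: "Phi x = cdf std_normal_distribution x"
proof -
  have "cdf std_normal_distribution x = measure std_normal_distribution {..x}" by (simp add: cdf_def)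
  also have "\<dots> = (LINT t:{..x}|lborel. std_normal_density t)"
    unfolding measure_def set_lebesgue_integral_def
    by (subst emeasure_density) (auto simp: integral_eq_nn_integral mult.commute ennreal_mult'' intro!: arg_cong[where f = enn2real] nn_integral_cong split: split_indicator)
  finally show ?thesis by (simp add: Phi_def)
qed

lemma isCont_Phi: "isCont Phi x"
proof -
  interpret real_distribution std_normal_distribution by (rule real_dist_normal_dist)
  have "emeasure std_normal_distribution {x} = 0"
    by (subst emeasure_density) (auto simp: nn_integral_null_set AE_lborel_singleton intro!: nn_integral_0_iff_AE[THEN iffD2] AE_I[of _ _ "{x}"] split: split_indicator)
  then have "isCont (cdf std_normal_distribution) x" unfolding isCont_cdf measure_def by simp
  moreover have "Phi = cdf std_normal_distribution" using Phi_eq_cdf by auto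
  ultimately show ?thesis by simp
qed

lemma Phi_at_top: "(Phi \<longlongrightarrow> 1) at_top" and Phi_at_bot: "(Phi \<longlongrightarrow> 0) at_bot" and
  Phi_ge_0: "0 \<le> Phi x" and Phi_le_1: "Phi x \<le> 1"
proof -
  interpret real_distribution std_normal_distribution by (rule real_dist_normal_dist)
  have P: "Phi = cdf std_normal_distribution" using Phi_eq_cdf by auto
  show "(Phi \<longlongrightarrow> 1) at_top" unfolding P by (rule cdf_lim_at_top_prob)
  show "(Phi \<longlongrightarrow> 0) at_bot" unfolding P by (rule cdf_lim_at_bot)
  show "0 \<le> Phi x" "Phi x \<le> 1" unfolding P by (simp_all add: cdf_nonneg cdf_bounded_prob)
qed

lemma Phi_diff:
  assumes "x \<le> y"
  shows "Phi y - Phi x = measure std_normal_distribution {x<..y}"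
proof -
  interpret real_distribution std_normal_distribution by (rule real_dist_normal_dist)
  show ?thesis unfolding Phi_eq_cdf using assms cdf_diff_eq[of x y] by (cases "x = y") auto
qed

lemma Phi_strict_mono:
  assumes "x < y"
  shows "Phi x < Phi y"
proof -
  interpret real_distribution std_normal_distribution by (rule real_dist_normal_dist)
  have "emeasure std_normal_distribution {x<..y} = (\<integral>\<^sup>+t. ennreal (std_normal_density t) * indicator {x<..y} t \<partial>lborel)"
    by (subst emeasure_density) auto
  moreover have "(\<integral>\<^sup>+t. ennreal (std_normal_density t) * indicator {x<..y} t \<partial>lborel) \<noteq> 0"
  proof
    assume "(\<integral>\<^sup>+t. ennreal (std_normal_density t) * indicator {x<..y} t \<partial>lborel) = 0"
    then have "AE t in lborel. ennreal (std_normal_density t) * indicator {x<..y} t = 0"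
      by (subst (asm) nn_integral_0_iff_AE) auto
    then have "AE t in lborel. t \<notin> {x<..y}"
    proof eventually_elim
      case (elim t)
      have "std_normal_density t > 0" by (simp add: normal_density_pos)
      then show ?case using elim by (auto split: split_indicator_asm)
    qed
    then have "emeasure lborel {x<..y} = 0"
      by (subst (asm) AE_iff_measurable[of "{x<..y}"]) auto
    then show False using assms by simp
  qed
  ultimately have "measure std_normal_distribution {x<..y} > 0"
    by (metis emeasure_eq_measure ennreal_0 measure_nonneg order_le_less)
  then show ?thesis using Phi_diff[of x y] assms by simp
qed

text \<open>The density is at most 1. The bound makes a vanishing shift of the argument harmless
  even when the argument itself diverges.\<close>

lemma Phi_lipschitz:
  assumes "x \<le> y"
  shows "Phi y - Phi x \<le> y - x"
proof -
  interpret real_distribution std_normal_distribution by (rule real_dist_normal_dist)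
  have "emeasure std_normal_distribution {x<..y} = (\<integral>\<^sup>+t. ennreal (std_normal_density t) * indicator {x<..y} t \<partial>lborel)"
    by (subst emeasure_density) auto
  also have "\<dots> \<le> (\<integral>\<^sup>+t. indicator {x<..y} t \<partial>lborel)"
  proof (rule nn_integral_mono)
    fix t :: real
    have "sqrt (2 * pi) \<ge> 1" using pi_gt3 by simp
    then have "1 / sqrt (2 * pi) \<le> 1" by simp
    moreover have "exp (- t\<^sup>2 / 2) \<le> 1" by simp
    ultimately have "1 / sqrt (2 * pi) * exp (- t\<^sup>2 / 2) \<le> 1"
      by (intro mult_le_one) auto
    then have "std_normal_density t \<le> 1" by (simp add: std_normal_density_def)
    then show "ennreal (std_normal_density t) * indicator {x<..y} t \<le> indicator {x<..y} t"
      by (auto split: split_indicator)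
  qed
  also have "\<dots> = ennreal (y - x)" using assms by simp
  finally have "measure std_normal_distribution {x<..y} \<le> y - x"
    using assms by (simp add: emeasure_eq_measure)
  then show ?thesis using Phi_diff[OF assms] by simp
qed

text \<open>Levy continuity: the characteristic functions of the summands are compared factor by factor with
  those of centred Gaussians of the same variance.\<close>
theorem lyapunov_clt:
  fixes \<mu> :: "nat \<Rightarrow> nat \<Rightarrow> real measure"
  assumes prob: "\<And>N n. prob_space (\<mu> N n)" and sets: "\<And>N n. sets (\<mu> N n) = sets borel"
    and int3: "\<And>N n. integrable (\<mu> N n) (\<lambda>x. \<bar>x\<bar> ^ 3)"
  defines "m \<equiv> \<lambda>N n. \<integral>x. x \<partial>\<mu> N n"
  defines "var \<equiv> \<lambda>N. \<Sum>n<N. \<integral>x. (x - m N n)\<^sup>2 \<partial>\<mu> N n"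
  defines "rho \<equiv> \<lambda>N. \<Sum>n<N. \<integral>x. \<bar>x - m N n\<bar> ^ 3 \<partial>\<mu> N n"
  assumes var_pos: "\<forall>\<^sub>F N in sequentially. 0 < var N"
    and lyap: "(\<lambda>N. rho N / var N powr (3/2)) \<longlonglongrightarrow> 0"
  shows "(\<lambda>N. measure (PiM {..<N} (\<mu> N))
      {f \<in> space (PiM {..<N} (\<mu> N)). (\<Sum>n<N. f n - m N n) \<le> y * sqrt (var N)}) \<longlonglongrightarrow> Phi y"
proof -
  interpret P: prob_space "\<mu> N n" for N n by (rule prob)
  interpret PP: product_prob_space "\<mu> N" for N by unfold_locales
  interpret Q: prob_space "PiM {..<N} (\<mu> N)" for N by (rule prob_space_PiM) (rule prob)
  have [measurable_cong]: "sets (\<mu> N n) = sets borel" for N n by (rule sets)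
  have space: "space (\<mu> N n) = UNIV" for N n using sets_eq_imp_space_eq[OF sets] by simp
  define s where "s N = sqrt (var N)" for N
  define M where "M N = distr (PiM {..<N} (\<mu> N)) borel (\<lambda>f. (\<Sum>n<N. f n - m N n) / s N)" for N
  have meas [measurable]: "(\<lambda>f. (\<Sum>n<N. f n - m N n) / s N) \<in> borel_measurable (PiM {..<N} (\<mu> N))" for N
    by measurable
  have rd: "real_distribution (M N)" for N
    unfolding M_def by (intro Q.real_distribution_distr) measurable
  have i1: "integrable (\<mu> N n) (\<lambda>x. x)" and i2: "integrable (\<mu> N n) (\<lambda>x. x\<^sup>2)" for N n
  proof -
    have "x\<^sup>2 \<le> 1 + \<bar>x\<bar> ^ 3" for x :: real
    proof (cases "\<bar>x\<bar> \<le> 1")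
      case True
      then have "x\<^sup>2 \<le> 1" by (simp add: abs_square_le_1)
      then show ?thesis by (simp add: add_increasing2)
    next
      case False
      then have "\<bar>x\<bar> ^ 2 \<le> \<bar>x\<bar> ^ 3" by (intro power_increasing) auto
      then show ?thesis by simp
    qed
    then have le: "norm (x\<^sup>2) \<le> norm (1 + \<bar>x\<bar> ^ 3)" for x :: real by (simp add: abs_of_nonneg)
    show 2: "integrable (\<mu> N n) (\<lambda>x. x\<^sup>2)"
    proof (rule Bochner_Integration.integrable_bound)
      show "integrable (\<mu> N n) (\<lambda>x. 1 + \<bar>x\<bar> ^ 3)"
        by (intro Bochner_Integration.integrable_add int3) simp
      show "AE x in \<mu> N n. norm (x\<^sup>2) \<le> norm (1 + \<bar>x\<bar> ^ 3)" using le by (intro AE_I2)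
      show "(\<lambda>x. x\<^sup>2) \<in> borel_measurable (\<mu> N n)" by measurable
    qed
    show "integrable (\<mu> N n) (\<lambda>x. x)"
      by (rule P.square_integrable_imp_integrable[OF _ 2]) measurable
  qed
  have c2: "integrable (\<mu> N n) (\<lambda>x. (x - m N n)\<^sup>2)" for N n
    unfolding power2_diff using i1 i2 by auto
  have c3: "integrable (\<mu> N n) (\<lambda>x. \<bar>x - m N n\<bar> ^ 3)" for N n
  proof (rule Bochner_Integration.integrable_bound[where f = "\<lambda>x. 4 * (\<bar>x\<bar> ^ 3 + \<bar>m N n\<bar> ^ 3)"])
    show "AE x in \<mu> N n. norm (\<bar>x - m N n\<bar> ^ 3) \<le> norm (4 * (\<bar>x\<bar> ^ 3 + \<bar>m N n\<bar> ^ 3))"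
    proof (rule AE_I2)
      fix x
      have convex: "(a + b) ^ 3 \<le> 4 * (a ^ 3 + b ^ 3)" if "a \<ge> 0" "b \<ge> 0" for a b :: real
      proof -
        have "4 * (a ^ 3 + b ^ 3) - (a + b) ^ 3 = 3 * (a + b) * (a - b)\<^sup>2"
          by (simp add: power2_eq_square power3_eq_cube algebra_simps)
        moreover have "3 * (a + b) * (a - b)\<^sup>2 \<ge> 0" using that by simp
        ultimately show ?thesis by linarith
      qed
      have "\<bar>x - m N n\<bar> ^ 3 \<le> (\<bar>x\<bar> + \<bar>m N n\<bar>) ^ 3" by (intro power_mono abs_triangle_ineq4) auto
      also have "\<dots> \<le> 4 * (\<bar>x\<bar> ^ 3 + \<bar>m N n\<bar> ^ 3)" by (rule convex) auto
      finally show "norm (\<bar>x - m N n\<bar> ^ 3) \<le> norm (4 * (\<bar>x\<bar> ^ 3 + \<bar>m N n\<bar> ^ 3))" by simp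
    qed
  qed (auto simp: int3)
  define v where "v N n = (\<integral>x. (x - m N n)\<^sup>2 \<partial>\<mu> N n)" for N n
  define k where "k N n = (\<integral>x. \<bar>x - m N n\<bar> ^ 3 \<partial>\<mu> N n)" for N n
  have v0: "v N n \<ge> 0" and k0: "k N n \<ge> 0" for N n unfolding v_def k_def by auto
  have vk: "v N n powr (3/2) \<le> k N n" for N n
    unfolding v_def k_def by (rule P.variance_powr_le_third_moment[OF c2 c3])
  have conv: "(\<lambda>N. char (M N) t) \<longlonglongrightarrow> char std_normal_distribution t" for t
  proof -
    define z where "z N n = char (distr (\<mu> N n) borel (\<lambda>x. x - m N n)) (t / s N)" for N n
    have charM: "char (M N) t = (\<Prod>n<N. z N n)" for N
    proof -
      have "char (M N) t = (\<integral>f. iexp (t * ((\<Sum>n<N. f n - m N n) / s N)) \<partial>PiM {..<N} (\<mu> N))"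
        unfolding char_def M_def by (rule integral_distr) auto
      also have "\<dots> = (\<integral>f. (\<Prod>n<N. iexp (t / s N * (f n - m N n))) \<partial>PiM {..<N} (\<mu> N))"
        by (intro Bochner_Integration.integral_cong refl)
           (simp add: exp_sum[symmetric] sum_distrib_left sum_divide_distrib)
      also have "\<dots> = (\<Prod>n<N. \<integral>x. iexp (t / s N * (x - m N n)) \<partial>\<mu> N n)"
      proof (rule PP.product_integral_prod)
        show "complex_integrable (\<mu> N n) (\<lambda>x. iexp (t / s N * (x - m N n)))" for n
        proof (rule P.integrable_iexp)
          show "(\<lambda>x. complex_of_real (t / s N * (x - m N n))) \<in> borel_measurable (\<mu> N n)" by measurable
        qed simp
      qed simp
      also have "\<dots> = (\<Prod>n<N. z N n)"
        unfolding z_def char_def by (intro prod.cong refl) (subst integral_distr; auto)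
      finally show ?thesis .
    qed
    \<comment> \<open>Characteristic function at \<open>t\<close> of a centred Gaussian carrying the
      share \<open>v N n / var N\<close> of unit variance; the product over \<open>n\<close> is that
      of the standard normal.\<close>
    define w where "w N n = exp (- (t\<^sup>2 * v N n / (2 * var N)))" for N n
    have bound: "cmod (char (M N) t - complex_of_real (exp (- (t\<^sup>2) / 2)))
      \<le> (\<bar>t\<bar> ^ 3 / 6 + (t\<^sup>2 / 2) powr (3/2)) * (rho N / var N powr (3/2))" if pos: "var N > 0" for N
    proof -
      have s0: "s N > 0" and s2: "(s N)\<^sup>2 = var N" using pos by (auto simp: s_def)
      have s3: "(s N) ^ 3 = var N powr (3/2)"
      proof -
        have "var N powr (3/2) = (var N powr (1/2)) powr 3" using pos by (simp add: powr_powr)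
        also have "\<dots> = (s N) ^ 3" using s0 pos by (simp add: powr_half_sqrt s_def powr_numeral)
        finally show ?thesis ..
      qed
      have "(\<Prod>n<N. w N n) = exp (\<Sum>n<N. - (t\<^sup>2 * v N n / (2 * var N)))"
        unfolding w_def by (simp add: exp_sum)
      also have "(\<Sum>n<N. - (t\<^sup>2 * v N n / (2 * var N))) = - (t\<^sup>2 / (2 * var N)) * (\<Sum>n<N. v N n)"
        unfolding sum_distrib_left by (intro sum.cong) auto
      also have "(\<Sum>n<N. v N n) = var N" by (simp add: var_def v_def)
      finally have prodw: "(\<Prod>n<N. w N n) = exp (- (t\<^sup>2) / 2)" using pos by simp
      have zw: "cmod (z N n - complex_of_real (w N n))
          \<le> (\<bar>t\<bar> ^ 3 / 6 + (t\<^sup>2 / 2) powr (3/2)) * (k N n / var N powr (3/2))" for n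
      proof -
        define r where "r = t / s N"
        have r2: "r\<^sup>2 = t\<^sup>2 / var N" unfolding r_def power_divide s2 ..
        have mean0: "P.expectation N n (\<lambda>x. x - m N n) = 0"
          using i1 by (simp add: m_def P.prob_space)
        \<comment> \<open>Second-order expansion with vanishing mean; from the minimum in the
          remainder only the third-moment branch is kept.\<close>
        have "cmod (z N n - (1 - r\<^sup>2 * v N n / 2))
          \<le> (r\<^sup>2 / 6) * P.expectation N n (\<lambda>x. min (6 * (x - m N n)\<^sup>2) (\<bar>r\<bar> * \<bar>x - m N n\<bar> ^ 3))"
          unfolding z_def r_def[symmetric]
        proof (rule P.char_approx3'[OF _ _ c2 mean0 _ refl])
          show "P.variance N n (\<lambda>x. x - m N n) = v N n" unfolding mean0 diff_zero v_def ..
          show "integrable (\<mu> N n) (\<lambda>x. x - m N n)" using i1 by (intro Bochner_Integration.integrable_diff) simp_all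
        qed measurable
        also have "\<dots> \<le> (r\<^sup>2 / 6) * P.expectation N n (\<lambda>x. \<bar>r\<bar> * \<bar>x - m N n\<bar> ^ 3)"
          using c2 c3 by (intro mult_left_mono integral_mono) auto
        also have "\<dots> = \<bar>r\<bar> ^ 3 / 6 * k N n"
        proof -
          have "\<bar>r\<bar> ^ 3 = r\<^sup>2 * \<bar>r\<bar>" by (simp add: power3_eq_cube power2_eq_square)
          then show ?thesis by (simp add: k_def)
        qed
        also have "\<bar>r\<bar> ^ 3 = \<bar>t\<bar> ^ 3 / var N powr (3/2)"
          unfolding r_def abs_divide power_divide s3[symmetric] using s0 by simp
        finally have 1: "cmod (z N n - (1 - r\<^sup>2 * v N n / 2)) \<le> \<bar>t\<bar> ^ 3 / 6 * (k N n / var N powr (3/2))"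
          by simp
        define a where "a = t\<^sup>2 * v N n / (2 * var N)"
        have a0: "a \<ge> 0" unfolding a_def using pos v0 by simp
        have "\<bar>w N n - (1 - a)\<bar> \<le> a powr (3/2)"
          using abs_one_minus_exp_le[OF a0] by (simp add: w_def a_def)
        also have "a = t\<^sup>2 / 2 * (v N n / var N)" by (simp add: a_def)
        also have "\<dots> powr (3/2) = (t\<^sup>2 / 2) powr (3/2) * (v N n powr (3/2) / var N powr (3/2))"
          using pos v0 by (simp add: powr_mult powr_divide)
        also have "\<dots> \<le> (t\<^sup>2 / 2) powr (3/2) * (k N n / var N powr (3/2))"
          using vk by (intro mult_left_mono divide_right_mono) auto
        finally have 2: "\<bar>w N n - (1 - t\<^sup>2 / 2 * (v N n / var N))\<bar> \<le> (t\<^sup>2 / 2) powr (3/2) * (k N n / var N powr (3/2))" .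
        have e: "r\<^sup>2 * v N n / 2 = t\<^sup>2 / 2 * (v N n / var N)" unfolding r2 by simp
        have "z N n - complex_of_real (w N n) = (z N n - (1 - r\<^sup>2 * v N n / 2)) - complex_of_real (w N n - (1 - t\<^sup>2 / 2 * (v N n / var N)))"
          unfolding e[symmetric] by simp
        then have "cmod (z N n - complex_of_real (w N n)) \<le> cmod (z N n - (1 - r\<^sup>2 * v N n / 2)) + \<bar>w N n - (1 - t\<^sup>2 / 2 * (v N n / var N))\<bar>"
          by (metis norm_triangle_ineq4 norm_of_real)
        also have "\<dots> \<le> \<bar>t\<bar> ^ 3 / 6 * (k N n / var N powr (3/2)) + (t\<^sup>2 / 2) powr (3/2) * (k N n / var N powr (3/2))"
          using 1 2 by (rule add_mono)
        finally show ?thesis by (simp only: distrib_right)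
      qed
      have "cmod (char (M N) t - complex_of_real (exp (- (t\<^sup>2) / 2)))
         = cmod ((\<Prod>n<N. z N n) - (\<Prod>n<N. complex_of_real (w N n)))"
        unfolding charM prodw[symmetric] of_real_prod ..
      \<comment> \<open>Products of numbers in the unit disc differ by at most the sum of the
        differences of their factors.\<close>
      also have "\<dots> \<le> (\<Sum>n<N. cmod (z N n - complex_of_real (w N n)))"
      proof (rule norm_prod_diff)
        fix n
        interpret R: real_distribution "distr (\<mu> N n) borel (\<lambda>x. x - m N n)"
          by (rule P.real_distribution_distr) measurable
        show "cmod (z N n) \<le> 1" unfolding z_def by (rule R.cmod_char_le_1)
        show "cmod (complex_of_real (w N n)) \<le> 1" using pos v0 by (simp add: w_def)
      qed
      also have "\<dots> \<le> (\<Sum>n<N. (\<bar>t\<bar> ^ 3 / 6 + (t\<^sup>2 / 2) powr (3/2)) * (k N n / var N powr (3/2)))"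
        by (intro sum_mono zw)
      also have "\<dots> = (\<bar>t\<bar> ^ 3 / 6 + (t\<^sup>2 / 2) powr (3/2)) * (rho N / var N powr (3/2))"
        unfolding rho_def k_def[symmetric] sum_distrib_left[symmetric] sum_divide_distrib[symmetric] ..
      finally show ?thesis .
    qed
    have "(\<lambda>N. (\<bar>t\<bar> ^ 3 / 6 + (t\<^sup>2 / 2) powr (3/2)) * (rho N / var N powr (3/2))) \<longlonglongrightarrow> 0"
      using tendsto_mult_right_zero[OF lyap] .
    then have "(\<lambda>N. char (M N) t - complex_of_real (exp (- (t\<^sup>2) / 2))) \<longlonglongrightarrow> 0"
      by (rule Lim_null_comparison[rotated]) (use var_pos bound in \<open>auto elim: eventually_mono\<close>)
    then show ?thesis unfolding char_std_normal_distribution by (rule Lim_null[THEN iffD2])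
  qed
  have "weak_conv_m M std_normal_distribution"
    by (rule levy_continuity[OF rd real_dist_normal_dist conv])
  then have lim: "(\<lambda>N. cdf (M N) y) \<longlonglongrightarrow> Phi y"
    using isCont_Phi[of y] unfolding weak_conv_m_def weak_conv_def Phi_eq_cdf[abs_def] by auto
  have "cdf (M N) y = measure (PiM {..<N} (\<mu> N))
      {f \<in> space (PiM {..<N} (\<mu> N)). (\<Sum>n<N. f n - m N n) \<le> y * sqrt (var N)}" if "0 < var N" for N
  proof -
    have "cdf (M N) y = measure (PiM {..<N} (\<mu> N))
       ((\<lambda>f. (\<Sum>n<N. f n - m N n) / s N) -` {..y} \<inter> space (PiM {..<N} (\<mu> N)))"
      unfolding cdf_def M_def by (rule measure_distr) auto
    also have "(\<lambda>f. (\<Sum>n<N. f n - m N n) / s N) -` {..y} \<inter> space (PiM {..<N} (\<mu> N))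
      = {f \<in> space (PiM {..<N} (\<mu> N)). (\<Sum>n<N. f n - m N n) \<le> y * sqrt (var N)}"
      using that by (auto simp: s_def pos_divide_le_eq)
    finally show ?thesis .
  qed
  then show ?thesis
    by (intro Lim_transform_eventually[OF lim] eventually_mono[OF var_pos]) auto
qed

section \<open>Product systems and log-likelihood ratios\<close>

text \<open>Induction runs downwards from \<open>a = N\<close>, since \<open>kron_list\<close> peels
  off the head. The map \<open>\<phi>\<close> decodes a flat index into the configuration of levels
  of the subsystems.\<close>

lemma product_system_spec:
  fixes d :: "nat \<Rightarrow> nat" and p e :: "nat \<Rightarrow> nat \<Rightarrow> real"
  assumes sub: "\<forall>n<N. d n > 0 \<and> unitary_basis (d n) (U n)
      \<and> \<rho> n = spec (d n) (U n) (p n) \<and> H n = spec (d n) (U n) (e n)" and "a \<le> N"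
  shows "\<exists>D K \<phi>. D > 0 \<and> unitary_basis D K \<and> bij_betw \<phi> {..<D} (PiE {a..<N} (\<lambda>n. {..<d n})) \<and>
    dim_row (kron_list (map H [a..<N])) = D \<and>
    kron_list (map \<rho> [a..<N]) = spec D K (\<lambda>i. \<Prod>n\<in>{a..<N}. p n (\<phi> i n)) \<and>
    ham_sum (map H [a..<N]) = spec D K (\<lambda>i. \<Sum>n\<in>{a..<N}. e n (\<phi> i n))"
  using \<open>a \<le> N\<close>
proof (induction a rule: inc_induct)
  case base
  have one: "spec 1 (1\<^sub>m 1) (\<lambda>_. 1) = 1\<^sub>m 1" "spec 1 (1\<^sub>m 1) (\<lambda>_. 0) = 0\<^sub>m 1 1"
    by (rule eq_matI; auto simp: spec_def scalar_prod_def)+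
  \<comment> \<open>The empty product has dimension 1, and its only configuration is the everywhere
    undefined function.\<close>
  show ?case
    by (rule exI[of _ 1], rule exI[of _ "1\<^sub>m 1"], rule exI[of _ "\<lambda>_ _. undefined"])
       (auto simp: unitary_basis_one one[simplified] bij_betw_def inj_on_def)
next
  case (step a)
  then obtain D K \<phi> where D: "D > 0" and K: "unitary_basis D K"
    and \<phi>: "bij_betw \<phi> {..<D} (PiE {Suc a..<N} (\<lambda>n. {..<d n}))"
    and dr: "dim_row (kron_list (map H [Suc a..<N])) = D"
    and \<rho>: "kron_list (map \<rho> [Suc a..<N]) = spec D K (\<lambda>i. \<Prod>n\<in>{Suc a..<N}. p n (\<phi> i n))"
    and h: "ham_sum (map H [Suc a..<N]) = spec D K (\<lambda>i. \<Sum>n\<in>{Suc a..<N}. e n (\<phi> i n))"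
    by blast
  have da: "d a > 0" and Ua: "unitary_basis (d a) (U a)" and \<rho>a: "\<rho> a = spec (d a) (U a) (p a)"
    and Ha: "H a = spec (d a) (U a) (e a)" using sub step by auto
  interpret A: unitary_basis "d a" "U a" by fact
  have up: "[a..<N] = a # [Suc a..<N]" using step by (simp add: upt_conv_Cons)
  have ins: "{a..<N} = insert a {Suc a..<N}" using step by auto
  \<comment> \<open>The leading digit \<open>i div D\<close> is the level of the new head subsystem,
    the rest decodes the tail.\<close>
  define \<psi> where "\<psi> i = (\<phi> (i mod D))(a := i div D)" for i
  let ?E = "PiE {Suc a..<N} (\<lambda>n. {..<d n})"
  have \<phi>E: "\<phi> i \<in> ?E" if "i < D" for i using \<phi> that by (auto simp: bij_betw_def)
  have bij: "bij_betw \<psi> {..<d a * D} (PiE {a..<N} (\<lambda>n. {..<d n}))"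
  proof (rule bij_betw_imageI)
    show "inj_on \<psi> {..<d a * D}"
    proof (rule inj_onI)
      fix i j assume ij: "i \<in> {..<d a * D}" "j \<in> {..<d a * D}" "\<psi> i = \<psi> j"
      have "i div D = j div D" using fun_cong[OF ij(3), of a] by (simp add: \<psi>_def)
      moreover have "\<phi> (i mod D) = \<phi> (j mod D)"
      proof
        fix n
        have "\<phi> (i mod D) a = undefined" "\<phi> (j mod D) a = undefined"
          using \<phi>E[of "i mod D"] \<phi>E[of "j mod D"] D by (auto simp: PiE_def extensional_def)
        then show "\<phi> (i mod D) n = \<phi> (j mod D) n"
          using fun_cong[OF ij(3), of n] by (cases "n = a") (auto simp: \<psi>_def)
      qed
      then have "i mod D = j mod D" using \<phi> D by (auto simp: bij_betw_def dest: inj_onD)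
      ultimately show "i = j" by (metis div_mult_mod_eq)
    qed
    show "\<psi> ` {..<d a * D} = PiE {a..<N} (\<lambda>n. {..<d n})"
    proof (intro equalityI subsetI)
      fix f assume "f \<in> \<psi> ` {..<d a * D}"
      then obtain i where i: "i < d a * D" "f = \<psi> i" by auto
      show "f \<in> PiE {a..<N} (\<lambda>n. {..<d n})"
        unfolding i(2) \<psi>_def ins using div_mod_less[OF i(1)] \<phi>E[of "i mod D"] by (intro PiE_fun_upd) auto
    next
      fix f assume f: "f \<in> PiE {a..<N} (\<lambda>n. {..<d n})"
      have "f(a := undefined) \<in> ?E" using f by (auto simp: PiE_def extensional_def Pi_def)
      then obtain j where j: "j < D" "\<phi> j = f(a := undefined)" using bij_betw_imp_surj_on[OF \<phi>] by (metis imageE lessThan_iff)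
      have "f a < d a" using f step by auto
      then have "f a * D + j < d a * D" using j by (intro pair_index_less)
      moreover have "\<psi> (f a * D + j) = f" using j by (auto simp: \<psi>_def)
      ultimately show "f \<in> \<psi> ` {..<d a * D}" by (metis imageI lessThan_iff)
    qed
  qed
  have \<psi>a: "\<psi> i a = i div D" and \<psi>n: "n \<noteq> a \<Longrightarrow> \<psi> i n = \<phi> (i mod D) n" for i n by (auto simp: \<psi>_def)
  have tails: "(\<Prod>n\<in>{Suc a..<N}. p n (\<psi> i n)) = (\<Prod>n\<in>{Suc a..<N}. p n (\<phi> (i mod D) n))"
    "(\<Sum>n\<in>{Suc a..<N}. e n (\<psi> i n)) = (\<Sum>n\<in>{Suc a..<N}. e n (\<phi> (i mod D) n))" for i
    by (auto simp: \<psi>n intro: prod.cong sum.cong)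
  have "kron_list (map \<rho> [a..<N]) = spec (d a * D) (kron (U a) K) (\<lambda>i. \<Prod>n\<in>{a..<N}. p n (\<psi> i n))"
    unfolding up ins by (simp add: \<rho> \<rho>a kron_spec[OF Ua K] \<psi>a tails)
  moreover have "ham_sum (map H [a..<N]) = spec (d a * D) (kron (U a) K) (\<lambda>i. \<Sum>n\<in>{a..<N}. e n (\<psi> i n))"
    unfolding up ins by (simp add: dr h Ha kron_spec_add[OF Ua K] \<psi>a tails)
  moreover have "dim_row (kron_list (map H [a..<N])) = d a * D" unfolding up by (simp add: dr Ha)
  ultimately show ?case
    using bij unitary_basis_kron[OF Ua K] da D by (intro exI[of _ "d a * D"] exI[of _ "kron (U a) K"] exI[of _ \<psi>]) auto
qed

text \<open>A degenerate Hamiltonian has eigenbases that miss \<open>v\<close>. Diagonalising it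
  jointly with \<open>proj v\<close>, which commutes with it, gives one that contains
  \<open>v\<close> up to a phase.\<close>

lemma target_diagonalisation:
  assumes H: "H \<in> carrier_mat n n" "hermitian H" and ev: "eigenvector H v c"
    and norm: "(\<Sum>i<n. (cmod (v $ i))\<^sup>2) = 1"
  obtains W E k where "unitary_basis n W" "H = spec n W E" "k < n"
    "proj v = spec n W (\<lambda>i. if i = k then 1 else 0)" "dim_vec v = n"
proof -
  have v: "v \<in> carrier_vec n" and eq: "H *\<^sub>v v = c \<cdot>\<^sub>v v" using ev H by (auto simp: eigenvector_def)
  then have dv: "dim_vec v = n" by auto
  have P: "proj v \<in> carrier_mat n n" using dv by (auto simp: proj_def)
  have Hv: "(\<Sum>j<n. H $$ (i,j) * v $ j) = c * v $ i" if "i < n" for i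
  proof -
    have "(H *\<^sub>v v) $ i = (\<Sum>j<n. H $$ (i,j) * v $ j)" using H(1) v that by (auto simp: scalar_prod_def atLeast0LessThan)
    then show ?thesis unfolding eq using v that by simp
  qed
  have hH: "cnj (H $$ (i,j)) = H $$ (j,i)" if "i < n" "j < n" for i j
    using H that by (metis adj_index carrier_matD hermitian_def)
  have vv: "(\<Sum>i<n. cnj (v $ i) * v $ i) = 1"
  proof -
    have "(\<Sum>i<n. cnj (v $ i) * v $ i) = complex_of_real (\<Sum>i<n. (cmod (v $ i))\<^sup>2)"
      unfolding of_real_sum complex_norm_square by (simp add: mult.commute)
    then show ?thesis unfolding norm by simp
  qed
  have c1: "c = (\<Sum>i<n. \<Sum>j<n. cnj (v $ i) * H $$ (i,j) * v $ j)"
  proof -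
    have "(\<Sum>i<n. \<Sum>j<n. cnj (v $ i) * H $$ (i,j) * v $ j) = (\<Sum>i<n. cnj (v $ i) * (c * v $ i))"
      by (intro sum.cong refl) (simp add: Hv[symmetric] sum_distrib_left mult.assoc)
    also have "\<dots> = c * (\<Sum>i<n. cnj (v $ i) * v $ i)" by (simp add: sum_distrib_left mult_ac)
    finally show ?thesis using vv by simp
  qed
  \<comment> \<open>The eigenvalue is the value of a Hermitian form, hence real; without this the
    two products below would differ by conjugation of \<open>c\<close>.\<close>
  have cc: "cnj c = c"
  proof -
    have "cnj c = (\<Sum>i<n. \<Sum>j<n. v $ i * H $$ (j,i) * cnj (v $ j))"
      by (subst c1) (simp add: hH)
    also have "\<dots> = (\<Sum>j<n. \<Sum>i<n. v $ i * H $$ (j,i) * cnj (v $ j))" by (rule sum.swap)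
    also have "\<dots> = (\<Sum>j<n. \<Sum>i<n. cnj (v $ j) * H $$ (j,i) * v $ i)" by (simp add: mult_ac)
    also have "\<dots> = c" by (rule c1[symmetric])
    finally show ?thesis .
  qed
  have "H * proj v = proj v * H"
  proof (rule eq_matI)
    fix i j assume "i < dim_row (proj v * H)" "j < dim_col (proj v * H)"
    then have ij: "i < n" "j < n" using P H by auto
    have "(H * proj v) $$ (i,j) = (\<Sum>k<n. H $$ (i,k) * v $ k) * cnj (v $ j)"
      using ij dv by (subst index_mult_sum[OF H(1) P ij]) (simp add: proj_def sum_distrib_right mult.assoc)
    also have "\<dots> = v $ i * cnj (\<Sum>k<n. H $$ (j,k) * v $ k)" unfolding Hv[OF ij(1)] Hv[OF ij(2)] by (simp add: cc)
    also have "\<dots> = (proj v * H) $$ (i,j)"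
      using ij dv by (subst index_mult_sum[OF P H(1) ij]) (simp add: proj_def sum_distrib_left hH mult_ac)
    finally show "(H * proj v) $$ (i,j) = (proj v * H) $$ (i,j)" .
  qed (use P H in auto)
  then obtain W E q where W: "unitary_basis n W" and HE: "H = spec n W E" and pq: "proj v = spec n W q"
    using simultaneous_diagonalisation[OF H P proj_hermitian] by metis
  interpret unitary_basis n W by fact
  have q01: "q i = 0 \<or> q i = 1" if "i < n" for i
    using proj_spectrum(1)[OF pq dv that] norm by simp
  have qs: "(\<Sum>i<n. q i) = 1" using proj_spectrum(2)[OF pq dv] norm by simp
  then obtain k where k: "k < n" "q k \<noteq> 0" by (metis lessThan_iff sum.neutral zero_neq_one)
  then have qk: "q k = 1" using q01 by auto
  have "(\<Sum>i\<in>{..<n} - {k}. q i) = 0" using qs qk k by (simp add: sum.remove[of _ k])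
  then have "\<forall>i\<in>{..<n} - {k}. q i = 0" using q01 by (subst (asm) sum_nonneg_eq_0_iff) force+
  then have "spec n W q = spec n W (\<lambda>i. if i = k then 1 else 0)"
    using qk by (intro spec_cong) auto
  then show ?thesis using that[OF W HE k(1) _ dv] pq by simp
qed

section \<open>Finite distributions and independent sums\<close>

definition fin_pmf :: "nat \<Rightarrow> (nat \<Rightarrow> real) \<Rightarrow> nat pmf" where
  "fin_pmf d p = embed_pmf (\<lambda>i. if i < d then p i else 0)"

lemma pmf_fin_pmf:
  assumes "\<And>i. i < d \<Longrightarrow> p i \<ge> 0" "(\<Sum>i<d. p i) = 1"
  shows "pmf (fin_pmf d p) i = (if i < d then p i else 0)"
  unfolding fin_pmf_def
proof (rule pmf_embed_pmf)
  have "(\<integral>\<^sup>+i. ennreal (if i < d then p i else 0) \<partial>count_space UNIV)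
    = (\<Sum>i<d. ennreal (if i < d then p i else 0))"
    by (rule nn_integral_count_space') auto
  also have "\<dots> = ennreal (\<Sum>i<d. if i < d then p i else 0)" using assms by (intro sum_ennreal) auto
  also have "(\<Sum>i<d. if i < d then p i else 0) = 1" using assms by simp
  finally show "(\<integral>\<^sup>+i. ennreal (if i < d then p i else 0) \<partial>count_space UNIV) = 1" by simp
qed (use assms in auto)

lemma integral_fin_pmf:
  fixes f :: "nat \<Rightarrow> real"
  assumes "\<And>i. i < d \<Longrightarrow> p i \<ge> 0" "(\<Sum>i<d. p i) = 1"
  shows "(\<integral>i. f i \<partial>measure_pmf (fin_pmf d p)) = (\<Sum>i<d. p i * f i)"
    and "integrable (measure_pmf (fin_pmf d p)) f"
proof -
  have sub: "set_pmf (fin_pmf d p) \<subseteq> {..<d}" using assms by (auto simp: set_pmf_eq pmf_fin_pmf)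
  have "(\<integral>i. f i \<partial>measure_pmf (fin_pmf d p)) = (\<Sum>i<d. f i * pmf (fin_pmf d p) i)"
    by (rule integral_measure_pmf_real) (use sub in auto)
  then show "(\<integral>i. f i \<partial>measure_pmf (fin_pmf d p)) = (\<Sum>i<d. p i * f i)"
    using assms by (simp add: pmf_fin_pmf mult.commute)
  show "integrable (measure_pmf (fin_pmf d p)) f"
    by (rule integrable_measure_pmf_finite) (use sub finite_subset in auto)
qed

lemma measure_fin_pmf:
  assumes "\<And>i. i < d \<Longrightarrow> p i \<ge> 0" "(\<Sum>i<d. p i) = 1"
  shows "measure (measure_pmf (fin_pmf d p)) S = (\<Sum>i<d. p i * of_bool (i \<in> S))"
proof -
  have "measure (measure_pmf (fin_pmf d p)) S = (\<integral>i. of_bool (i \<in> S) \<partial>measure_pmf (fin_pmf d p))"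
    by (subst Bochner_Integration.integral_cong[OF refl, of _ _ "indicator S"]) (auto simp: indicator_def)
  also have "\<dots> = (\<Sum>i<d. p i * of_bool (i \<in> S))" by (rule integral_fin_pmf(1)) (use assms in auto)
  finally show ?thesis .
qed

lemma sum_prod_reindex:
  fixes g :: "nat \<Rightarrow> nat \<Rightarrow> real"
  assumes \<phi>: "bij_betw \<phi> {..<D} (PiE {..<N} (\<lambda>n. {..<d n}))"
  shows "(\<Sum>i<(D::nat). \<Prod>n<N. g n (\<phi> i n)) = (\<Prod>n<N. \<Sum>j<d n. g n j)"
proof -
  have "(\<Prod>n<N. \<Sum>j<d n. g n j) = (\<Sum>f\<in>PiE {..<N} (\<lambda>n. {..<d n}). \<Prod>n<N. g n (f n))"
    by (rule prod_sum_PiE) auto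
  also have "\<dots> = (\<Sum>i<D. \<Prod>n<N. g n (\<phi> i n))"
    by (rule sum.reindex_bij_betw[OF \<phi>, symmetric])
  finally show ?thesis ..
qed

text \<open>The product of the laws is the image of one finite distribution on flat indices, because
  both agree on boxes by the distributive law. Probabilities of the independent sum thus become sums
  over the spectrum of the product state.\<close>

lemma PiM_fin_pmf:
  fixes X :: "nat \<Rightarrow> nat \<Rightarrow> real" and c :: "nat \<Rightarrow> real" and D :: nat and d :: "nat \<Rightarrow> nat"
  assumes p: "\<And>n i. n < N \<Longrightarrow> i < d n \<Longrightarrow> p n i \<ge> 0" "\<And>n. n < N \<Longrightarrow> (\<Sum>i<d n. p n i) = 1"
    and \<phi>: "bij_betw \<phi> {..<D} (PiE {..<N} (\<lambda>n. {..<d n}))"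
  defines "\<mu> \<equiv> \<lambda>n. distr (measure_pmf (fin_pmf (d n) (p n))) borel (X n)"
  defines "P \<equiv> \<lambda>i. \<Prod>n<N. p n (\<phi> i n)"
  shows "measure (PiM {..<N} \<mu>) {f \<in> space (PiM {..<N} \<mu>). (\<Sum>n<N. f n - c n) \<le> y}
      = (\<Sum>i<D. P i * of_bool ((\<Sum>n<N. X n (\<phi> i n) - c n) \<le> y))"
    and "\<And>i. i < D \<Longrightarrow> P i \<ge> 0" and "(\<Sum>i<D. P i) = 1"
proof -
  have \<phi>d: "\<phi> i n < d n" if "i < D" "n < N" for i n
    using \<phi> that by (auto simp: bij_betw_def)
  show P0: "P i \<ge> 0" if "i < D" for i
    unfolding P_def using p(1) \<phi>d[OF that] by (intro prod_nonneg) auto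
  note prodsum = sum_prod_reindex[OF \<phi>]
  show P1: "(\<Sum>i<D. P i) = 1" unfolding P_def prodsum using p(2) by simp
  have ps: "prob_space (\<mu> n)" for n unfolding \<mu>_def by (rule prob_space.prob_space_distr) (auto simp: measure_pmf.prob_space_axioms)
  interpret M: product_prob_space \<mu>
    by (rule product_prob_spaceI) (rule ps)
  define Q where "Q = distr (measure_pmf (fin_pmf D P)) (PiM {..<N} (\<lambda>_. borel :: real measure)) (\<lambda>i. \<lambda>n\<in>{..<N}. X n (\<phi> i n))"
  have meas: "(\<lambda>i. \<lambda>n\<in>{..<N}. X n (\<phi> i n)) \<in> measurable (measure_pmf (fin_pmf D P)) (PiM {..<N} (\<lambda>_. borel :: real measure))"
    by (rule measurable_restrict) auto
  have sPi: "sets (PiM {..<N} (\<lambda>_. borel :: real measure)) = sets (PiM {..<N} \<mu>)"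
    by (rule sets_PiM_cong) (auto simp: \<mu>_def)
  have "Q = PiM {..<N} \<mu>"
  proof (rule M.PiM_eqI)
    show "sets Q = sets (PiM {..<N} \<mu>)" unfolding Q_def using sPi by simp
    fix A :: "nat \<Rightarrow> real set" assume A: "\<And>n. n \<in> {..<N} \<Longrightarrow> A n \<in> sets (\<mu> n)"
    have AP: "PiE {..<N} A \<in> sets (PiM {..<N} (\<lambda>_. borel :: real measure))"
      using A by (intro sets_PiM_I_finite) (auto simp: \<mu>_def)
    have "emeasure Q (PiE {..<N} A) = emeasure (measure_pmf (fin_pmf D P)) ((\<lambda>i. \<lambda>n\<in>{..<N}. X n (\<phi> i n)) -` PiE {..<N} A)"
      unfolding Q_def by (subst emeasure_distr[OF meas AP]) simp
    also have "\<dots> = ennreal (\<Sum>i<D. P i * of_bool (i \<in> (\<lambda>i. \<lambda>n\<in>{..<N}. X n (\<phi> i n)) -` PiE {..<N} A))"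
      unfolding measure_pmf.emeasure_eq_measure by (subst measure_fin_pmf) (use P0 P1 in auto)
    also have "(\<Sum>i<D. P i * of_bool (i \<in> (\<lambda>i. \<lambda>n\<in>{..<N}. X n (\<phi> i n)) -` PiE {..<N} A))
        = (\<Sum>i<D. \<Prod>n<N. p n (\<phi> i n) * of_bool (X n (\<phi> i n) \<in> A n))"
    proof (intro sum.cong refl)
      fix i
      have "i \<in> (\<lambda>i. \<lambda>n\<in>{..<N}. X n (\<phi> i n)) -` PiE {..<N} A \<longleftrightarrow> (\<forall>n<N. X n (\<phi> i n) \<in> A n)"
        by (auto simp: PiE_iff)
      moreover have "(of_bool (\<forall>n<N. X n (\<phi> i n) \<in> A n) :: real) = (\<Prod>n<N. of_bool (X n (\<phi> i n) \<in> A n))"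
        by auto
      ultimately show "P i * of_bool (i \<in> (\<lambda>i. \<lambda>n\<in>{..<N}. X n (\<phi> i n)) -` PiE {..<N} A)
        = (\<Prod>n<N. p n (\<phi> i n) * of_bool (X n (\<phi> i n) \<in> A n))"
        by (simp only: P_def prod.distrib)
    qed
    also have "\<dots> = (\<Prod>n<N. \<Sum>j<d n. p n j * of_bool (X n j \<in> A n))" by (rule prodsum)
    also have "ennreal \<dots> = (\<Prod>n<N. ennreal (\<Sum>j<d n. p n j * of_bool (X n j \<in> A n)))"
      using p(1) by (intro prod_ennreal[symmetric] sum_nonneg) auto
    also have "\<dots> = (\<Prod>n<N. emeasure (\<mu> n) (A n))"
    proof (intro prod.cong refl)
      fix n assume n: "n \<in> {..<N}"
      have An: "A n \<in> sets borel" using A[OF n] by (simp add: \<mu>_def)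
      have "emeasure (\<mu> n) (A n) = emeasure (measure_pmf (fin_pmf (d n) (p n))) (X n -` A n)"
        unfolding \<mu>_def by (subst emeasure_distr[OF _ An]) auto
      also have "\<dots> = ennreal (\<Sum>j<d n. p n j * of_bool (j \<in> X n -` A n))"
        unfolding measure_pmf.emeasure_eq_measure using n p by (subst measure_fin_pmf) auto
      finally show "ennreal (\<Sum>j<d n. p n j * of_bool (X n j \<in> A n)) = emeasure (\<mu> n) (A n)" by simp
    qed
    finally show "emeasure Q (PiE {..<N} A) = (\<Prod>n<N. emeasure (\<mu> n) (A n))" .
  qed simp
  have S: "{f \<in> space (PiM {..<N} (\<lambda>_. borel :: real measure)). (\<Sum>n<N. f n - c n) \<le> y} \<in> sets (PiM {..<N} (\<lambda>_. borel :: real measure))"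
    by measurable
  have "measure (PiM {..<N} \<mu>) {f \<in> space (PiM {..<N} \<mu>). (\<Sum>n<N. f n - c n) \<le> y}
    = measure Q {f \<in> space (PiM {..<N} (\<lambda>_. borel :: real measure)). (\<Sum>n<N. f n - c n) \<le> y}"
    using \<open>Q = PiM {..<N} \<mu>\<close> sets_eq_imp_space_eq[OF sPi] by simp
  also have "\<dots> = measure (measure_pmf (fin_pmf D P)) {i. (\<Sum>n<N. X n (\<phi> i n) - c n) \<le> y}"
    unfolding Q_def by (subst measure_distr[OF meas S]) (auto simp: space_PiM intro!: arg_cong[where f = "measure _"])
  also have "\<dots> = (\<Sum>i<D. P i * of_bool ((\<Sum>n<N. X n (\<phi> i n) - c n) \<le> y))"
    by (subst measure_fin_pmf) (use P0 P1 in auto)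
  finally show "measure (PiM {..<N} \<mu>) {f \<in> space (PiM {..<N} \<mu>). (\<Sum>n<N. f n - c n) \<le> y}
      = (\<Sum>i<D. P i * of_bool ((\<Sum>n<N. X n (\<phi> i n) - c n) \<le> y))" .
qed

lemma density_op_spec:
  assumes "density_op n \<rho>" "unitary_basis n U" "\<rho> = spec n U p"
  shows "i < n \<Longrightarrow> p i \<ge> 0" "(\<Sum>i<n. p i) = 1"
proof -
  interpret unitary_basis n U by fact
  show "p i \<ge> 0" if i: "i < n"
  proof -
    define w where "w = Matrix.vec n (\<lambda>j. U $$ (j,i))"
    have "0 \<le> Re (\<Sum>j<n. \<Sum>l<n. cnj (w $ j) * \<rho> $$ (j,l) * w $ l)"
    proof -
      have "w \<in> carrier_vec n" by (simp add: w_def)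
      then show ?thesis using assms(1) unfolding density_op_def by blast
    qed
    also have "(\<Sum>j<n. \<Sum>l<n. cnj (w $ j) * \<rho> $$ (j,l) * w $ l)
      = (\<Sum>j<n. \<Sum>l<n. cnj (U $$ (j,i)) * spec n U p $$ (j,l) * U $$ (l,i))"
      unfolding assms(3) by (intro sum.cong refl) (simp add: w_def)
    finally show ?thesis unfolding quadratic_form_col[OF i] by simp
  qed
  have "complex_of_real (\<Sum>i<n. p i) = 1"
    using assms(1) unfolding density_op_def assms(3) mtrace_spec by blast
  then show "(\<Sum>i<n. p i) = 1" unfolding of_real_eq_1_iff .
qed

text \<open>If the log-likelihood ratio took a single value on the support of the product state, then
  so would each summand, and every variance would vanish.\<close>
lemma product_not_constant:
  fixes X p :: "nat \<Rightarrow> nat \<Rightarrow> real"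
  assumes p: "\<And>n i. n < N \<Longrightarrow> i < d n \<Longrightarrow> p n i \<ge> 0" "\<And>n. n < N \<Longrightarrow> (\<Sum>i<d n. p n i) = 1"
    and \<phi>: "bij_betw \<phi> {..<D} (PiE {..<N} (\<lambda>n. {..<d n}))"
    and const: "\<And>i. i < (D::nat) \<Longrightarrow> (\<Prod>n<N. p n (\<phi> i n)) > 0 \<Longrightarrow> (\<Sum>n<N. X n (\<phi> i n)) = c"
    and n0: "n0 < N"
  shows "(\<Sum>i<d n0. p n0 i * (X n0 i - (\<Sum>i<d n0. p n0 i * X n0 i))\<^sup>2) = 0"
proof -
  have "\<exists>j<d n. p n j > 0" if "n < N" for n
  proof (rule ccontr)
    assume "\<not> (\<exists>j<d n. p n j > 0)"
    then have "(\<Sum>i<d n. p n i) \<le> 0" by (intro sum_nonpos) (meson lessThan_iff not_less)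
    then show False using p(2)[OF that] by simp
  qed
  then obtain s where s: "\<And>n. n < N \<Longrightarrow> s n < d n \<and> p n (s n) > 0" by metis
  have eq: "X n0 j = X n0 (s n0)" if j: "j < d n0" "p n0 j > 0" for j
  proof -
    \<comment> \<open>Configurations of positive weight that differ from \<open>s\<close> only at
      \<open>n0\<close>; comparing their sums isolates \<open>X n0\<close>.\<close>
    define f where "f j = (\<lambda>n. if n < N then (s(n0 := j)) n else undefined)" for j
    have key: "(\<Sum>n<N. X n (f j n)) = c" if "j < d n0" "p n0 j > 0" for j
    proof -
      have "f j \<in> PiE {..<N} (\<lambda>n. {..<d n})" using s that by (auto simp: f_def PiE_iff extensional_def)
      then obtain i where i: "i < D" "\<phi> i = f j"
        using bij_betw_imp_surj_on[OF \<phi>] by (metis imageE lessThan_iff)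
      have "(\<Prod>n<N. p n (f j n)) > 0" using s that by (intro prod_pos) (auto simp: f_def)
      then show ?thesis using const[OF i(1)] i(2) by simp
    qed
    have split: "(\<Sum>n<N. X n (f j n)) = X n0 j + (\<Sum>n\<in>{..<N} - {n0}. X n (s n))" for j
    proof -
      have "(\<Sum>n<N. X n (f j n)) = X n0 (f j n0) + (\<Sum>n\<in>{..<N} - {n0}. X n (f j n))"
        using n0 by (intro sum.remove) auto
      moreover have "(\<Sum>n\<in>{..<N} - {n0}. X n (f j n)) = (\<Sum>n\<in>{..<N} - {n0}. X n (s n))"
        by (intro sum.cong) (auto simp: f_def)
      ultimately show ?thesis using n0 by (simp add: f_def)
    qed
    show ?thesis using key[OF j] key[of "s n0"] s[OF n0] split[of j] split[of "s n0"] by simp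
  qed
  have pX: "p n0 i * X n0 i = p n0 i * X n0 (s n0)" if "i < d n0" for i
    using eq[OF that] p(1)[OF n0 that] by (cases "p n0 i = 0") auto
  have mean: "(\<Sum>i<d n0. p n0 i * X n0 i) = X n0 (s n0)"
  proof -
    have "(\<Sum>i<d n0. p n0 i * X n0 i) = (\<Sum>i<d n0. p n0 i * X n0 (s n0))" by (intro sum.cong) (auto simp: pX)
    then show ?thesis unfolding sum_distrib_right[symmetric] p(2)[OF n0] by simp
  qed
  show ?thesis unfolding mean
  proof (intro sum.neutral ballI)
    fix i assume "i \<in> {..<d n0}"
    then show "p n0 i * (X n0 i - X n0 (s n0))\<^sup>2 = 0"
      using eq[of i] p(1)[OF n0, of i] by (cases "p n0 i = 0") auto
  qed
qed

text \<open>\<open>\<mu> n\<close> is the law of the log-likelihood ratio between \<open>\<rho> n\<close> and its Gibbs state under \<open>\<rho> n\<close>.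
  Strict inequality \<open>y < \<dots>\<close> in the achievability part absorbs the error of finite baths.\<close>
lemma single_shot_error:
  fixes d :: "nat \<Rightarrow> nat" and H \<rho> :: "nat \<Rightarrow> complex mat" and \<beta> :: real
  assumes sub: "\<And>n. n < N \<Longrightarrow> 0 < d n \<and> H n \<in> carrier_mat (d n) (d n) \<and> hermitian (H n)"
    and states: "\<And>n. n < N \<Longrightarrow> density_op (d n) (\<rho> n)"
    and incoherent: "\<And>n. n < N \<Longrightarrow> \<rho> n * H n = H n * \<rho> n"
    and target: "Ht \<in> carrier_mat dt dt" "hermitian Ht" "eigenvector Ht v c" "(\<Sum>i<dt. (cmod (v $ i))\<^sup>2) = 1"
  defines "m \<equiv> \<lambda>n. relD (\<rho> n) (gibbs \<beta> (H n))"
  defines "T \<equiv> relD (proj v) (gibbs \<beta> Ht) - (\<Sum>n<N. m n)"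
  defines "R \<equiv> kron_list (map \<rho> [0..<N])"
  defines "ops \<equiv> thermal_ops \<beta> (ham_sum (map H [0..<N])) Ht"
  shows "\<exists>\<mu> :: nat \<Rightarrow> real measure.
    (\<forall>n. prob_space (\<mu> n) \<and> sets (\<mu> n) = sets borel \<and> integrable (\<mu> n) (\<lambda>x. \<bar>x\<bar> ^ 3)) \<and>
    (\<forall>n<N. (\<integral>x. x \<partial>\<mu> n) = m n \<and> (\<integral>x. (x - m n)\<^sup>2 \<partial>\<mu> n) = relV (\<rho> n) (gibbs \<beta> (H n)) \<and>
      (\<integral>x. \<bar>x - m n\<bar> ^ 3 \<partial>\<mu> n) = relY (\<rho> n) (gibbs \<beta> (H n))) \<and>
    (let F = \<lambda>y. measure (PiM {..<N} \<mu>) {f \<in> space (PiM {..<N} \<mu>). (\<Sum>n<N. f n - m n) \<le> y} in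
      ((\<Sum>n<N. relV (\<rho> n) (gibbs \<beta> (H n))) > 0 \<longrightarrow>
        (\<exists>y<T. \<forall>\<epsilon>>0. \<exists>Ch\<in>ops. infid (Ch R) (proj v) \<le> F y + \<epsilon>)) \<and>
      (\<forall>Ch\<in>ops. infid (Ch R) (proj v) \<ge> 0 \<and> (\<forall>s. infid (Ch R) (proj v) \<ge> F (T - s) - exp (- s))))"
proof -
  have "\<exists>U p e. unitary_basis (d n) U \<and> \<rho> n = spec (d n) U p \<and> H n = spec (d n) U e" if "n < N" for n
  proof -
    have "\<rho> n \<in> carrier_mat (d n) (d n)" "hermitian (\<rho> n)" using states[OF that] by (auto simp: density_op_def)
    then show ?thesis using simultaneous_diagonalisation[of "\<rho> n" "d n" "H n"] sub[OF that] incoherent[OF that] by metis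
  qed
  then obtain U p e where diag: "\<And>n. n < N \<Longrightarrow> unitary_basis (d n) (U n) \<and> \<rho> n = spec (d n) (U n) (p n) \<and> H n = spec (d n) (U n) (e n)"
    by metis
  have p0: "p n i \<ge> 0" if "n < N" "i < d n" for n i
    using density_op_spec(1)[OF states] diag that by blast
  have p1: "(\<Sum>i<d n. p n i) = 1" if "n < N" for n
    using density_op_spec(2)[OF states] diag that by blast
  define g where "g n = gibbs_weight \<beta> (d n) (e n)" for n
  have gpos: "g n i > 0" if "n < N" for n i using gibbs_weight_pos sub[OF that] by (simp add: g_def)
  have gb: "gibbs \<beta> (H n) = spec (d n) (U n) (g n)" if "n < N" for n
    using unitary_basis.gibbs_spec'[of "d n" "U n"] diag[OF that] sub[OF that] by (simp add: g_def)
  define X where "X n i = ln (p n i) - ln (g n i)" for n i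
  have mD: "m n = (\<Sum>i<d n. p n i * X n i)" if "n < N" for n
    using unitary_basis.relD_spec[of "d n" "U n"] diag[OF that] gb[OF that] by (simp add: m_def X_def)
  have V: "relV (\<rho> n) (gibbs \<beta> (H n)) = (\<Sum>i<d n. p n i * (X n i - m n)\<^sup>2)" if "n < N" for n
    using unitary_basis.relV_spec[of "d n" "U n"] diag[OF that] gb[OF that] by (simp add: m_def X_def)
  have Y: "relY (\<rho> n) (gibbs \<beta> (H n)) = (\<Sum>i<d n. p n i * \<bar>X n i - m n\<bar> ^ 3)" if "n < N" for n
    using unitary_basis.relY_spec[of "d n" "U n"] diag[OF that] gb[OF that] by (simp add: m_def X_def)
  \<comment> \<open>Indices beyond \<open>N\<close> are padded with a point mass, so that the
    conditions on \<open>\<mu> n\<close> hold for all \<open>n\<close>.\<close>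
  define d' where "d' n = (if n < N then d n else 1)" for n
  define p' where "p' n = (if n < N then p n else (\<lambda>_. 1))" for n
  define \<mu> where "\<mu> n = distr (measure_pmf (fin_pmf (d' n) (p' n))) borel (X n)" for n
  have p'0: "p' n i \<ge> 0" if "i < d' n" for n i using p0 that by (auto simp: p'_def d'_def split: if_splits)
  have p'1: "(\<Sum>i<d' n. p' n i) = 1" for n using p1 by (auto simp: p'_def d'_def)
  have ps: "prob_space (\<mu> n)" for n
    unfolding \<mu>_def by (rule prob_space.prob_space_distr) (auto simp: measure_pmf.prob_space_axioms)
  have sb: "sets (\<mu> n) = sets borel" for n by (simp add: \<mu>_def)
  have int3: "integrable (\<mu> n) (\<lambda>x. \<bar>x\<bar> ^ 3)" for n
    unfolding \<mu>_def by (subst integrable_distr_eq) (auto intro!: integral_fin_pmf(2) p'0 p'1)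
  have int: "(\<integral>x. f x \<partial>\<mu> n) = (\<Sum>i<d n. p n i * f (X n i))" if "n < N" "f \<in> borel_measurable borel" for n and f :: "real \<Rightarrow> real"
  proof -
    have "(\<integral>x. f x \<partial>\<mu> n) = (\<integral>i. f (X n i) \<partial>measure_pmf (fin_pmf (d' n) (p' n)))"
      unfolding \<mu>_def by (rule integral_distr) (use that in auto)
    also have "\<dots> = (\<Sum>i<d' n. p' n i * f (X n i))" by (rule integral_fin_pmf(1)) (auto simp: p'0 p'1)
    finally show ?thesis using that by (simp add: p'_def d'_def)
  qed
  have factors: "\<forall>n<N. d n > 0 \<and> unitary_basis (d n) (U n) \<and> \<rho> n = spec (d n) (U n) (p n) \<and> H n = spec (d n) (U n) (e n)"
    using diag sub by blast
  obtain D K \<phi> where D: "D > 0" and K: "unitary_basis D K"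
    and \<phi>0: "bij_betw \<phi> {..<D} (PiE {0..<N} (\<lambda>n. {..<d n}))"
    and R0: "kron_list (map \<rho> [0..<N]) = spec D K (\<lambda>i. \<Prod>n\<in>{0..<N}. p n (\<phi> i n))"
    and H0: "ham_sum (map H [0..<N]) = spec D K (\<lambda>i. \<Sum>n\<in>{0..<N}. e n (\<phi> i n))"
    using product_system_spec[OF factors le0] by (elim exE conjE) (rule that)
  define P where "P i = (\<Prod>n<N. p n (\<phi> i n))" for i
  define Et where "Et i = (\<Sum>n<N. e n (\<phi> i n))" for i
  have \<phi>: "bij_betw \<phi> {..<D} (PiE {..<N} (\<lambda>n. {..<d n}))" using \<phi>0 by (simp add: atLeast0LessThan)
  have RP: "R = spec D K P" and HE: "ham_sum (map H [0..<N]) = spec D K Et"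
    unfolding R_def R0 H0 by (simp_all add: atLeast0LessThan P_def[abs_def] Et_def[abs_def])
  have \<phi>d: "\<phi> i n < d n" if "i < D" "n < N" for i n
    using \<phi> that by (auto simp: bij_betw_def)
  have P0: "P i \<ge> 0" if "i < D" for i unfolding P_def using p0 \<phi>d[OF that] by (intro prod_nonneg) auto
  have P1: "(\<Sum>i<D. P i) = 1" unfolding P_def sum_prod_reindex[OF \<phi>] using p1 by simp
  define G where "G = gibbs_weight \<beta> D Et"
  have Gpos: "G i > 0" for i unfolding G_def by (rule gibbs_weight_pos[OF D])
  have Gprod: "G i = (\<Prod>n<N. g n (\<phi> i n))" for i
  proof -
    have ex: "exp (- \<beta> * Et i) = (\<Prod>n<N. exp (- \<beta> * e n (\<phi> i n)))" for i
      unfolding Et_def sum_distrib_left by (simp add: exp_sum)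
    show ?thesis unfolding G_def gibbs_weight_def ex sum_prod_reindex[OF \<phi>, of "\<lambda>n j. exp (- \<beta> * e n j)"] g_def
      by (simp add: prod_dividef)
  qed
  define \<Lambda> where "\<Lambda> i = (\<Sum>n<N. X n (\<phi> i n))" for i
  \<comment> \<open>Restricted to positive \<open>P i\<close>, since elsewhere
    \<open>\<Lambda> i\<close> contains logarithms of 0.\<close>
  have PG: "P i = exp (\<Lambda> i) * G i" if i: "i < D" and "P i > 0" for i
  proof -
    have pp: "p n (\<phi> i n) > 0" if "n < N" for n
    proof -
      have "p n (\<phi> i n) \<noteq> 0" using \<open>P i > 0\<close> that unfolding P_def by (metis finite_lessThan lessThan_iff less_irrefl prod_zero)
      then show ?thesis using p0[OF that \<phi>d[OF i that]] by simp
    qed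
    have "exp (\<Lambda> i) * G i = (\<Prod>n<N. exp (X n (\<phi> i n)) * g n (\<phi> i n))"
      unfolding \<Lambda>_def Gprod by (simp add: exp_sum prod.distrib)
    also have "\<dots> = P i" unfolding P_def
    proof (intro prod.cong refl)
      fix n assume "n \<in> {..<N}"
      then show "exp (X n (\<phi> i n)) * g n (\<phi> i n) = p n (\<phi> i n)"
        using pp[of n] gpos[of n "\<phi> i n"] by (simp add: X_def exp_diff)
    qed
    finally show ?thesis ..
  qed
  obtain W E k where W: "unitary_basis dt W" and HtE: "Ht = spec dt W E" and k: "k < dt"
    and pv: "proj v = spec dt W (\<lambda>i. if i = k then 1 else 0)" and dv: "dim_vec v = dt"
    using target_diagonalisation[OF target] by blast
  define \<gamma> where "\<gamma> = gibbs_weight \<beta> dt E k"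
  have dt: "dt > 0" using k by simp
  have \<gamma>pos: "\<gamma> > 0" unfolding \<gamma>_def by (rule gibbs_weight_pos[OF dt])
  define Dt where "Dt = relD (proj v) (gibbs \<beta> Ht)"
  have "Dt = (\<Sum>j<dt. if j = k then - ln \<gamma> else 0)"
    unfolding Dt_def HtE unitary_basis.gibbs_spec'[OF W dt] pv unitary_basis.relD_spec[OF W]
    by (intro sum.cong refl) (simp add: \<gamma>_def)
  then have "Dt = - ln \<gamma>" using k by simp
  then have exD: "exp Dt * \<gamma> = 1" using \<gamma>pos by (simp add: exp_minus)
  have TD: "T = Dt - (\<Sum>n<N. m n)" by (simp add: T_def Dt_def)
  define F where "F y = measure (PiM {..<N} \<mu>) {f \<in> space (PiM {..<N} \<mu>). (\<Sum>n<N. f n - m n) \<le> y}" for y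
  have F: "F y = (\<Sum>i<D. P i * of_bool (\<Lambda> i - (\<Sum>n<N. m n) \<le> y))" for y
  proof -
    have \<phi>': "bij_betw \<phi> {..<D} (PiE {..<N} (\<lambda>n. {..<d' n}))"
    proof -
      have "PiE {..<N} (\<lambda>n. {..<d' n}) = PiE {..<N} (\<lambda>n. {..<d n})"
        by (rule PiE_cong) (simp add: d'_def)
      then show ?thesis using \<phi> by simp
    qed
    have "F y = (\<Sum>i<D. (\<Prod>n<N. p' n (\<phi> i n)) * of_bool ((\<Sum>n<N. X n (\<phi> i n) - m n) \<le> y))"
      unfolding F_def \<mu>_def by (rule PiM_fin_pmf(1)) (use p'0 p'1 \<phi>' in auto)
    then show ?thesis by (simp add: P_def p'_def \<Lambda>_def sum_subtractf)
  qed
  have lower: "infid (Ch R) (proj v) \<ge> 0" "infid (Ch R) (proj v) \<ge> F (T - s) - exp (- s)" if "Ch \<in> ops" for Ch s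
  proof -
    have Ch: "Ch \<in> thermal_ops \<beta> (spec D K Et) (spec dt W E)" using that unfolding ops_def HE HtE .
    have bound: "infid (Ch R) (proj v) \<ge> 1 - t * \<gamma> - (\<Sum>i<D. max 0 (P i - t * G i))" for t
      unfolding RP \<gamma>_def G_def by (rule thermal_op_infid_ge[OF K W D k _ dv pv Ch]) (rule P0)
    \<comment> \<open>The trivial test \<open>t = 0\<close> shows that the infidelity is
      nonnegative.\<close>
    have "(\<Sum>i<D. max 0 (P i - 0 * G i)) = 1" unfolding P1[symmetric] by (intro sum.cong) (use P0 in auto)
    then show "infid (Ch R) (proj v) \<ge> 0" using bound[of 0] by simp
    \<comment> \<open>The test threshold \<open>t = exp (Dt - s)\<close> lies a factor
      \<open>exp (- s)\<close> below the likelihood ratio \<open>1 / \<gamma>\<close>, which makes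
      the Gibbs term \<open>exp (- s)\<close>.\<close>
    have t: "exp (Dt - s) * \<gamma> = exp (- s)" using exD by (simp add: exp_diff exp_minus field_simps)
    have "(\<Sum>i<D. max 0 (P i - exp (Dt - s) * G i)) \<le> (\<Sum>i<D. P i - P i * of_bool (\<Lambda> i - (\<Sum>n<N. m n) \<le> T - s))"
    proof (intro sum_mono)
      fix i assume "i \<in> {..<D}"
      then have i: "i < D" by simp
      show "max 0 (P i - exp (Dt - s) * G i) \<le> P i - P i * of_bool (\<Lambda> i - (\<Sum>n<N. m n) \<le> T - s)"
      proof (cases "\<Lambda> i \<le> Dt - s")
        case True
        have "P i \<le> exp (Dt - s) * G i"
        proof (cases "P i = 0")
          case False
          then have "P i = exp (\<Lambda> i) * G i" using PG[OF i] P0[OF i] by simp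
          then show ?thesis using True Gpos[of i] by simp
        qed (use Gpos[of i] in simp)
        then show ?thesis using True by (simp add: TD)
      next
        case False
        have "exp (Dt - s) * G i \<ge> 0" using Gpos[of i] by simp
        then show ?thesis using False P0[OF i] by (simp add: TD)
      qed
    qed
    also have "\<dots> = 1 - F (T - s)" unfolding F sum_subtractf P1 ..
    finally show "infid (Ch R) (proj v) \<ge> F (T - s) - exp (- s)"
      using bound[of "exp (Dt - s)"] t by simp
  qed
  have upper: "\<exists>y<T. \<forall>\<epsilon>>0. \<exists>Ch\<in>ops. infid (Ch R) (proj v) \<le> F y + \<epsilon>"
    if var: "(\<Sum>n<N. relV (\<rho> n) (gibbs \<beta> (H n))) > 0"
  proof -
    define s where "s i \<longleftrightarrow> P i > 0 \<and> \<Lambda> i \<ge> Dt" for i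
    have GP: "G i \<le> \<gamma> * P i" if "i < D" "s i" for i
    proof -
      have "exp Dt * G i \<le> exp (\<Lambda> i) * G i" using that Gpos[of i] by (simp add: s_def)
      also have "\<dots> = P i" using PG[of i] that by (simp add: s_def)
      finally have "\<gamma> * (exp Dt * G i) \<le> \<gamma> * P i" using \<gamma>pos by simp
      moreover have "\<gamma> * (exp Dt * G i) = G i" using exD by (simp add: mult_ac)
      ultimately show ?thesis by simp
    qed
    have Ps: "(\<Sum>i<D. P i * of_bool (s i)) \<le> (\<Sum>i<D. P i)" by (intro sum_mono) (use P0 in auto)
    have le: "(\<Sum>i<D. G i * of_bool (s i)) \<le> (\<Sum>i<D. \<gamma> * (P i * of_bool (s i)))" using GP by (intro sum_mono) auto
    \<comment> \<open>Without strictness all of \<open>P\<close> would sit on \<open>s\<close> with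
      \<open>G i = \<gamma> * P i\<close> there, so \<open>\<Lambda>\<close> would be constant on
      the support of \<open>P\<close>.\<close>
    have gap: "(\<Sum>i<D. G i * of_bool (s i)) < \<gamma>"
    proof (rule ccontr)
      assume "\<not> ?thesis"
      then have ge: "\<gamma> \<le> (\<Sum>i<D. G i * of_bool (s i))" by simp
      have eqP: "(\<Sum>i<D. P i * of_bool (s i)) = (\<Sum>i<D. P i)"
      proof (rule antisym[OF Ps])
        have "\<gamma> * 1 \<le> \<gamma> * (\<Sum>i<D. P i * of_bool (s i))" using order_trans[OF ge le] by (simp only: sum_distrib_left mult_1_right)
        then show "(\<Sum>i<D. P i) \<le> (\<Sum>i<D. P i * of_bool (s i))" unfolding P1 using \<gamma>pos by simp
      qed
      have eqG: "(\<Sum>i<D. G i * of_bool (s i)) = (\<Sum>i<D. \<gamma> * (P i * of_bool (s i)))"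
      proof (rule antisym[OF le])
        show "(\<Sum>i<D. \<gamma> * (P i * of_bool (s i))) \<le> (\<Sum>i<D. G i * of_bool (s i))"
          unfolding sum_distrib_left[symmetric] eqP P1 using ge by simp
      qed
      have const: "\<Lambda> i = Dt" if i: "i < D" and Pi: "P i > 0" for i
      proof -
        have "\<forall>i\<in>{..<D}. P i - P i * of_bool (s i) = 0"
          using eqP P0 by (subst sum_nonneg_eq_0_iff[symmetric]) (auto simp: sum_subtractf)
        then have "P i - P i * of_bool (s i) = 0" using i by blast
        then have si: "s i" using Pi by (cases "s i") auto
        have "\<forall>i\<in>{..<D}. \<gamma> * (P i * of_bool (s i)) - G i * of_bool (s i) = 0"
          using eqG GP by (subst sum_nonneg_eq_0_iff[symmetric]) (auto simp: sum_subtractf)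
        then have "\<gamma> * (P i * of_bool (s i)) - G i * of_bool (s i) = 0" using i by blast
        then have "G i = \<gamma> * P i" using si by simp
        then have "exp (\<Lambda> i) * (\<gamma> * P i) = P i" using PG[OF i Pi] by simp
        then have "exp (\<Lambda> i) * \<gamma> = 1" using Pi by simp
        then have "exp (\<Lambda> i) = exp Dt" using exD \<gamma>pos by (metis less_irrefl mult_right_cancel)
        then show ?thesis by simp
      qed
      have "relV (\<rho> n) (gibbs \<beta> (H n)) = 0" if "n < N" for n
        unfolding V[OF that] mD[OF that]
        by (rule product_not_constant[OF p0 p1 \<phi> _ that, of X Dt]) (use const in \<open>auto simp: P_def \<Lambda>_def\<close>)
      then show False using var by simp
    qed
    \<comment> \<open>Its maximum separates \<open>T\<close> from all values of the centred ratio
      below \<open>T\<close>, which are finitely many; \<open>T - 1\<close> keeps the set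
      nonempty.\<close>
    define A where "A = insert (T - 1) ((\<lambda>i. \<Lambda> i - (\<Sum>n<N. m n)) ` {i. i < D \<and> \<Lambda> i < Dt})"
    have finA: "finite A" by (simp add: A_def)
    have yT: "Max A < T" using finA by (subst Max_less_iff) (auto simp: A_def TD)
    have Fy: "F (Max A) = 1 - (\<Sum>i<D. P i * of_bool (s i))"
    proof -
      have "F (Max A) = (\<Sum>i<D. P i - P i * of_bool (s i))" unfolding F
      proof (intro sum.cong refl)
        fix i assume "i \<in> {..<D}"
        then have i: "i < D" by simp
        have "\<Lambda> i - (\<Sum>n<N. m n) \<le> Max A \<longleftrightarrow> \<Lambda> i < Dt"
        proof
          assume "\<Lambda> i < Dt"
          then show "\<Lambda> i - (\<Sum>n<N. m n) \<le> Max A" using i finA by (intro Max_ge) (auto simp: A_def)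
        qed (use yT TD in simp)
        then show "P i * of_bool (\<Lambda> i - (\<Sum>n<N. m n) \<le> Max A) = P i - P i * of_bool (s i)"
          using P0[OF i] by (auto simp: s_def)
      qed
      then show ?thesis unfolding sum_subtractf P1 .
    qed
    show ?thesis
    proof (intro exI[of _ "Max A"] conjI allI impI yT)
      fix \<epsilon> :: real assume "\<epsilon> > 0"
      then show "\<exists>Ch\<in>ops. infid (Ch R) (proj v) \<le> F (Max A) + \<epsilon>"
        using thermal_distillation_error[OF K W D k P0 P1 dv pv, where s = s and \<epsilon> = \<epsilon> and \<beta> = \<beta> and E = Et and E' = E] gap
        unfolding ops_def HE HtE RP Fy \<gamma>_def G_def by blast
    qed
  qed
  show ?thesis
    unfolding Let_def
    by (rule exI[of _ \<mu>]) (use ps sb int3 int lower upper mD V Y in \<open>auto simp: F_def[abs_def]\<close>)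
qed

section \<open>Asymptotics\<close>

lemma Phi_surj:
  assumes "0 < b" "b < 1"
  obtains z where "Phi z = b"
proof -
  have "\<forall>\<^sub>F u in at_bot. Phi u < b" using order_tendstoD(2)[OF Phi_at_bot] assms by simp
  then obtain u where u: "Phi u < b" by (auto simp: eventually_at_bot_linorder)
  have "\<forall>\<^sub>F w in at_top. b < Phi w" using order_tendstoD(1)[OF Phi_at_top] assms by simp
  then obtain w where w: "b < Phi w" by (auto simp: eventually_at_top_linorder)
  have "u \<le> w" using u w Phi_strict_mono[of w u] by (meson less_asym less_trans not_le)
  then have "\<exists>z\<ge>u. z \<le> w \<and> Phi z = b" using u w isCont_Phi by (intro IVT) auto
  then show ?thesis using that by blast
qed

text \<open>\<open>Phi\<close> is continuous and strictly increasing, so \<open>G N (y N)\<close> can be compared with \<open>G N z\<close> for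
  constants \<open>z\<close> with \<open>Phi z\<close> close to \<open>L\<close>; no convergence of \<open>y N\<close> itself is needed.\<close>
lemma cdf_tendsto_along_sequence:
  fixes G :: "nat \<Rightarrow> real \<Rightarrow> real"
  assumes conv: "\<And>y. (\<lambda>N. G N y) \<longlonglongrightarrow> Phi y" and mono: "\<And>N. mono (G N)"
    and range: "\<And>N y. 0 \<le> G N y" "\<And>N y. G N y \<le> 1"
    and lim: "(\<lambda>N. Phi (y N)) \<longlonglongrightarrow> L"
  shows "(\<lambda>N. G N (y N)) \<longlonglongrightarrow> L"
proof (rule order_tendstoI)
  fix a assume aL: "a < L"
  have L1: "L \<le> 1" by (rule LIMSEQ_le_const2[OF lim]) (use Phi_le_1 in auto)
  show "\<forall>\<^sub>F N in sequentially. a < G N (y N)"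
  proof (cases "a < 0")
    case True
    then show ?thesis using range(1) by (intro always_eventually) (meson less_le_trans)
  next
    case False
    \<comment> \<open>Strictly inside the unit interval, hence a value of \<open>Phi\<close>; it
      leaves room on both sides, against \<open>a\<close> for \<open>G N z\<close> and against
      \<open>L\<close> for \<open>Phi (y N)\<close>.\<close>
    define b where "b = (a + L) / 2"
    have b: "a < b" "b < L" "0 < b" "b < 1" using aL False L1 by (auto simp: b_def)
    obtain z where z: "Phi z = b" using Phi_surj[OF b(3,4)] .
    have "\<forall>\<^sub>F N in sequentially. b < Phi (y N)" using order_tendstoD(1)[OF lim b(2)] .
    moreover have "\<forall>\<^sub>F N in sequentially. a < G N z" using order_tendstoD(1)[OF conv[of z]] b(1) z by simp
    ultimately show ?thesis
    proof eventually_elim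
      case (elim N)
      then have "z \<le> y N" using Phi_strict_mono[of "y N" z] z by (meson less_asym not_le)
      then show ?case using elim(2) monoD[OF mono] by (meson less_le_trans)
    qed
  qed
next
  fix a assume aL: "L < a"
  have L0: "0 \<le> L" by (rule LIMSEQ_le_const[OF lim]) (use Phi_ge_0 in auto)
  show "\<forall>\<^sub>F N in sequentially. G N (y N) < a"
  proof (cases "1 < a")
    case True
    then show ?thesis using range(2) by (intro always_eventually) (meson le_less_trans)
  next
    case False
    define b where "b = (a + L) / 2"
    have b: "b < a" "L < b" "0 < b" "b < 1" using aL False L0 by (auto simp: b_def)
    obtain z where z: "Phi z = b" using Phi_surj[OF b(3,4)] .
    have "\<forall>\<^sub>F N in sequentially. Phi (y N) < b" using order_tendstoD(2)[OF lim b(2)] .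
    moreover have "\<forall>\<^sub>F N in sequentially. G N z < a" using order_tendstoD(2)[OF conv[of z]] b(1) z by simp
    ultimately show ?thesis
    proof eventually_elim
      case (elim N)
      then have "y N \<le> z" using Phi_strict_mono[of z "y N"] z by (meson less_asym not_le)
      then show ?case using elim(2) monoD[OF mono] by (meson le_less_trans)
    qed
  qed
qed

theorem mainTheorem1:
  fixes \<beta> :: real
    and d :: "nat \<Rightarrow> nat \<Rightarrow> nat"          \<comment> \<open>d N n: dimension of subsystem n (n < N)\<close>
    and H :: "nat \<Rightarrow> nat \<Rightarrow> complex mat"    \<comment> \<open>H N n: Hamiltonian H^N_n\<close>
    and \<rho> :: "nat \<Rightarrow> nat \<Rightarrow> complex mat"    \<comment> \<open>\<rho> N n: state \<rho>^N_n\<close>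
    and dt :: "nat \<Rightarrow> nat"                  \<comment> \<open>target dimension\<close>
    and Ht :: "nat \<Rightarrow> complex mat"          \<comment> \<open>target Hamiltonian\<close>
    and v :: "nat \<Rightarrow> complex Matrix.vec"    \<comment> \<open>target eigenvector |E^N_k>\<close>
  defines "sig2 \<equiv> \<lambda>N. (1 / \<beta>^2) * (\<Sum>n<N. relV (\<rho> N n) (gibbs \<beta> (H N n)))"
    and "kap3 \<equiv> \<lambda>N. (1 / \<beta>^3) * (\<Sum>n<N. relY (\<rho> N n) (gibbs \<beta> (H N n)))"
    and "dF \<equiv> \<lambda>N. (1 / \<beta>) * ((\<Sum>n<N. relD (\<rho> N n) (gibbs \<beta> (H N n)))
                                  - relD (proj (v N)) (gibbs \<beta> (Ht N)))"
    and "rhoN \<equiv> \<lambda>N. kron_list (map (\<rho> N) [0..<N])"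
    and "HN \<equiv> \<lambda>N. ham_sum (map (H N) [0..<N])"
    and "eps \<equiv> \<lambda>N. Inf {infid (Ch (kron_list (map (\<rho> N) [0..<N]))) (proj (v N)) | Ch.
                    Ch \<in> thermal_ops \<beta> (ham_sum (map (H N) [0..<N])) (Ht N)}"
  assumes beta_pos: "0 < \<beta>"
    and sub: "\<And>N n. n < N \<Longrightarrow> 0 < d N n \<and> H N n \<in> carrier_mat (d N n) (d N n) \<and> hermitian (H N n)"
    and states: "\<And>N n. n < N \<Longrightarrow> density_op (d N n) (\<rho> N n)"
    and incoherent: "\<And>N n. n < N \<Longrightarrow> \<rho> N n * H N n = H N n * \<rho> N n"
    and target: "\<And>N. Ht N \<in> carrier_mat (dt N) (dt N) \<and> hermitian (Ht N)"
    and eigvec: "\<And>N. \<exists>e. eigenvector (Ht N) (v N) e"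
    and normalized: "\<And>N. (\<Sum>i<dt N. (cmod (v N $ i))^2) = 1"
    and rational_init: "\<And>N n a. n < N \<Longrightarrow> eigenvalue (gibbs \<beta> (H N n)) a \<Longrightarrow> a \<in> \<rat>"
    and rational_target: "\<And>N a. eigenvalue (gibbs \<beta> (Ht N)) a \<Longrightarrow> a \<in> \<rat>"
    and lim_sig: "\<exists>s. (\<lambda>N. sig2 N / real N) \<longlonglongrightarrow> s \<and> s \<noteq> 0"
    and lim_kap: "\<exists>k. (\<lambda>N. kap3 N / real N) \<longlonglongrightarrow> k \<and> k \<noteq> 0"
  shows "(\<forall>C. berry_esseen_const C \<longrightarrow>
            (\<forall>N. 0 < sig2 N \<longrightarrow>
               (\<exists>Ch \<in> thermal_ops \<beta> (HN N) (Ht N).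
                  infid (Ch (rhoN N)) (proj (v N))
                    \<le> Phi (- dF N / sqrt (sig2 N)) + C * kap3 N / sqrt (sig2 N) ^ 3)))
       \<and> (\<forall>L. (\<lambda>N. Phi (- dF N / sqrt (sig2 N))) \<longlonglongrightarrow> L \<longrightarrow> eps \<longlonglongrightarrow> L)"
proof -
  define m where "m N n = relD (\<rho> N n) (gibbs \<beta> (H N n))" for N n
  define V where "V N = (\<Sum>n<N. relV (\<rho> N n) (gibbs \<beta> (H N n)))" for N
  define Y where "Y N = (\<Sum>n<N. relY (\<rho> N n) (gibbs \<beta> (H N n)))" for N
  \<comment> \<open>This is \<open>- \<beta> * dF N\<close>, the threshold for the centred
    log-likelihood ratio; the factors of \<open>\<beta>\<close> cancel in \<open>x_eq\<close> and
    \<open>ratio\<close>.\<close>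
  define T where "T N = relD (proj (v N)) (gibbs \<beta> (Ht N)) - (\<Sum>n<N. m N n)" for N
  define ops where "ops N = thermal_ops \<beta> (HN N) (Ht N)" for N
  define err where "err N Ch = infid (Ch (rhoN N)) (proj (v N))" for N and Ch :: "complex mat \<Rightarrow> complex mat"
  define Q where "Q N \<mu> \<longleftrightarrow>
    (\<forall>n. prob_space (\<mu> n) \<and> sets (\<mu> n) = sets borel \<and> integrable (\<mu> n) (\<lambda>x. \<bar>x\<bar> ^ 3)) \<and>
    (\<forall>n<N. (\<integral>x. x \<partial>\<mu> n) = m N n \<and> (\<integral>x. (x - m N n)\<^sup>2 \<partial>\<mu> n) = relV (\<rho> N n) (gibbs \<beta> (H N n)) \<and>
      (\<integral>x. \<bar>x - m N n\<bar> ^ 3 \<partial>\<mu> n) = relY (\<rho> N n) (gibbs \<beta> (H N n))) \<and>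
    (let F = \<lambda>y. measure (PiM {..<N} \<mu>) {f \<in> space (PiM {..<N} \<mu>). (\<Sum>n<N. f n - m N n) \<le> y} in
      (V N > 0 \<longrightarrow> (\<exists>y<T N. \<forall>\<epsilon>>0. \<exists>Ch\<in>ops N. err N Ch \<le> F y + \<epsilon>)) \<and>
      (\<forall>Ch\<in>ops N. err N Ch \<ge> 0 \<and> (\<forall>s. err N Ch \<ge> F (T N - s) - exp (- s))))" for N and \<mu> :: "nat \<Rightarrow> real measure"
  have "\<exists>\<mu>. Q N \<mu>" for N
  proof -
    obtain c where "eigenvector (Ht N) (v N) c" using eigvec by blast
    then show ?thesis
      unfolding Q_def ops_def err_def T_def V_def m_def rhoN_def HN_def
      by (intro single_shot_error[of N "d N" "H N" "\<rho> N" "Ht N" "dt N" "v N"])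
         (use sub states incoherent target normalized in auto)
  qed
  then obtain \<mu> where Q: "\<And>N. Q N (\<mu> N)" by metis
  define F where "F N y = measure (PiM {..<N} (\<mu> N))
    {f \<in> space (PiM {..<N} (\<mu> N)). (\<Sum>n<N. f n - m N n) \<le> y}" for N y
  have prob: "prob_space (\<mu> N n)" and sets: "sets (\<mu> N n) = sets borel"
    and int3: "integrable (\<mu> N n) (\<lambda>x. \<bar>x\<bar> ^ 3)" for N n
    using Q[of N] unfolding Q_def by blast+
  have mean: "(\<integral>x. x \<partial>\<mu> N n) = m N n" and var: "(\<integral>x. (x - m N n)\<^sup>2 \<partial>\<mu> N n) = relV (\<rho> N n) (gibbs \<beta> (H N n))"
    and third: "(\<integral>x. \<bar>x - m N n\<bar> ^ 3 \<partial>\<mu> N n) = relY (\<rho> N n) (gibbs \<beta> (H N n))" if "n < N" for N n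
    using Q[of N] that unfolding Q_def by blast+
  have upper: "\<exists>y<T N. \<forall>\<epsilon>>0. \<exists>Ch\<in>ops N. err N Ch \<le> F N y + \<epsilon>" if "V N > 0" for N
    using Q[of N] that unfolding Q_def Let_def F_def by blast
  have lower: "err N Ch \<ge> 0" "err N Ch \<ge> F N (T N - s) - exp (- s)" if "Ch \<in> ops N" for N Ch s
    using Q[of N] that unfolding Q_def Let_def F_def by blast+
  have Veq: "(\<Sum>n<N. \<integral>x. (x - (\<integral>x. x \<partial>\<mu> N n))\<^sup>2 \<partial>\<mu> N n) = V N" for N
    unfolding V_def by (intro sum.cong) (auto simp: mean var)
  have Yeq: "(\<Sum>n<N. \<integral>x. \<bar>x - (\<integral>x. x \<partial>\<mu> N n)\<bar> ^ 3 \<partial>\<mu> N n) = Y N" for N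
    unfolding Y_def by (intro sum.cong) (auto simp: mean third)
  have Feq: "measure (PiM {..<N} (\<mu> N)) {f \<in> space (PiM {..<N} (\<mu> N)). (\<Sum>n<N. f n - (\<integral>x. x \<partial>\<mu> N n)) \<le> y} = F N y" for N y
    unfolding F_def by (intro arg_cong[where f = "measure _"] Collect_cong conj_cong refl)
      (simp add: mean cong: sum.cong_simp)
  have V0: "V N \<ge> 0" for N unfolding Veq[symmetric] by (intro sum_nonneg) simp
  have sig2: "sig2 N = V N / \<beta>\<^sup>2" and kap3: "kap3 N = Y N / \<beta> ^ 3" and dF: "dF N = - T N / \<beta>" for N
    unfolding sig2_def kap3_def dF_def V_def Y_def T_def m_def by (simp_all add: field_simps)
  have x_eq: "- dF N / sqrt (sig2 N) = T N / sqrt (V N)" for N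
    unfolding dF sig2 using beta_pos by (simp add: real_sqrt_divide)
  have cube: "V N powr (3/2) = sqrt (V N) ^ 3" for N
  proof (cases "V N = 0")
    case False
    then have "V N powr (3/2) = (V N powr (1/2)) powr 3" using V0 by (simp add: powr_powr)
    then show ?thesis using V0[of N] False by (simp add: powr_half_sqrt powr_numeral)
  qed simp
  have ratio: "kap3 N / sqrt (sig2 N) ^ 3 = Y N / V N powr (3/2)" for N
    unfolding kap3 sig2 cube using beta_pos by (simp add: real_sqrt_divide power_divide)
  have pos: "V N > 0" if "sig2 N > 0" for N
    using that beta_pos unfolding sig2 by (simp add: zero_less_divide_iff)

  \<comment> \<open>The bound at fixed \<open>N\<close>\<close>
  have part1: "\<exists>Ch \<in> thermal_ops \<beta> (HN N) (Ht N). infid (Ch (rhoN N)) (proj (v N))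
      \<le> Phi (- dF N / sqrt (sig2 N)) + C * kap3 N / sqrt (sig2 N) ^ 3"
    if C: "berry_esseen_const C" and "0 < sig2 N" for C N
  proof -
    have VN: "V N > 0" by (rule pos) fact
    obtain y where y: "y < T N" "\<And>\<epsilon>. \<epsilon> > 0 \<Longrightarrow> \<exists>Ch\<in>ops N. err N Ch \<le> F N y + \<epsilon>" using upper[OF VN] by blast
    have "\<bar>F N (y / sqrt (V N) * sqrt (V N)) - Phi (y / sqrt (V N))\<bar> \<le> C * Y N / V N powr (3/2)"
      using C[unfolded berry_esseen_const_def Let_def, rule_format, of N "\<mu> N" "y / sqrt (V N)"] prob sets int3 VN
      unfolding Veq Yeq Feq by blast
    then have BE: "F N y \<le> Phi (y / sqrt (V N)) + C * Y N / V N powr (3/2)" using VN by simp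
    \<comment> \<open>Berry--Esseen is applied at \<open>y\<close> below \<open>T N\<close>; the
      resulting gap between the two values of \<open>Phi\<close> is the tolerance granted to the
      bath.\<close>
    have "Phi (y / sqrt (V N)) < Phi (T N / sqrt (V N))"
      using y(1) VN by (intro Phi_strict_mono divide_strict_right_mono) auto
    then obtain Ch where "Ch \<in> ops N" "err N Ch \<le> F N y + (Phi (T N / sqrt (V N)) - Phi (y / sqrt (V N)))"
      using y(2)[of "Phi (T N / sqrt (V N)) - Phi (y / sqrt (V N))"] by auto
    moreover have "C * kap3 N / sqrt (sig2 N) ^ 3 = C * Y N / V N powr (3/2)"
      using ratio[of N] by (metis times_divide_eq_right)
    ultimately show ?thesis using BE unfolding ops_def err_def x_eq by (intro bexI[of _ Ch]) auto
  qed

  \<comment> \<open>The limit of the optimal error\<close>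
  have part2: "eps \<longlonglongrightarrow> L" if lim: "(\<lambda>N. Phi (- dF N / sqrt (sig2 N))) \<longlonglongrightarrow> L" for L
  proof -
    obtain s where s: "(\<lambda>N. sig2 N / real N) \<longlonglongrightarrow> s" "s \<noteq> 0" using lim_sig by blast
    obtain k where k: "(\<lambda>N. kap3 N / real N) \<longlonglongrightarrow> k" using lim_kap by blast
    have "s \<ge> 0" by (rule LIMSEQ_le_const[OF s(1)]) (use V0 in \<open>auto simp: sig2\<close>)
    then have s0: "s > 0" using s(2) by simp
    have evV: "\<forall>\<^sub>F N in sequentially. 0 < V N"
      using order_tendstoD(1)[OF s(1) s0]
    proof eventually_elim
      case (elim N)
      then have "sig2 N > 0" using V0[of N] by (cases "sig2 N = 0") (auto simp: sig2 zero_less_divide_iff)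
      then show ?case by (rule pos)
    qed
    have rootN: "(\<lambda>N. 1 / sqrt (real N)) \<longlonglongrightarrow> 0" by real_asymp
    \<comment> \<open>The Lyapunov ratio is a convergent factor times
      \<open>1 / sqrt (real N)\<close>.\<close>
    have "(\<lambda>N. (kap3 N / real N) / sqrt (sig2 N / real N) ^ 3 * (1 / sqrt (real N))) \<longlonglongrightarrow> k / sqrt s ^ 3 * 0"
      using s0 by (intro tendsto_mult tendsto_divide k tendsto_power tendsto_real_sqrt s(1) rootN) auto
    moreover have "\<forall>\<^sub>F N in sequentially. (kap3 N / real N) / sqrt (sig2 N / real N) ^ 3 * (1 / sqrt (real N)) = Y N / V N powr (3/2)"
      using eventually_gt_at_top[of 0]
    proof eventually_elim
      case (elim N)
      have "sqrt (real N) ^ 3 = real N * sqrt (real N)" by (simp add: power3_eq_cube)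
      then have "(kap3 N / real N) / sqrt (sig2 N / real N) ^ 3 * (1 / sqrt (real N)) = kap3 N / sqrt (sig2 N) ^ 3"
        using elim by (simp add: real_sqrt_divide power_divide)
      then show ?case unfolding ratio .
    qed
    ultimately have lyap: "(\<lambda>N. Y N / V N powr (3/2)) \<longlonglongrightarrow> 0"
      using Lim_transform_eventually by force
    have clt: "(\<lambda>N. F N (y * sqrt (V N))) \<longlonglongrightarrow> Phi y" for y
      using lyapunov_clt[of \<mu> y] prob sets int3 evV lyap unfolding Veq Yeq Feq by blast
    define G where "G N y = F N (y * sqrt (V N))" for N y
    have Fmono: "F N y \<le> F N z" if "y \<le> z" for N y z
    proof -
      have "{f \<in> space (PiM {..<N} (\<mu> N)). (\<Sum>n<N. f n - m N n) \<le> z} \<in> sets (PiM {..<N} (\<mu> N))"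
      proof -
        have [measurable_cong]: "sets (\<mu> N n) = sets borel" for n by (rule sets)
        show ?thesis by measurable
      qed
      then show ?thesis
        unfolding F_def using that
        by (intro finite_measure.finite_measure_mono prob_space.finite_measure prob_space_PiM prob) auto
    qed
    have F01: "0 \<le> F N y" "F N y \<le> 1" for N y
    proof -
      interpret prob_space "PiM {..<N} (\<mu> N)" by (rule prob_space_PiM) (rule prob)
      show "0 \<le> F N y" "F N y \<le> 1" unfolding F_def by simp_all
    qed
    have G: "(\<lambda>N. G N (z N)) \<longlonglongrightarrow> L" if "(\<lambda>N. Phi (z N)) \<longlonglongrightarrow> L" for z
      by (rule cdf_tendsto_along_sequence[OF _ _ _ _ that])
         (auto simp: G_def clt F01 V0 intro!: monoI Fmono mult_right_mono)
    \<comment> \<open>The fourth root of \<open>N\<close> diverges, so \<open>exp (- r N)\<close>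
      vanishes, yet is negligible against \<open>sqrt (V N)\<close>, which grows like the square
      root of \<open>N\<close>.\<close>
    define r where "r N = sqrt (sqrt (real N))" for N
    have r_inf: "filterlim r at_top sequentially" unfolding r_def by real_asymp
    have shift: "(\<lambda>N. r N / sqrt (V N)) \<longlonglongrightarrow> 0"
    proof -
      have "(\<lambda>N. 1 / sqrt (sig2 N / real N) * (1 / \<beta>) * (1 / sqrt (sqrt (real N)))) \<longlonglongrightarrow> 1 / sqrt s * (1 / \<beta>) * 0"
      proof (intro tendsto_mult tendsto_divide tendsto_const tendsto_real_sqrt s(1))
        show "(\<lambda>N. 1 / sqrt (sqrt (real N))) \<longlonglongrightarrow> 0" by real_asymp
      qed (use s0 beta_pos in auto)
      moreover have "\<forall>\<^sub>F N in sequentially. 1 / sqrt (sig2 N / real N) * (1 / \<beta>) * (1 / sqrt (sqrt (real N))) = r N / sqrt (V N)"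
        using eventually_gt_at_top[of 0]
      proof eventually_elim
        case (elim N)
        have "sqrt (sig2 N / real N) = sqrt (V N) / (\<beta> * sqrt (real N))"
          using beta_pos by (simp add: sig2 real_sqrt_divide real_sqrt_mult)
        also have "sqrt (real N) = r N * r N" by (simp add: r_def)
        finally have "sqrt (sig2 N / real N) = sqrt (V N) / (\<beta> * (r N * r N))" .
        moreover have "r N > 0" using elim by (simp add: r_def)
        ultimately show ?case using beta_pos by (simp add: r_def[symmetric])
      qed
      ultimately show ?thesis using Lim_transform_eventually by force
    qed
    define x where "x N = T N / sqrt (V N)" for N
    have limx: "(\<lambda>N. Phi (x N)) \<longlonglongrightarrow> L" using lim unfolding x_eq x_def .
    have "(\<lambda>N. Phi (x N - r N / sqrt (V N)) - Phi (x N)) \<longlonglongrightarrow> 0"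
    proof (rule Lim_null_comparison[OF _ shift], intro always_eventually allI)
      fix N
      have nn: "r N / sqrt (V N) \<ge> 0" using V0[of N] by (simp add: r_def)
      have "Phi (x N - r N / sqrt (V N)) \<le> Phi (x N)"
        using nn Phi_strict_mono[of "x N - r N / sqrt (V N)" "x N"] by (cases "r N / sqrt (V N) = 0") auto
      then show "norm (Phi (x N - r N / sqrt (V N)) - Phi (x N)) \<le> r N / sqrt (V N)"
        using Phi_lipschitz[of "x N - r N / sqrt (V N)" "x N"] nn by simp
    qed
    then have "(\<lambda>N. Phi (x N - r N / sqrt (V N))) \<longlonglongrightarrow> L"
      using tendsto_add[OF _ limx] by fastforce
    then have lim_lower: "(\<lambda>N. G N (x N - r N / sqrt (V N)) - exp (- r N)) \<longlonglongrightarrow> L - 0"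
    proof (intro tendsto_diff G)
      show "(\<lambda>N. exp (- r N)) \<longlonglongrightarrow> 0"
        using filterlim_compose[OF exp_at_bot filterlim_compose[OF filterlim_uminus_at_bot_at_top r_inf]] .
    qed
    have eps: "eps N = Inf (err N ` ops N)" for N
      unfolding eps_def err_def ops_def rhoN_def HN_def by (intro arg_cong[where f = Inf]) auto
    \<comment> \<open>Both bounds evaluate the same normalised distribution function
      \<open>G N\<close>, at points that differ by the vanishing shift; \<open>V N > 0\<close> holds
      eventually, which is enough for the limit.\<close>
    have bounds: "G N (x N - r N / sqrt (V N)) - exp (- r N) \<le> eps N \<and> eps N \<le> G N (x N)" if VN: "V N > 0" for N
    proof
      obtain y where y: "y < T N" "\<And>\<epsilon>. \<epsilon> > 0 \<Longrightarrow> \<exists>Ch\<in>ops N. err N Ch \<le> F N y + \<epsilon>" using upper[OF VN] by blast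
      have ne: "ops N \<noteq> {}" using y(2)[of 1] by auto
      have bdd: "bdd_below (err N ` ops N)" using lower(1) by (intro bdd_belowI[of _ 0]) auto
      have "G N (x N - r N / sqrt (V N)) = F N (T N - r N)"
        using VN by (simp add: G_def x_def left_diff_distrib)
      then show "G N (x N - r N / sqrt (V N)) - exp (- r N) \<le> eps N"
        unfolding eps using ne lower(2) by (intro cInf_greatest) auto
      show "eps N \<le> G N (x N)"
      proof (rule field_le_epsilon)
        fix e :: real assume "e > 0"
        then obtain Ch where Ch: "Ch \<in> ops N" "err N Ch \<le> F N y + e" using y(2) by blast
        have "eps N \<le> err N Ch" unfolding eps using Ch(1) bdd by (intro cInf_lower) auto
        also have "\<dots> \<le> F N (T N) + e" using Ch(2) Fmono[of y "T N" N] y(1) by simp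
        also have "F N (T N) = G N (x N)" using VN by (simp add: G_def x_def)
        finally show "eps N \<le> G N (x N) + e" .
      qed
    qed
    show ?thesis
    proof (rule tendsto_sandwich[OF _ _ _ G[OF limx]])
      show "(\<lambda>N. G N (x N - r N / sqrt (V N)) - exp (- r N)) \<longlonglongrightarrow> L" using lim_lower by simp
    qed (use evV bounds in \<open>auto elim: eventually_mono\<close>)
  qed
  show ?thesis using part1 part2 by blast
qed

end
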